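(* Let $k$ be a field, let $G$ be a simple graph with vertex set $V_G$, and let $S \subset V_G$. Assume that $|S| \ge |V_G| - 3$. Then $G \cup W(S)$ is a sequentially Cohen-Macaulay graph (over $k$).
   Context: A simple graph $G=(V_G,E_G)$ is a finite graph with no loops or multiple edges. If $S=\{y_1,\dots,y_n\}\subset V_G$, then $G \cup W(S)$ denotes the graph obtained from $G$ by adding a whisker at each vertex of $S$: one adds $n$ new distinct vertices $x_1,\dots,x_n$ and the edges $x_1y_1,\dots,x_ny_n$. The edge ideal of a graph $G$ on vertices $x_1,\dots,x_n$ is $\mathcal{I}(G)=(x_ix_j \mid \{x_i,x_j\}\in E_G)\subset R=k[x_1,\dots,x_n]$, where the vertices are identified with the variables. A finitely generated graded $R$-module $M$ is sequentially Cohen-Macaulay if there is a filtration $0=M_0\subset M_1\subset\cdots\subset M_r=M$ by graded $R$-modules such that each $M_i/M_{i-1}$ is Cohen-Macaulay and $\dim M_i/M_{i-1}<\dim M_{i+1}/M_i$ for all $i$ (Krull dimension). A graph $G$ is sequentially Cohen-Macaulay (over $k$) if $R/\mathcal{I}(G)$ is a sequentially Cohen-Macaulay $R$-module. *)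

theory Defs
  imports "HOL-Algebra.Module" "HOL-Algebra.QuotRing" "HOL-Library.Poly_Mapping"
    "HOL-Library.Extended_Real"
begin

section \<open>Modules\<close>

definition self_module :: "('a, 'm) ring_scheme \<Rightarrow> ('a, 'a) module" where
  "self_module R = \<lparr>carrier = carrier R, mult = mult R, one = one R, zero = zero R,
     add = add R, smult = mult R\<rparr>"

text \<open>The record type of modules extends that of rings. The components \<open>mult\<close> and \<open>one\<close> of a
  module that is not an algebra carry no information, and nothing below depends on them.\<close>

definition quot_module :: "('a, 'b, 'm) module_scheme \<Rightarrow> 'b set \<Rightarrow> ('a, 'b set) module" where
  "quot_module M N = \<lparr>carrier = a_rcosets\<^bsub>M\<^esub> N, mult = rcoset_mult M N, one = N +>\<^bsub>M\<^esub> \<one>\<^bsub>M\<^esub>,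
     zero = N, add = set_add M, smult = (\<lambda>a X. \<Union>x\<in>X. N +>\<^bsub>M\<^esub> (a \<odot>\<^bsub>M\<^esub> x))\<rparr>"

definition module_span :: "('a, 'm) ring_scheme \<Rightarrow> ('a, 'b, 'n) module_scheme \<Rightarrow> 'b set \<Rightarrow> 'b set" where
  "module_span R M A = \<Inter>{N. submodule N R M \<and> A \<subseteq> N}"

definition finitely_generated :: "('a, 'm) ring_scheme \<Rightarrow> ('a, 'b, 'n) module_scheme \<Rightarrow> bool" where
  "finitely_generated R M \<longleftrightarrow>
     (\<exists>A. finite A \<and> A \<subseteq> carrier M \<and> module_span R M A = carrier M)"

definition annihilator :: "('a, 'm) ring_scheme \<Rightarrow> ('a, 'b, 'n) module_scheme \<Rightarrow> 'a set" where
  "annihilator R M = {a \<in> carrier R. \<forall>x\<in>carrier M. a \<odot>\<^bsub>M\<^esub> x = \<zero>\<^bsub>M\<^esub>}"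


section \<open>Dimension and depth\<close>

text \<open>Dimension and depth are extended reals so that the supremum of the empty set is \<open>-\<infinity>\<close>.
  Thus the zero ring and the zero module have dimension \<open>-\<infinity>\<close>.\<close>

definition krull_dim :: "('a, 'm) ring_scheme \<Rightarrow> ereal" where
  "krull_dim R =
     (SUP n \<in> {n. \<exists>P. (\<forall>i\<le>n. primeideal (P i) R) \<and> (\<forall>i<n. P i \<subset> P (Suc i))}. ereal (real n))"

definition module_dim :: "('a, 'm) ring_scheme \<Rightarrow> ('a, 'b, 'n) module_scheme \<Rightarrow> ereal" where
  "module_dim R M = krull_dim (R Quot annihilator R M)"

definition nonzerodivisor_on :: "('a, 'b, 'n) module_scheme \<Rightarrow> 'a \<Rightarrow> bool" where
  "nonzerodivisor_on M a \<longleftrightarrow> (\<forall>x\<in>carrier M. a \<odot>\<^bsub>M\<^esub> x = \<zero>\<^bsub>M\<^esub> \<longrightarrow> x = \<zero>\<^bsub>M\<^esub>)"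

text \<open>The submodule \<open>(a\<^sub>1, \<dots>, a\<^sub>r)M\<close>.\<close>

definition seq_submodule ::
  "('a, 'm) ring_scheme \<Rightarrow> ('a, 'b, 'n) module_scheme \<Rightarrow> 'a list \<Rightarrow> 'b set" where
  "seq_submodule R M as = module_span R M {a \<odot>\<^bsub>M\<^esub> x | a x. a \<in> set as \<and> x \<in> carrier M}"

definition regular_sequence ::
  "('a, 'm) ring_scheme \<Rightarrow> ('a, 'b, 'n) module_scheme \<Rightarrow> 'a list \<Rightarrow> bool" where
  "regular_sequence R M as \<longleftrightarrow>
     set as \<subseteq> carrier R \<and>
     (\<forall>i<length as. nonzerodivisor_on (quot_module M (seq_submodule R M (take i as))) (as ! i)) \<and>
     seq_submodule R M as \<noteq> carrier M"

definition depth ::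
  "('a, 'm) ring_scheme \<Rightarrow> 'a set \<Rightarrow> ('a, 'b, 'n) module_scheme \<Rightarrow> ereal" where
  "depth R J M =
     (SUP as \<in> {as. set as \<subseteq> J \<and> regular_sequence R M as}. ereal (real (length as)))"


section \<open>Polynomial rings and graded modules\<close>

type_synonym ('v, 'k) mpoly = "('v \<Rightarrow>\<^sub>0 nat) \<Rightarrow>\<^sub>0 'k"

text \<open>Exponent vectors are finitely supported functions \<open>'v \<Rightarrow>\<^sub>0 nat\<close>; the variables are the
  elements of the set \<open>V\<close> (the elements of the type \<open>'v\<close> outside \<open>V\<close> do not occur).\<close>

definition poly_ring :: "'v set \<Rightarrow> ('v, 'k::field) mpoly ring" where
  "poly_ring V = \<lparr>carrier = {p. \<forall>m\<in>Poly_Mapping.keys p. Poly_Mapping.keys m \<subseteq> V},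
     mult = (*), one = 1, zero = 0, add = (+)\<rparr>"

definition poly_var :: "'v \<Rightarrow> ('v, 'k::field) mpoly" where
  "poly_var v = Poly_Mapping.single (Poly_Mapping.single v 1) 1"

definition irrelevant_ideal :: "'v set \<Rightarrow> ('v, 'k::field) mpoly set" where
  "irrelevant_ideal V = Idl\<^bsub>poly_ring V\<^esub> (poly_var ` V)"

definition mon_degree :: "('v \<Rightarrow>\<^sub>0 nat) \<Rightarrow> nat" where
  "mon_degree m = (\<Sum>v\<in>Poly_Mapping.keys m. Poly_Mapping.lookup m v)"

definition poly_component :: "'v set \<Rightarrow> int \<Rightarrow> ('v, 'k::field) mpoly set" where
  "poly_component V d =
     {p \<in> carrier (poly_ring V). \<forall>m\<in>Poly_Mapping.keys p. int (mon_degree m) = d}"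

text \<open>A \<open>\<int>\<close>-grading of a module is given by its family of homogeneous components \<open>gr d\<close>.\<close>

definition graded_module ::
  "'v set \<Rightarrow> (('v, 'k::field) mpoly, 'b, 'n) module_scheme \<Rightarrow> (int \<Rightarrow> 'b set) \<Rightarrow> bool" where
  "graded_module V M gr \<longleftrightarrow>
     Module.module (poly_ring V) M \<and>
     (\<forall>d. subgroup (gr d) (add_monoid M)) \<and>
     (\<forall>x\<in>carrier M. \<exists>!f. (\<forall>d. f d \<in> gr d) \<and> finite {d. f d \<noteq> \<zero>\<^bsub>M\<^esub>} \<and>
        x = finsum M f {d. f d \<noteq> \<zero>\<^bsub>M\<^esub>}) \<and>
     (\<forall>d e. \<forall>a\<in>poly_component V d. \<forall>x\<in>gr e. a \<odot>\<^bsub>M\<^esub> x \<in> gr (d + e))"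

definition graded_submodule ::
  "'v set \<Rightarrow> (('v, 'k::field) mpoly, 'b, 'n) module_scheme \<Rightarrow> (int \<Rightarrow> 'b set) \<Rightarrow> 'b set \<Rightarrow> bool" where
  "graded_submodule V M gr N \<longleftrightarrow>
     submodule N (poly_ring V) M \<and> graded_module V (M\<lparr>carrier := N\<rparr>) (\<lambda>d. gr d \<inter> N)"

text \<open>To be used for finitely generated graded modules, where depth means depth with respect to
  the graded maximal ideal. The zero module is Cohen-Macaulay.\<close>

definition cohen_macaulay :: "'v set \<Rightarrow> (('v, 'k::field) mpoly, 'b, 'n) module_scheme \<Rightarrow> bool" where
  "cohen_macaulay V M \<longleftrightarrow>
     depth (poly_ring V) (irrelevant_ideal V) M = module_dim (poly_ring V) M"

text \<open>The submodule \<open>M\<^sub>i\<close> of the filtration is \<open>F i\<close>. The quotient \<open>F (i + 1) / F i\<close> is finitely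
  generated, since polynomial rings in finitely many variables are Noetherian.\<close>

definition sequentially_cohen_macaulay ::
  "'v set \<Rightarrow> (('v, 'k::field) mpoly, 'b, 'n) module_scheme \<Rightarrow> (int \<Rightarrow> 'b set) \<Rightarrow> bool" where
  "sequentially_cohen_macaulay V M gr \<longleftrightarrow>
     graded_module V M gr \<and> finitely_generated (poly_ring V) M \<and>
     (\<exists>r (F :: nat \<Rightarrow> 'b set).
        let Q = (\<lambda>i. quot_module (M\<lparr>carrier := F (Suc i)\<rparr>) (F i)) in
        F 0 = {\<zero>\<^bsub>M\<^esub>} \<and> F r = carrier M \<and>
        (\<forall>i\<le>r. graded_submodule V M gr (F i)) \<and>
        (\<forall>i<r. F i \<subset> F (Suc i)) \<and>
        (\<forall>i<r. cohen_macaulay V (Q i)) \<and>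
        (\<forall>i. Suc i < r \<longrightarrow>
           module_dim (poly_ring V) (Q i) < module_dim (poly_ring V) (Q (Suc i))))"


section \<open>Graphs\<close>

record 'v ugraph =
  vertices :: "'v set"
  edges :: "'v set set"

definition simple_graph :: "'v ugraph \<Rightarrow> bool" where
  "simple_graph G \<longleftrightarrow> finite (vertices G) \<and> (\<forall>e\<in>edges G. e \<subseteq> vertices G \<and> card e = 2)"

text \<open>The whisker at \<open>y \<in> S\<close> joins the old vertex \<open>Inl y\<close> to the new vertex \<open>Inr y\<close>.\<close>

definition whisker :: "'v ugraph \<Rightarrow> 'v set \<Rightarrow> ('v + 'v) ugraph" where
  "whisker G S = \<lparr>vertices = Inl ` vertices G \<union> Inr ` S,
     edges = (\<lambda>e. Inl ` e) ` edges G \<union> {{Inl y, Inr y} | y. y \<in> S}\<rparr>"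

definition edge_ideal :: "'v ugraph \<Rightarrow> ('v, 'k::field) mpoly set" where
  "edge_ideal G =
     Idl\<^bsub>poly_ring (vertices G)\<^esub> {poly_var u * poly_var v | u v. {u, v} \<in> edges G}"

definition sequentially_cm_graph :: "'k::field itself \<Rightarrow> 'v ugraph \<Rightarrow> bool" where
  "sequentially_cm_graph k G \<longleftrightarrow>
     (let V = vertices G;
          R = (poly_ring V :: ('v, 'k) mpoly ring);
          I = (edge_ideal G :: ('v, 'k) mpoly set)
      in sequentially_cohen_macaulay V (quot_module (self_module R) I)
           (\<lambda>d. (\<lambda>p. I +>\<^bsub>R\<^esub> p) ` poly_component V d))"


section \<open>Basic facts\<close>

lemma simple_graph_whisker:
  assumes "simple_graph G" "S \<subseteq> vertices G"
  shows "simple_graph (whisker G S)"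
  using assms finite_subset[OF assms(2)]
  by (fastforce simp: simple_graph_def whisker_def card_image card_insert_if)

lemma cring_poly_ring: "cring (poly_ring V :: ('v, 'k::field) mpoly ring)"
proof (rule cringI)
  show "abelian_group (poly_ring V :: ('v, 'k) mpoly ring)"
  proof (rule abelian_groupI)
    fix p :: "('v, 'k) mpoly" assume "p \<in> carrier (poly_ring V)"
    then have "- p \<in> carrier (poly_ring V)" by (simp add: poly_ring_def)
    then show "\<exists>q\<in>carrier (poly_ring V). q \<oplus>\<^bsub>poly_ring V\<^esub> p = \<zero>\<^bsub>poly_ring V\<^esub>"
      by (intro bexI[of _ "- p"]) (simp_all add: poly_ring_def)
  qed (use Poly_Mapping.keys_add in \<open>fastforce simp: poly_ring_def algebra_simps\<close>)+
  show "Group.comm_monoid (poly_ring V :: ('v, 'k) mpoly ring)"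
  proof (rule comm_monoidI)
    fix p q :: "('v, 'k) mpoly"
    assume pq: "p \<in> carrier (poly_ring V)" "q \<in> carrier (poly_ring V)"
    have "Poly_Mapping.keys m \<subseteq> V" if m: "m \<in> Poly_Mapping.keys (p * q)" for m
    proof -
      obtain a b where "m = a + b" "a \<in> Poly_Mapping.keys p" "b \<in> Poly_Mapping.keys q"
        using m Poly_Mapping.keys_mult[of p q] by blast
      then show ?thesis
        using pq Poly_Mapping.keys_add[of a b] by (fastforce simp: poly_ring_def)
    qed
    then show "p \<otimes>\<^bsub>poly_ring V\<^esub> q \<in> carrier (poly_ring V)" by (simp add: poly_ring_def)
  qed (simp_all add: poly_ring_def mult_ac)
qed (simp add: poly_ring_def distrib_right)

end

theory Submission
  imports Defs
begin

text \<open>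
  The edge ideal of a graph is the intersection of the primes \<open>P\<^sub>F = (x\<^sub>v | v \<notin> F)\<close> over the maximal
  independent sets \<open>F\<close>, the facets of the independence complex (\<open>edge_ideal_eq\<close>). The proof shows
  that this complex has a nonpure shelling, and that a nonpure shelling gives the required
  filtration.

  Algebra. Let \<open>N\<^sub>d\<close> be the intersection of the \<open>P\<^sub>F\<close> with \<open>|F| > d\<close>. The filtration of \<open>R/I\<close> by the
  \<open>N\<^sub>d/I\<close> has layers that are filtered in turn, along a shelling of the facets of size \<open>d\<close>, with
  factors isomorphic to \<open>R/P\<^sub>F\<close> (\<open>shelling_step\<close>). A layer therefore behaves like \<open>R/P\<^sub>F\<close>, a
  polynomial ring in \<open>d\<close> variables. A sequence that is regular on every \<open>R/P\<^sub>F\<close> with \<open>|F| = d\<close> is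
  regular on the layer (\<open>shelling_weakly_regular\<close>), and dropping the elements of a facet one by one
  gives a chain of \<open>d + 1\<close> primes. So depth and dimension are at least \<open>d\<close>. Both upper bounds come
  from one argument in the style of Coquand and Lombardi: any \<open>d + 1\<close> elements satisfy an algebraic
  relation modulo each \<open>P\<^sub>F\<close>, by counting monomials (\<open>algebraically_dependent\<close>), and the product of
  these relations annihilates the layer. If the elements formed a regular sequence, or separated the
  members of a chain of primes, they could be cancelled from the relation one after the other until
  a unit is left (\<open>relation_collapse\<close>).

  Combinatorics. Let \<open>T = V\<^sub>G - S\<close>, so that \<open>|T| \<le> 3\<close>. A facet contains exactly one end of every
  whisker; hence it is determined by its trace \<open>A\<close> on \<open>T\<close> and its trace \<open>B\<close> on \<open>S\<close>, and it has
  \<open>|S| + |A|\<close> elements. Ordering the facets by decreasing \<open>|A|\<close> and then by increasing \<open>|B|\<close> gives a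
  shelling (\<open>facet_exchange\<close>): an element of \<open>B\<close> can be exchanged for its whisker, and when this is
  of no use, the comparison is between two subsets \<open>A\<close> and \<open>A''\<close> of \<open>T\<close> such that \<open>|A''| \<ge> |A|\<close> and \<open>A\<close> is
  not contained in \<open>A''\<close>. Since \<open>|T| \<le> 3\<close>, the set \<open>A - A''\<close> then has exactly one element. The sums
  \<open>x\<^sub>y + z\<^sub>y\<close> of the two variables of a whisker, followed by \<open>|A|\<close> linear forms in the variables of
  \<open>T\<close>, form the regular sequence; for \<open>|A| = 2\<close> and \<open>|T| = 3\<close> the forms \<open>a + c\<close> and \<open>b + c\<close> serve
  for all three possible \<open>A\<close> over every field (\<open>facets_regular\<close>).
\<close>

section \<open>Subrings and their ideals\<close>

text \<open>A ring whose operations are those of the ambient type. Computations with its elements, ideals and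
  subquotients then take place in the type class of commutative rings.\<close>

definition set_ring :: "'a::comm_ring_1 set \<Rightarrow> 'a ring" where
  "set_ring C = \<lparr>carrier = C, mult = (*), one = 1, zero = 0, add = (+)\<rparr>"

lemma set_ring_simps [simp]:
  "carrier (set_ring C) = C" "mult (set_ring C) = (*)" "one (set_ring C) = 1"
  "zero (set_ring C) = 0" "add (set_ring C) = (+)"
  by (simp_all add: set_ring_def)

definition ideal_in :: "'a::comm_ring_1 set \<Rightarrow> 'a set \<Rightarrow> bool" where
  "ideal_in C J \<longleftrightarrow> J \<subseteq> C \<and> 0 \<in> J \<and> (\<forall>x\<in>J. \<forall>y\<in>J. x + y \<in> J) \<and> (\<forall>c\<in>C. \<forall>x\<in>J. c * x \<in> J)"

definition prime_in :: "'a::comm_ring_1 set \<Rightarrow> 'a set \<Rightarrow> bool" where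
  "prime_in C P \<longleftrightarrow> ideal_in C P \<and> 1 \<notin> P \<and> (\<forall>x\<in>C. \<forall>y\<in>C. x * y \<in> P \<longrightarrow> x \<in> P \<or> y \<in> P)"

locale csubring =
  fixes C :: "'a::comm_ring_1 set"
  assumes zero_C [simp, intro]: "0 \<in> C"
    and one_C [simp, intro]: "1 \<in> C"
    and add_C [intro]: "x \<in> C \<Longrightarrow> y \<in> C \<Longrightarrow> x + y \<in> C"
    and mult_C [intro]: "x \<in> C \<Longrightarrow> y \<in> C \<Longrightarrow> x * y \<in> C"
    and uminus_C [intro]: "x \<in> C \<Longrightarrow> - x \<in> C"
begin

abbreviation R :: "'a ring" where "R \<equiv> set_ring C"

lemma diff_C [intro]: "x \<in> C \<Longrightarrow> y \<in> C \<Longrightarrow> x - y \<in> C"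
  using add_C[of x "- y"] uminus_C[of y] by simp

lemma ideal_inD:
  assumes "ideal_in C J"
  shows "J \<subseteq> C" "0 \<in> J" "x \<in> J \<Longrightarrow> y \<in> J \<Longrightarrow> x + y \<in> J" "c \<in> C \<Longrightarrow> x \<in> J \<Longrightarrow> c * x \<in> J"
    "x \<in> J \<Longrightarrow> - x \<in> J" "x \<in> J \<Longrightarrow> y \<in> J \<Longrightarrow> x - y \<in> J" "x \<in> J \<Longrightarrow> x \<in> C"
proof -
  show *: "J \<subseteq> C" "0 \<in> J" "x \<in> J \<Longrightarrow> y \<in> J \<Longrightarrow> x + y \<in> J" "c \<in> C \<Longrightarrow> x \<in> J \<Longrightarrow> c * x \<in> J"
    for x y c
    using assms by (auto simp: ideal_in_def)
  show **: "x \<in> J \<Longrightarrow> - x \<in> J" for x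
    using *(4)[of "-1" x] uminus_C[of 1] by simp
  show "x \<in> J \<Longrightarrow> y \<in> J \<Longrightarrow> x - y \<in> J" using *(3)[of x "- y"] **[of y] by simp
  show "x \<in> J \<Longrightarrow> x \<in> C" using * by auto
qed

lemma ideal_in_C: "ideal_in C C"
  by (auto simp: ideal_in_def)

lemma cring_set_ring: "cring R"
proof (rule cringI)
  show "abelian_group R"
  proof (rule abelian_groupI)
    fix x assume "x \<in> carrier R"
    then show "\<exists>y\<in>carrier R. y \<oplus>\<^bsub>R\<^esub> x = \<zero>\<^bsub>R\<^esub>" by (intro bexI[of _ "- x"]) auto
  qed (auto simp: algebra_simps)
  show "Group.comm_monoid R"
    by (rule comm_monoidI) (auto simp: algebra_simps)
qed (auto simp: algebra_simps)

lemma a_inv_set_ring: "x \<in> C \<Longrightarrow> \<ominus>\<^bsub>R\<^esub> x = - x"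
proof -
  assume x: "x \<in> C"
  interpret cring R by (rule cring_set_ring)
  show ?thesis using minus_equality[of "- x" x] x uminus_C by simp
qed

lemma subgroup_ideal_in: "ideal_in C J \<Longrightarrow> subgroup J (add_monoid R)"
proof -
  assume J: "ideal_in C J"
  interpret cring R by (rule cring_set_ring)
  show ?thesis
  proof (rule add.subgroupI)
    show "J \<noteq> {}" using ideal_inD(2)[OF J] by auto
    show "\<ominus>\<^bsub>R\<^esub> a \<in> J" if "a \<in> J" for a
      using that ideal_inD[OF J] a_inv_set_ring by auto
  qed (use ideal_inD[OF J] in auto)
qed

lemma ideal_iff: "ideal J R \<longleftrightarrow> ideal_in C J"
proof
  assume "ideal J R"
  then interpret ideal J R .
  show "ideal_in C J"
    using a_subset additive_subgroup.a_closed[OF additive_subgroup_axioms] additive_subgroup.zero_closed[OF additive_subgroup_axioms] I_l_closed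
    by (auto simp: ideal_in_def)
next
  assume J: "ideal_in C J"
  interpret cring R by (rule cring_set_ring)
  show "ideal J R"
  proof (rule idealI)
    show "x \<otimes>\<^bsub>R\<^esub> a \<in> J" "a \<otimes>\<^bsub>R\<^esub> x \<in> J" if "a \<in> J" "x \<in> carrier R" for a x
      using ideal_inD(4)[OF J, of x a] that by (simp_all add: mult.commute)
  qed (use subgroup_ideal_in[OF J] ring_axioms in auto)
qed

lemma primeideal_iff: "primeideal P R \<longleftrightarrow> prime_in C P"
proof
  assume "primeideal P R"
  then interpret primeideal P R .
  have I: "ideal_in C P" using is_ideal ideal_iff by auto
  have "1 \<notin> P"
  proof
    assume "1 \<in> P"
    then have "C \<subseteq> P" using ideal_inD(4)[OF I, of _ 1] by auto
    then show False using I_notcarr ideal_inD(1)[OF I] by auto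
  qed
  then show "prime_in C P" using I I_prime by (auto simp: prime_in_def)
next
  assume P: "prime_in C P"
  show "primeideal P R"
    by (rule primeidealI)
      (use P cring_set_ring ideal_iff one_C in \<open>auto simp: prime_in_def\<close>)
qed

text \<open>The primes of \<open>R/A\<close> are the images of the primes of \<open>R\<close> that contain \<open>A\<close>, so that chains may be
  formed in \<open>R\<close>.\<close>

lemma krull_dim_quotI:
  assumes A: "ideal_in C A"
    and chain: "\<And>i. i \<le> d \<Longrightarrow> prime_in C (P i)" "\<And>i. i < d \<Longrightarrow> P i \<subset> P (Suc i)" "A \<subseteq> P 0"
    and bound: "\<And>n Q. \<lbrakk>\<And>i. i \<le> n \<Longrightarrow> prime_in C (Q i); \<And>i. i < n \<Longrightarrow> Q i \<subset> Q (Suc i); A \<subseteq> Q 0\<rbrakk> \<Longrightarrow> n \<le> d"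
  shows "krull_dim (R Quot A) = ereal (real d)"
proof -
  interpret cring R by (rule cring_set_ring)
  interpret I: ideal A R using A ideal_iff by simp
  define \<pi> where "\<pi> x = A +>\<^bsub>R\<^esub> x" for x
  have hom: "ring_hom_ring R (R Quot A) \<pi>"
    unfolding \<pi>_def using I.rcos_ring_hom_ring by (simp add: eta_contract_eq)
  interpret h: ring_hom_ring R "R Quot A" \<pi> by (rule hom)
  have surj: "carrier (R Quot A) = \<pi> ` C"
    by (auto simp: FactRing_def A_RCOSETS_def' \<pi>_def)
  have eq: "\<pi> x = \<pi> y \<longleftrightarrow> x - y \<in> A" if xy: "x \<in> C" "y \<in> C" for x y
  proof -
    have "\<pi> x = \<pi> y \<longleftrightarrow> x \<ominus>\<^bsub>R\<^esub> y \<in> A"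
      using quotient_eq_iff_same_a_r_cos[OF I.is_ideal, of x y] xy by (simp add: \<pi>_def)
    then show ?thesis using a_inv_set_ring[OF xy(2)] by (simp add: a_minus_def)
  qed
  have image_prime: "primeideal (\<pi> ` Q) (R Quot A)" if Q: "prime_in C Q" and AQ: "A \<subseteq> Q" for Q
  proof -
    have IQ: "ideal_in C Q" using Q by (simp add: prime_in_def)
    have mem: "\<pi> x \<in> \<pi> ` Q \<longleftrightarrow> x \<in> Q" if "x \<in> C" for x
    proof
      assume "\<pi> x \<in> \<pi> ` Q"
      then obtain y where y: "y \<in> Q" "\<pi> x = \<pi> y" by auto
      then have "x - y \<in> Q" using eq[of x y] that AQ ideal_inD[OF IQ] by auto
      then show "x \<in> Q" using y ideal_inD(3)[OF IQ, of "x - y" y] by simp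
    qed auto
    have "ideal (\<pi> ` Q) (R Quot A)"
      using ring_ideal_imp_quot_ideal[OF I.is_ideal, of Q] IQ ideal_iff by (simp add: \<pi>_def)
    moreover have "cring (R Quot A)" by (rule I.quotient_is_cring[OF is_cring])
    moreover have "carrier (R Quot A) \<noteq> \<pi> ` Q"
      using mem[of 1] surj Q one_C by (metis image_eqI prime_in_def)
    moreover have "a \<in> \<pi> ` Q \<or> b \<in> \<pi> ` Q"
      if ab: "a \<in> carrier (R Quot A)" "b \<in> carrier (R Quot A)" "a \<otimes>\<^bsub>R Quot A\<^esub> b \<in> \<pi> ` Q" for a b
    proof -
      obtain x y where xy: "x \<in> C" "y \<in> C" "a = \<pi> x" "b = \<pi> y" using ab surj by auto
      then have "\<pi> (x * y) \<in> \<pi> ` Q" using ab(3) h.hom_mult[of x y] by simp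
      then show ?thesis using mem xy Q mult_C by (auto simp: prime_in_def)
    qed
    ultimately show ?thesis by (intro primeidealI) auto
  qed
  define L where "L = {n. \<exists>P. (\<forall>i\<le>n. primeideal (P i) (R Quot A)) \<and> (\<forall>i<n. P i \<subset> P (Suc i))}"
  have "d \<in> L"
  proof -
    have sub: "A \<subseteq> P i" if "i \<le> d" for i
      using that
    proof (induction i)
      case (Suc i)
      then show ?case using chain(2)[of i] by auto
    qed (use chain in auto)
    have "\<pi> ` P i \<subset> \<pi> ` P (Suc i)" if i: "i < d" for i
    proof -
      obtain x where x: "x \<in> P (Suc i)" "x \<notin> P i" using chain(2)[OF i] by auto
      have id: "ideal_in C (P i)" "ideal_in C (P (Suc i))" using chain(1) i by (auto simp: prime_in_def)
      have "\<pi> x \<notin> \<pi> ` P i"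
      proof
        assume "\<pi> x \<in> \<pi> ` P i"
        then obtain y where y: "y \<in> P i" "\<pi> x = \<pi> y" by auto
        then have "x - y \<in> P i" using eq[of x y] x sub[of i] i ideal_inD(7)[OF id(1)] ideal_inD(7)[OF id(2)] by auto
        then show False using x y ideal_inD(3)[OF id(1), of "x - y" y] by simp
      qed
      then show ?thesis using chain(2)[OF i] x by blast
    qed
    then show ?thesis unfolding L_def using chain(1) sub image_prime
      by (intro CollectI exI[of _ "\<lambda>i. \<pi> ` P i"]) auto
  qed
  moreover have "n \<le> d" if n: "n \<in> L" for n
  proof -
    obtain Q where "(\<forall>i\<le>n. primeideal (Q i) (R Quot A)) \<and> (\<forall>i<n. Q i \<subset> Q (Suc i))"
      using n unfolding L_def by blast
    then have Q: "\<And>i. i \<le> n \<Longrightarrow> primeideal (Q i) (R Quot A)" "\<And>i. i < n \<Longrightarrow> Q i \<subset> Q (Suc i)"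
      by auto
    have Qid: "ideal (Q i) (R Quot A)" if "i \<le> n" for i using Q(1)[OF that] by (simp add: primeideal_def)
    define P' where "P' i = {r \<in> carrier R. \<pi> r \<in> Q i}" for i
    show ?thesis
    proof (rule bound[of n P'])
      show "prime_in C (P' i)" if "i \<le> n" for i
        unfolding P'_def primeideal_iff[symmetric] by (rule h.primeideal_vimage[OF is_cring Q(1)[OF that]])
      show "P' i \<subset> P' (Suc i)" if i: "i < n" for i
      proof -
        obtain a where a: "a \<in> Q (Suc i)" "a \<notin> Q i" using Q(2)[OF i] by auto
        then have "a \<in> carrier (R Quot A)" using ideal.Icarr[OF Qid[of "Suc i"]] i by auto
        then show ?thesis using a Q(2)[OF i] surj unfolding P'_def by auto
      qed
      have "\<pi> x \<in> Q 0" if x: "x \<in> A" for x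
      proof -
        have "\<pi> x = \<pi> 0" using eq[of x 0] x ideal_inD[OF A] by auto
        also have "\<dots> = \<zero>\<^bsub>R Quot A\<^esub>" using h.hom_zero by simp
        also have "\<dots> \<in> Q 0" using additive_subgroup.zero_closed[OF ideal.axioms(1)[OF Qid[of 0]]] by simp
        finally show ?thesis .
      qed
      then show "A \<subseteq> P' 0" using ideal_inD[OF A] unfolding P'_def by auto
    qed
  qed
  ultimately have "(SUP n\<in>L. ereal (real n)) = ereal (real d)"
    by (intro antisym SUP_least SUP_upper2[of d]) auto
  then show ?thesis by (simp add: krull_dim_def L_def)
qed

end


section \<open>Modules presented as quotients of ideals\<close>

text \<open>The module \<open>M\<close> is \<open>N/U\<close> with the projection \<open>h\<close>. The layers of a filtration consist of cosets of
  cosets of polynomials, and regularity of a sequence refers to further quotients of them. A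
  presentation turns every statement about such a module into one about a pair of ideals.\<close>

definition presents ::
  "'a::comm_ring_1 set \<Rightarrow> 'a set \<Rightarrow> 'a set \<Rightarrow> ('a, 'b, 'n) module_scheme \<Rightarrow> ('a \<Rightarrow> 'b) \<Rightarrow> bool" where
  "presents C N U M h \<longleftrightarrow>
     ideal_in C N \<and> ideal_in C U \<and> U \<subseteq> N \<and> carrier M = h ` N \<and> \<zero>\<^bsub>M\<^esub> = h 0 \<and>
     (\<forall>x\<in>N. \<forall>y\<in>N. h x \<oplus>\<^bsub>M\<^esub> h y = h (x + y)) \<and> (\<forall>c\<in>C. \<forall>x\<in>N. c \<odot>\<^bsub>M\<^esub> h x = h (c * x)) \<and>
     (\<forall>x\<in>N. h x = h 0 \<longleftrightarrow> x \<in> U)"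

context csubring
begin

lemma presentsD:
  assumes "presents C N U M h"
  shows "ideal_in C N" "ideal_in C U" "U \<subseteq> N" "carrier M = h ` N" "\<zero>\<^bsub>M\<^esub> = h 0"
    "x \<in> N \<Longrightarrow> y \<in> N \<Longrightarrow> h x \<oplus>\<^bsub>M\<^esub> h y = h (x + y)" "c \<in> C \<Longrightarrow> x \<in> N \<Longrightarrow> c \<odot>\<^bsub>M\<^esub> h x = h (c * x)"
    "x \<in> N \<Longrightarrow> h x = h 0 \<longleftrightarrow> x \<in> U"
  using assms by (auto simp: presents_def)

lemma presents_eq_iff:
  assumes P: "presents C N U M h" and xy: "x \<in> N" "y \<in> N"
  shows "h x = h y \<longleftrightarrow> x - y \<in> U"
proof
  note N = ideal_inD[OF presentsD(1)[OF P]]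
  assume "h x = h y"
  then have "h (x - y) = h (y + (- y))"
    using presentsD(6)[OF P, of x "- y"] presentsD(6)[OF P, of y "- y"] xy N by auto
  then show "x - y \<in> U" using presentsD(8)[OF P, of "x - y"] xy N by auto
next
  note N = ideal_inD[OF presentsD(1)[OF P]]
  assume "x - y \<in> U"
  then have "h (x - y) = h 0" using presentsD(8)[OF P, of "x - y"] xy N by auto
  then have "h ((x - y) + y) = h (0 + y)"
    using presentsD(6)[OF P, of "x - y" y] presentsD(6)[OF P, of 0 y] xy N by auto
  then show "h x = h y" by simp
qed

lemma presents_image_mem_iff:
  assumes P: "presents C N U M h" and W: "ideal_in C W" "U \<subseteq> W" "W \<subseteq> N" and x: "x \<in> N"
  shows "h x \<in> h ` W \<longleftrightarrow> x \<in> W"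
proof
  assume "h x \<in> h ` W"
  then obtain w where w: "w \<in> W" "h x = h w" by auto
  then have "x - w \<in> W" using presents_eq_iff[OF P x, of w] W by auto
  then show "x \<in> W" using ideal_inD(3)[OF W(1), of "x - w" w] w by simp
qed auto

lemma presents_module:
  assumes P: "presents C N U M h"
  shows "Module.module R M"
proof (rule moduleI)
  note N = ideal_inD[OF presentsD(1)[OF P]] and h = presentsD(4-7)[OF P]
  show "cring R" by (rule cring_set_ring)
  show "abelian_group M"
  proof (rule abelian_groupI)
    fix x assume "x \<in> carrier M"
    then obtain n where n: "n \<in> N" "x = h n" using h by auto
    then show "\<exists>y\<in>carrier M. y \<oplus>\<^bsub>M\<^esub> x = \<zero>\<^bsub>M\<^esub>"
      using h N by (intro bexI[of _ "h (- n)"]) auto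
  qed (use h N in \<open>auto simp: add.commute add.left_commute\<close>)
qed (use presentsD(4-7)[OF P] ideal_inD[OF presentsD(1)[OF P]] in
    \<open>auto simp: distrib_right distrib_left mult.assoc add_C mult_C\<close>)

lemma presents_submodule:
  assumes P: "presents C N U M h" and W: "ideal_in C W" "W \<subseteq> N"
  shows "submodule (h ` W) R M"
proof -
  note N = ideal_inD[OF presentsD(1)[OF P]] and h = presentsD(4-7)[OF P] and WI = ideal_inD[OF W(1)]
  interpret Module.module R M by (rule presents_module[OF P])
  have sub: "x \<in> W \<Longrightarrow> x \<in> N" for x using W by auto
  have inv: "\<ominus>\<^bsub>M\<^esub> h x = h (- x)" if x: "x \<in> W" for x
    by (rule M.minus_equality) (use x h sub WI(5) in auto)
  have "subgroup (h ` W) (add_monoid M)"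
  proof (rule M.add.subgroupI)
    show "h ` W \<noteq> {}" using WI by auto
    show "\<ominus>\<^bsub>M\<^esub> a \<in> h ` W" if "a \<in> h ` W" for a using that inv WI by auto
  qed (use h sub WI in auto)
  then show ?thesis
    using h sub WI by (auto simp: submodule_def submodule_axioms_def)
qed

lemma presents_self: "presents C C {0} (self_module R) id"
  by (auto simp: presents_def ideal_in_C self_module_def) (auto simp: ideal_in_def)

lemma presents_restrict:
  assumes "presents C N U M h" "ideal_in C N'" "U \<subseteq> N'" "N' \<subseteq> N"
  shows "presents C N' U (M\<lparr>carrier := h ` N'\<rparr>) h"
proof -
  have "x \<in> N' \<Longrightarrow> x \<in> N" for x using assms(4) by auto
  then show ?thesis using assms(2,3) presentsD[OF assms(1)] by (simp add: presents_def)
qed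

lemma presents_cong:
  assumes P: "presents C N U M k" and eq: "\<And>x. x \<in> N \<Longrightarrow> h x = k x"
  shows "presents C N U M h"
proof -
  have "h ` N = k ` N" using eq by simp
  then show ?thesis
    using presentsD[OF P] ideal_inD[OF presentsD(1)[OF P]] by (simp add: presents_def eq)
qed

lemma presents_coset:
  assumes P: "presents C N U M h" and W: "W \<subseteq> N" and x: "x \<in> N"
  shows "h ` W +>\<^bsub>M\<^esub> h x = (\<lambda>w. h (w + x)) ` W"
proof -
  have "h ` W +>\<^bsub>M\<^esub> h x = (\<lambda>w. h w \<oplus>\<^bsub>M\<^esub> h x) ` W"
    unfolding a_r_coset_def' by blast
  also have "\<dots> = (\<lambda>w. h (w + x)) ` W"
    by (rule image_cong) (use presentsD(6)[OF P _ x] W in auto)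
  finally show ?thesis .
qed

text \<open>Every coset of \<open>h ` W\<close> has the form \<open>h ` (W + x)\<close>; a presentation therefore composes with the
  projection to a quotient.\<close>

lemma presents_quotient:
  assumes P: "presents C N U M h" and W: "ideal_in C W" "U \<subseteq> W" "W \<subseteq> N"
  shows "presents C N W (quot_module M (h ` W)) (\<lambda>x. h ` W +>\<^bsub>M\<^esub> h x)"
proof -
  note N = ideal_inD[OF presentsD(1)[OF P]] and h = presentsD(4-7)[OF P] and WI = ideal_inD[OF W(1)]
  have sub: "x \<in> W \<Longrightarrow> x \<in> N" for x using W by auto
  define k where "k x = (\<lambda>w. h (w + x)) ` W" for x
  have coset: "h ` W +>\<^bsub>M\<^esub> h x = k x" if "x \<in> N" for x
    using presents_coset[OF P W(3) that] by (simp add: k_def)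
  have k0: "k 0 = h ` W" by (simp add: k_def)
  have k_sub: "k x \<subseteq> k y" if "x - y \<in> W" for x y
  proof
    fix z assume "z \<in> k x"
    then obtain w where w: "w \<in> W" "z = h (w + x)" by (auto simp: k_def)
    then have "z = h ((w + (x - y)) + y)" by simp
    then show "z \<in> k y" using WI(3)[OF w(1) that] unfolding k_def by (rule image_eqI)
  qed
  have k_eq: "k x = k y" if "x - y \<in> W" for x y
    using k_sub[OF that] k_sub[of y x] WI(5)[OF that] by auto
  have k_eq0: "k x = k 0 \<longleftrightarrow> x \<in> W" if x: "x \<in> N" for x
  proof
    assume "k x = k 0"
    moreover have "h x \<in> k x" using WI(2) unfolding k_def by (auto intro: image_eqI[of _ _ 0])
    ultimately show "x \<in> W" using presents_image_mem_iff[OF P W x] k0 by simp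
  qed (use k_eq[of x 0] in auto)
  have k_add: "k x <+>\<^bsub>M\<^esub> k y = k (x + y)" if xy: "x \<in> N" "y \<in> N" for x y
  proof -
    have *: "h (w + x) \<oplus>\<^bsub>M\<^esub> h (v + y) = h ((w + v) + (x + y))" if "w \<in> W" "v \<in> W" for w v
      using h(3)[of "w + x" "v + y"] that xy sub N(3) by (simp add: algebra_simps)
    show ?thesis
    proof (intro equalityI subsetI)
      fix z assume "z \<in> k x <+>\<^bsub>M\<^esub> k y"
      then obtain w v where wv: "w \<in> W" "v \<in> W" "z = h (w + x) \<oplus>\<^bsub>M\<^esub> h (v + y)"
        by (auto simp: set_add_def' k_def)
      then show "z \<in> k (x + y)" unfolding k_def using * WI(3) by blast
    next
      fix z assume "z \<in> k (x + y)"
      then obtain w where w: "w \<in> W" "z = h (w + (x + y))" by (auto simp: k_def)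
      have "z = h (w + x) \<oplus>\<^bsub>M\<^esub> h (0 + y)" using *[of w 0] w WI(2) by simp
      then show "z \<in> k x <+>\<^bsub>M\<^esub> k y" using w WI(2) unfolding set_add_def' k_def by blast
    qed
  qed
  have k_smult: "(\<Union>z\<in>k x. h ` W +>\<^bsub>M\<^esub> (c \<odot>\<^bsub>M\<^esub> z)) = k (c * x)" if c: "c \<in> C" and x: "x \<in> N" for c x
  proof -
    have "h ` W +>\<^bsub>M\<^esub> (c \<odot>\<^bsub>M\<^esub> z) = k (c * x)" if z: "z \<in> k x" for z
    proof -
      obtain w where w: "w \<in> W" "z = h (w + x)" using z by (auto simp: k_def)
      have wx: "w + x \<in> N" using w sub x N(3) by auto
      then have "h ` W +>\<^bsub>M\<^esub> (c \<odot>\<^bsub>M\<^esub> z) = k (c * (w + x))"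
        using h(4)[OF c wx] coset[OF N(4)[OF c wx]] w by simp
      also have "\<dots> = k (c * x)" using k_eq[of "c * (w + x)" "c * x"] WI(4)[OF c w(1)] by (simp add: algebra_simps)
      finally show ?thesis .
    qed
    moreover have "k x \<noteq> {}" using WI(2) by (auto simp: k_def)
    ultimately show ?thesis by auto
  qed
  have "carrier (quot_module M (h ` W)) = k ` N"
    using h(1) coset by (auto simp: quot_module_def A_RCOSETS_def')
  then have "presents C N W (quot_module M (h ` W)) k"
    using presentsD(1)[OF P] W k0 k_eq0 k_add k_smult unfolding presents_def
    by (simp add: quot_module_def)
  then show ?thesis by (rule presents_cong) (rule coset)
qed

lemma presents_annihilator:
  assumes P: "presents C N U M h"
  shows "annihilator R M = {c \<in> C. \<forall>x\<in>N. c * x \<in> U}"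
  using presentsD[OF P] ideal_inD[OF presentsD(1)[OF P]] by (auto simp: annihilator_def)

lemma ideal_in_annihilator:
  assumes "ideal_in C U"
  shows "ideal_in C {c \<in> C. \<forall>x\<in>N. c * x \<in> U}"
  using ideal_inD[OF assms] by (auto simp: ideal_in_def distrib_right mult.assoc add_C mult_C)


end


section \<open>Regular sequences\<close>

definition add_multiples :: "'a::comm_ring_1 set \<Rightarrow> 'a \<Rightarrow> 'a set \<Rightarrow> 'a set" where
  "add_multiples U a N = {u + a * n | u n. u \<in> U \<and> n \<in> N}"

lemma add_multiplesI: "u \<in> U \<Longrightarrow> n \<in> N \<Longrightarrow> x = u + a * n \<Longrightarrow> x \<in> add_multiples U a N"
  unfolding add_multiples_def by blast

lemma add_multiplesE:
  assumes "x \<in> add_multiples U a N"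
  obtains u n where "x = u + a * n" "u \<in> U" "n \<in> N"
  using assms unfolding add_multiples_def by blast

text \<open>The ideal \<open>U + (a\<^sub>1, \<dots>, a\<^sub>r) N\<close>.\<close>

fun seq_sum :: "'a::comm_ring_1 set \<Rightarrow> 'a set \<Rightarrow> 'a list \<Rightarrow> 'a set" where
  "seq_sum N U [] = U"
| "seq_sum N U (a # as) = seq_sum N (add_multiples U a N) as"

definition reg_mod :: "'a::comm_ring_1 set \<Rightarrow> 'a set \<Rightarrow> 'a \<Rightarrow> bool" where
  "reg_mod N U a \<longleftrightarrow> (\<forall>x\<in>N. a * x \<in> U \<longrightarrow> x \<in> U)"

text \<open>Regularity on \<open>N/U\<close> up to the condition that \<open>N\<close> differs from \<open>U + (a\<^sub>1, \<dots>, a\<^sub>r) N\<close>. This is the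
  part of the notion that passes through extensions.\<close>

definition weakly_regular :: "'a::comm_ring_1 set \<Rightarrow> 'a set \<Rightarrow> 'a list \<Rightarrow> bool" where
  "weakly_regular N U as \<longleftrightarrow> (\<forall>i<length as. reg_mod N (seq_sum N U (take i as)) (as ! i))"

lemma weakly_regular_Nil [simp]: "weakly_regular N U []"
  by (simp add: weakly_regular_def)

lemma weakly_regular_Cons [simp]:
  "weakly_regular N U (a # as) \<longleftrightarrow> reg_mod N U a \<and> weakly_regular N (add_multiples U a N) as"
  unfolding weakly_regular_def by (auto simp: less_Suc_eq_0_disj)

lemma seq_sum_append: "seq_sum N U (as @ bs) = seq_sum N (seq_sum N U as) bs"
  by (induction as arbitrary: U) auto

context csubring
begin

lemma add_multiples_ideal:
  assumes "ideal_in C N" "ideal_in C U" "U \<subseteq> N" "a \<in> C"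
  shows "ideal_in C (add_multiples U a N)" "U \<subseteq> add_multiples U a N" "add_multiples U a N \<subseteq> N"
    "x \<in> N \<Longrightarrow> a * x \<in> add_multiples U a N"
proof -
  note N = ideal_inD[OF assms(1)] and U = ideal_inD[OF assms(2)]
  show "U \<subseteq> add_multiples U a N"
  proof
    fix x assume "x \<in> U"
    then show "x \<in> add_multiples U a N"
      by (rule add_multiplesI[OF _ N(2)]) simp
  qed
  show "add_multiples U a N \<subseteq> N"
  proof
    fix x assume "x \<in> add_multiples U a N"
    then obtain u n where "x = u + a * n" "u \<in> U" "n \<in> N" by (rule add_multiplesE)
    then show "x \<in> N" using N(3)[of u "a * n"] N(4)[OF assms(4), of n] assms(3) by auto
  qed
  show "x \<in> N \<Longrightarrow> a * x \<in> add_multiples U a N"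
    by (rule add_multiplesI[OF U(2)]) simp_all
  show "ideal_in C (add_multiples U a N)"
    unfolding ideal_in_def
  proof (intro conjI ballI)
    show "add_multiples U a N \<subseteq> C" using \<open>add_multiples U a N \<subseteq> N\<close> N(1) by simp
    show "0 \<in> add_multiples U a N"
      by (rule add_multiplesI[OF U(2) N(2)]) simp
    fix x y assume "x \<in> add_multiples U a N" "y \<in> add_multiples U a N"
    then obtain u n v m where *: "x = u + a * n" "y = v + a * m" "u \<in> U" "v \<in> U" "n \<in> N" "m \<in> N"
      by (elim add_multiplesE)
    show "x + y \<in> add_multiples U a N"
      by (rule add_multiplesI[OF U(3)[OF *(3,4)] N(3)[OF *(5,6)]]) (simp add: * algebra_simps)
  next
    fix c x assume c: "c \<in> C" and "x \<in> add_multiples U a N"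
    then obtain u n where *: "x = u + a * n" "u \<in> U" "n \<in> N" by (elim add_multiplesE)
    show "c * x \<in> add_multiples U a N"
      by (rule add_multiplesI[OF U(4)[OF c *(2)] N(4)[OF c *(3)]]) (simp add: * algebra_simps)
  qed
qed

lemma seq_sum_ideal:
  assumes "ideal_in C N" "ideal_in C U" "U \<subseteq> N" "set as \<subseteq> C"
  shows "ideal_in C (seq_sum N U as)" "U \<subseteq> seq_sum N U as" "seq_sum N U as \<subseteq> N"
    "a \<in> set as \<Longrightarrow> x \<in> N \<Longrightarrow> a * x \<in> seq_sum N U as"
proof -
  have "ideal_in C (seq_sum N U as) \<and> U \<subseteq> seq_sum N U as \<and> seq_sum N U as \<subseteq> N \<and>
    (\<forall>a\<in>set as. \<forall>x\<in>N. a * x \<in> seq_sum N U as)"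
    using assms
  proof (induction as arbitrary: U)
    case (Cons a as)
    note A = add_multiples_ideal[OF Cons.prems(1-3), of a]
    have a: "a \<in> C" using Cons.prems by auto
    have IH: "ideal_in C (seq_sum N (add_multiples U a N) as) \<and>
      add_multiples U a N \<subseteq> seq_sum N (add_multiples U a N) as \<and>
      seq_sum N (add_multiples U a N) as \<subseteq> N \<and>
      (\<forall>b\<in>set as. \<forall>x\<in>N. b * x \<in> seq_sum N (add_multiples U a N) as)"
      by (rule Cons.IH) (use Cons.prems A[OF a] in auto)
    then show ?case using A(2,4)[OF a] by auto
  qed auto
  then show "ideal_in C (seq_sum N U as)" "U \<subseteq> seq_sum N U as" "seq_sum N U as \<subseteq> N"
    "a \<in> set as \<Longrightarrow> x \<in> N \<Longrightarrow> a * x \<in> seq_sum N U as" by auto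
qed

lemma presents_seq_submodule:
  assumes P: "presents C N U M h" and as: "set as \<subseteq> C"
  shows "seq_submodule R M as = h ` seq_sum N U as"
proof -
  note NU = presentsD(1-3)[OF P] and h = presentsD(4-7)[OF P]
  note S = seq_sum_ideal[OF NU as]
  define X where "X = {a \<odot>\<^bsub>M\<^esub> x | a x. a \<in> set as \<and> x \<in> carrier M}"
  have "h ` seq_sum N U as \<subseteq> K" if K: "submodule K R M" "X \<subseteq> K" for K
  proof -
    interpret K: submodule K R M by (rule K)
    have clos: "x \<in> K \<Longrightarrow> y \<in> K \<Longrightarrow> x \<oplus>\<^bsub>M\<^esub> y \<in> K" for x y using K.m_closed by simp
    have "h ` seq_sum N U' bs \<subseteq> K"
      if "ideal_in C U'" "U' \<subseteq> N" "h ` U' \<subseteq> K" "set bs \<subseteq> set as" for U' bs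
      using that
    proof (induction bs arbitrary: U')
      case (Cons b bs)
      have b: "b \<in> C" "b \<in> set as" using Cons.prems as by auto
      note A = add_multiples_ideal[OF NU(1) Cons.prems(1,2) b(1)]
      have "h z \<in> K" if z: "z \<in> add_multiples U' b N" for z
      proof -
        obtain u n where un: "z = u + b * n" "u \<in> U'" "n \<in> N" using z by (elim add_multiplesE)
        then have "h z = h u \<oplus>\<^bsub>M\<^esub> (b \<odot>\<^bsub>M\<^esub> h n)"
          using h(3)[of u "b * n"] h(4)[OF b(1) un(3)] Cons.prems ideal_inD(4)[OF NU(1) b(1) un(3)] by auto
        moreover have "h u \<in> K" using un Cons.prems by auto
        moreover have "b \<odot>\<^bsub>M\<^esub> h n \<in> K" using K(2) un b h(1) by (auto simp: X_def)
        ultimately show ?thesis using clos by simp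
      qed
      then show ?case using Cons.IH[OF A(1,3)] Cons.prems by auto
    qed auto
    moreover have "h ` U \<subseteq> K"
    proof -
      have "h u = \<zero>\<^bsub>M\<^esub>" if "u \<in> U" for u using presentsD(8)[OF P, of u] that NU h(2) by auto
      then show ?thesis using K.one_closed by auto
    qed
    ultimately show ?thesis using NU by auto
  qed
  moreover have "submodule (h ` seq_sum N U as) R M"
    by (rule presents_submodule[OF P]) (use S in auto)
  moreover have "X \<subseteq> h ` seq_sum N U as"
    unfolding X_def using h(1,4) S(4) as by auto
  ultimately have "\<Inter>{K. submodule K R M \<and> X \<subseteq> K} = h ` seq_sum N U as" by blast
  then show ?thesis by (simp add: seq_submodule_def module_span_def X_def)
qed

lemma presents_regular_sequence:
  assumes P: "presents C N U M h" and as: "set as \<subseteq> C"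
  shows "regular_sequence R M as \<longleftrightarrow> weakly_regular N U as \<and> seq_sum N U as \<noteq> N"
proof -
  note NU = presentsD(1-3)[OF P]
  have nzd: "nonzerodivisor_on (quot_module M (h ` W)) a \<longleftrightarrow> reg_mod N W a"
    if W: "ideal_in C W" "U \<subseteq> W" "W \<subseteq> N" and a: "a \<in> C" for W a
  proof -
    note Q = presents_quotient[OF P W]
    have "a * x \<in> N" if "x \<in> N" for x using ideal_inD(4)[OF NU(1) a that] .
    then show ?thesis
      using presentsD[OF Q] a by (auto simp: nonzerodivisor_on_def reg_mod_def)
  qed
  have *: "nonzerodivisor_on (quot_module M (seq_submodule R M (take i as))) (as ! i) \<longleftrightarrow>
      reg_mod N (seq_sum N U (take i as)) (as ! i)" if i: "i < length as" for i
  proof -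
    have t: "set (take i as) \<subseteq> C" using as set_take_subset[of i as] by auto
    show ?thesis
      using nzd[of "seq_sum N U (take i as)" "as ! i"] seq_sum_ideal[OF NU t] as i
        presents_seq_submodule[OF P t] by (auto simp: subset_iff)
  qed
  have "h ` seq_sum N U as = carrier M \<longleftrightarrow> seq_sum N U as = N"
  proof
    assume *: "h ` seq_sum N U as = carrier M"
    note S = seq_sum_ideal[OF NU as]
    have "x \<in> seq_sum N U as" if "x \<in> N" for x
      using presents_image_mem_iff[OF P S(1-3) that] * presentsD(4)[OF P] that by auto
    then show "seq_sum N U as = N" using S by auto
  qed (use presentsD(4)[OF P] in auto)
  moreover have "(\<forall>i<length as. nonzerodivisor_on (quot_module M (seq_submodule R M (take i as))) (as ! i))
      \<longleftrightarrow> weakly_regular N U as"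
    unfolding weakly_regular_def using * by blast
  ultimately show ?thesis
    using as presents_seq_submodule[OF P as] by (simp add: regular_sequence_def)
qed

text \<open>This is the exact sequence \<open>0 \<rightarrow> N'/(N' \<inter> U) \<rightarrow> N/U \<rightarrow> N/(N' + U) \<rightarrow> 0\<close>. Regularity of \<open>a\<close> on the
  last term makes the sequence stay exact modulo \<open>a\<close>. This form, with \<open>N'\<close> and \<open>U\<close> in
  general position, is preserved when \<open>U\<close> is enlarged to \<open>U + a N\<close>.\<close>

lemma weakly_regular_extension:
  assumes "ideal_in C N" "ideal_in C N'" "ideal_in C U" "N' \<subseteq> N" "U \<subseteq> N" "set as \<subseteq> C"
    and "weakly_regular N' (N' \<inter> U) as"
    and "weakly_regular N {n + u | n u. n \<in> N' \<and> u \<in> U} as"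
  shows "weakly_regular N U as"
  using assms
proof (induction as arbitrary: U)
  case (Cons a as)
  note N = ideal_inD[OF \<open>ideal_in C N\<close>] and N' = ideal_inD[OF \<open>ideal_in C N'\<close>] and U = ideal_inD[OF \<open>ideal_in C U\<close>]
  define L where "L = {n + u | n u. n \<in> N' \<and> u \<in> U}"
  have a: "a \<in> C" using Cons.prems by auto
  have regL: "x \<in> L" if "x \<in> N" "a * x \<in> L" for x
    using Cons.prems(8) that by (auto simp: reg_mod_def L_def)
  have regN': "x \<in> U" if "x \<in> N'" "a * x \<in> U" for x
    using Cons.prems(7) that N'(4)[OF a] by (auto simp: reg_mod_def)
  have LI: "x \<in> L" if "n \<in> N'" "u \<in> U" "x = n + u" for x n u
    unfolding L_def using that by blast
  have UL: "U \<subseteq> L"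
  proof
    fix x assume "x \<in> U"
    then show "x \<in> L" by (rule LI[OF N'(2)]) simp
  qed
  have N'L: "N' \<subseteq> L"
  proof
    fix x assume "x \<in> N'"
    then show "x \<in> L" by (rule LI[OF _ U(2)]) simp
  qed
  have reg: "reg_mod N U a"
    unfolding reg_mod_def
  proof (intro ballI impI)
    fix x assume x: "x \<in> N" "a * x \<in> U"
    then have "x \<in> L" using UL by (intro regL[OF x(1)]) auto
    then obtain n u where nu: "x = n + u" "n \<in> N'" "u \<in> U" by (auto simp: L_def)
    have "a * n = a * x - a * u" using nu by (simp add: algebra_simps)
    then have "a * n \<in> U" using x U(4)[OF a nu(3)] U(6) by metis
    then show "x \<in> U" using regN' nu U(3) by auto
  qed
  define U1 where "U1 = add_multiples U a N"
  note A = add_multiples_ideal[OF \<open>ideal_in C N\<close> \<open>ideal_in C U\<close> \<open>U \<subseteq> N\<close> a, folded U1_def]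
  have int: "N' \<inter> U1 = add_multiples (N' \<inter> U) a N'"
  proof (intro equalityI subsetI)
    fix x assume x: "x \<in> N' \<inter> U1"
    then obtain u n where un: "x = u + a * n" "u \<in> U" "n \<in> N" unfolding U1_def add_multiples_def by blast
    have "a * n = x + (- u)" using un by simp
    moreover have "- u \<in> U" using un U by auto
    ultimately have "a * n \<in> L" using x LI by blast
    then obtain m v where mv: "n = m + v" "m \<in> N'" "v \<in> U" using regL[OF un(3)] by (auto simp: L_def)
    have "x - a * m = u + a * v" using un mv by (simp add: algebra_simps)
    moreover have "u + a * v \<in> U" using un mv U(3,4) a by auto
    moreover have "x - a * m \<in> N'" using x mv N'(4)[OF a] N'(6) by auto
    ultimately have "x - a * m \<in> N' \<inter> U" by (metis IntI)
    moreover have "x = (x - a * m) + a * m" by simp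
    ultimately show "x \<in> add_multiples (N' \<inter> U) a N'" using mv(2) by (intro add_multiplesI)
  next
    fix x assume "x \<in> add_multiples (N' \<inter> U) a N'"
    then obtain u n where un: "x = u + a * n" "u \<in> N' \<inter> U" "n \<in> N'" by (elim add_multiplesE)
    moreover have "u + a * n \<in> N'" using un N'(3) N'(4)[OF a] by auto
    ultimately show "x \<in> N' \<inter> U1"
      unfolding U1_def using \<open>N' \<subseteq> N\<close> by (auto intro: add_multiplesI)
  qed
  have sum: "{n + u | n u. n \<in> N' \<and> u \<in> U1} = add_multiples L a N"
  proof (intro equalityI subsetI)
    fix x assume "x \<in> {n + u | n u. n \<in> N' \<and> u \<in> U1}"
    then obtain n u m where "x = n + (u + a * m)" "n \<in> N'" "u \<in> U" "m \<in> N"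
      unfolding U1_def add_multiples_def by blast
    moreover have "n + u \<in> L" using calculation LI by blast
    ultimately show "x \<in> add_multiples L a N"
      by (intro add_multiplesI[of "n + u" _ m]) (simp_all add: add.assoc)
  next
    fix x assume "x \<in> add_multiples L a N"
    then obtain n u m where "x = (n + u) + a * m" "n \<in> N'" "u \<in> U" "m \<in> N"
      unfolding L_def add_multiples_def by blast
    moreover have "u + a * m \<in> U1" unfolding U1_def using calculation by (intro add_multiplesI) auto
    moreover have "(n + u) + a * m = n + (u + a * m)" by (simp add: add.assoc)
    ultimately show "x \<in> {n + u | n u. n \<in> N' \<and> u \<in> U1}" by blast
  qed
  have "weakly_regular N U1 as"
    by (rule Cons.IH) (use Cons.prems A int sum in \<open>auto simp: L_def\<close>)
  then show ?case using reg by (simp add: U1_def)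
qed simp

text \<open>If \<open>N = U\<^sub>0 + C m\<close> and the annihilator of \<open>m\<close> modulo \<open>U\<close> is \<open>W\<close>, then \<open>r \<mapsto> r m\<close> is an
  isomorphism \<open>R/W \<cong> N/U\<close>.\<close>

lemma weakly_regular_cyclic:
  assumes "ideal_in C N" "ideal_in C U" "ideal_in C W" "U \<subseteq> N" "set as \<subseteq> C" "m \<in> N"
    and gen: "\<And>x. x \<in> N \<Longrightarrow> \<exists>r\<in>C. x - r * m \<in> U"
    and ann: "\<And>r. r \<in> C \<Longrightarrow> r * m \<in> U \<longleftrightarrow> r \<in> W"
  shows "(weakly_regular N U as \<longleftrightarrow> weakly_regular C W as) \<and>
     (\<forall>r\<in>C. r * m \<in> seq_sum N U as \<longleftrightarrow> r \<in> seq_sum C W as)"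
  using assms(2-5) gen ann
proof (induction as arbitrary: U W)
  case (Cons a as)
  note N = ideal_inD[OF \<open>ideal_in C N\<close>] and U = ideal_inD[OF \<open>ideal_in C U\<close>] and W = ideal_inD[OF \<open>ideal_in C W\<close>]
  have a: "a \<in> C" using Cons.prems by auto
  define U1 W1 where "U1 = add_multiples U a N" and "W1 = add_multiples W a C"
  note A = add_multiples_ideal[OF \<open>ideal_in C N\<close> \<open>ideal_in C U\<close> \<open>U \<subseteq> N\<close> a, folded U1_def]
  note B = add_multiples_ideal[OF ideal_in_C \<open>ideal_in C W\<close> W(1) a, folded W1_def]
  have reg: "reg_mod N U a \<longleftrightarrow> reg_mod C W a"
  proof
    assume r: "reg_mod N U a"
    show "reg_mod C W a"
      unfolding reg_mod_def
    proof (intro ballI impI)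
      fix x assume x: "x \<in> C" "a * x \<in> W"
      then have "a * (x * m) \<in> U" using Cons.prems(6)[of "a * x"] mult_C[OF a x(1)] by (simp add: mult.assoc)
      then have "x * m \<in> U" using r N(4)[OF x(1) \<open>m \<in> N\<close>] by (auto simp: reg_mod_def)
      then show "x \<in> W" using Cons.prems(6)[OF x(1)] by simp
    qed
  next
    assume r: "reg_mod C W a"
    show "reg_mod N U a"
      unfolding reg_mod_def
    proof (intro ballI impI)
      fix x assume x: "x \<in> N" "a * x \<in> U"
      obtain s where s: "s \<in> C" "x - s * m \<in> U" using Cons.prems(5)[OF x(1)] by auto
      have "(a * s) * m = a * x - a * (x - s * m)" by (simp add: algebra_simps)
      then have "(a * s) * m \<in> U" using U(6)[OF x(2) U(4)[OF a s(2)]] by simp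
      then have "a * s \<in> W" using Cons.prems(6)[of "a * s"] mult_C[OF a s(1)] by simp
      then have "s \<in> W" using r s by (auto simp: reg_mod_def)
      then have "s * m \<in> U" using Cons.prems(6)[OF s(1)] by simp
      then show "x \<in> U" using U(3)[OF s(2), of "s * m"] by simp
    qed
  qed
  have ann1: "r * m \<in> U1 \<longleftrightarrow> r \<in> W1" if r: "r \<in> C" for r
  proof
    assume "r * m \<in> U1"
    then obtain u n where un: "r * m = u + a * n" "u \<in> U" "n \<in> N" unfolding U1_def add_multiples_def by blast
    obtain s where s: "s \<in> C" "n - s * m \<in> U" using Cons.prems(5)[OF un(3)] by auto
    have "(r - a * s) * m = u + a * (n - s * m)" using un(1) by (simp add: algebra_simps)
    then have "(r - a * s) * m \<in> U" using U(3)[OF un(2) U(4)[OF a s(2)]] by simp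
    then have "r - a * s \<in> W" using Cons.prems(6)[of "r - a * s"] r s a by auto
    then show "r \<in> W1" unfolding W1_def by (rule add_multiplesI[OF _ s(1)]) simp
  next
    assume "r \<in> W1"
    then obtain w s where ws: "r = w + a * s" "w \<in> W" "s \<in> C" unfolding W1_def add_multiples_def by blast
    have "w * m \<in> U" using ws Cons.prems(6) W(7) by auto
    moreover have "s * m \<in> N" using N(4) ws \<open>m \<in> N\<close> by auto
    ultimately show "r * m \<in> U1" unfolding U1_def
      by (rule add_multiplesI) (simp add: ws algebra_simps)
  qed
  have "(weakly_regular N U1 as \<longleftrightarrow> weakly_regular C W1 as) \<and>
     (\<forall>r\<in>C. r * m \<in> seq_sum N U1 as \<longleftrightarrow> r \<in> seq_sum C W1 as)"
  proof (rule Cons.IH)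
    show "\<exists>r\<in>C. x - r * m \<in> U1" if "x \<in> N" for x using Cons.prems(5)[OF that] A(2) by auto
  qed (use A B Cons.prems ann1 in auto)
  then show ?case using reg by (simp add: U1_def W1_def)
qed (use assms in auto)

text \<open>If \<open>b x = u + a y\<close>, then \<open>y\<close> is a multiple of \<open>b\<close> modulo \<open>U\<close> because \<open>a\<close> is regular modulo \<open>b\<close>, and
  \<open>b\<close> can be cancelled. This permits reading a sequence of length two in the more convenient order.\<close>

lemma reg_mod_swap:
  assumes "ideal_in C U" "a \<in> C" "b \<in> C"
    and "reg_mod C U b" and "reg_mod C (add_multiples U b C) a"
  shows "reg_mod C (add_multiples U a C) b"
  unfolding reg_mod_def
proof (intro ballI impI)
  note U = ideal_inD[OF assms(1)]
  fix x assume x: "x \<in> C" "b * x \<in> add_multiples U a C"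
  then obtain u y where uy: "b * x = u + a * y" "u \<in> U" "y \<in> C" by (elim add_multiplesE)
  have "a * y = (- u) + b * x" using uy by simp
  then have "a * y \<in> add_multiples U b C" using x U(5)[OF uy(2)] by (intro add_multiplesI)
  then have "y \<in> add_multiples U b C" using assms(5) uy by (auto simp: reg_mod_def)
  then obtain v z where vz: "y = v + b * z" "v \<in> U" "z \<in> C" by (elim add_multiplesE)
  have "b * (x - a * z) = u + a * v" using uy(1) vz(1) by (simp add: algebra_simps)
  then have "b * (x - a * z) \<in> U" using U(3)[OF uy(2) U(4)[OF assms(2) vz(2)]] by simp
  then have "x - a * z \<in> U" using assms(4) x vz assms(2) by (auto simp: reg_mod_def)
  then show "x \<in> add_multiples U a C" by (rule add_multiplesI[OF _ vz(3)]) simp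
qed

lemma reg_mod_prime: "prime_in C P \<Longrightarrow> a \<in> C \<Longrightarrow> a \<notin> P \<Longrightarrow> reg_mod C P a"
  by (auto simp: reg_mod_def prime_in_def)

end


section \<open>Polynomials and substitution\<close>

type_synonym 'v exponent = "'v \<Rightarrow>\<^sub>0 nat"

definition polys :: "'v set \<Rightarrow> ('v, 'k::field) mpoly set" where
  "polys V = {p. \<forall>m\<in>Poly_Mapping.keys p. Poly_Mapping.keys m \<subseteq> V}"

lemma poly_ring_eq: "poly_ring V = set_ring (polys V)"
  by (simp add: poly_ring_def set_ring_def polys_def)

lemma polys_mono: "V \<subseteq> W \<Longrightarrow> polys V \<subseteq> polys W"
  by (auto simp: polys_def)

lemma single_mem_polys [simp]: "Poly_Mapping.single m c \<in> polys V \<longleftrightarrow> c = 0 \<or> Poly_Mapping.keys m \<subseteq> V"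
  by (simp add: polys_def)

lemma csubring_polys: "csubring (polys V :: ('v, 'k::field) mpoly set)"
proof -
  interpret cring "poly_ring V :: ('v, 'k) mpoly ring" by (rule cring_poly_ring)
  show ?thesis
  proof
    fix p q :: "('v, 'k) mpoly" assume "p \<in> polys V" "q \<in> polys V"
    then show "p + q \<in> polys V" "p * q \<in> polys V" "- p \<in> polys V"
      using a_closed[of p q] m_closed[of p q] by (auto simp: poly_ring_eq) (simp add: polys_def)
  qed (simp_all add: polys_def)
qed

interpretation P: csubring "polys V :: ('v, 'k::field) mpoly set" for V
  by (rule csubring_polys)

lemma polys_sum: "(\<And>i. i \<in> A \<Longrightarrow> f i \<in> polys V) \<Longrightarrow> sum f A \<in> polys V"
  by (induction A rule: infinite_finite_induct) (auto intro: P.add_C)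

lemma polys_prod: "(\<And>i. i \<in> A \<Longrightarrow> f i \<in> polys V) \<Longrightarrow> prod f A \<in> polys V"
  by (induction A rule: infinite_finite_induct) (auto intro: P.mult_C)

lemma polys_power: "p \<in> polys V \<Longrightarrow> p ^ n \<in> polys V"
  by (induction n) (auto intro: P.mult_C)

lemma sum_monomials:
  assumes "finite A" "Poly_Mapping.keys p \<subseteq> A"
  shows "(\<Sum>m\<in>A. Poly_Mapping.single m (Poly_Mapping.lookup p m)) = p"
proof (rule poly_mapping_eqI)
  fix n
  have "Poly_Mapping.lookup (\<Sum>m\<in>A. Poly_Mapping.single m (Poly_Mapping.lookup p m)) n =
     (\<Sum>m\<in>A. if m = n then Poly_Mapping.lookup p m else 0)"
    unfolding lookup_sum by (rule sum.cong) (auto simp: lookup_single)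
  also have "\<dots> = Poly_Mapping.lookup p n"
    using assms by (auto simp: in_keys_iff)
  finally show "Poly_Mapping.lookup (\<Sum>m\<in>A. Poly_Mapping.single m (Poly_Mapping.lookup p m)) n =
    Poly_Mapping.lookup p n" .
qed

lemma poly_induct [case_names add single]:
  assumes "\<And>p q. P p \<Longrightarrow> P q \<Longrightarrow> P (p + q)" "\<And>m c. P (Poly_Mapping.single m c)"
  shows "P (p :: 'a \<Rightarrow>\<^sub>0 'b::comm_monoid_add)"
proof -
  have "P (\<Sum>m\<in>A. Poly_Mapping.single m (Poly_Mapping.lookup p m))" if "finite A" for A
    using that
  proof induction
    case empty
    show ?case using assms(2)[of undefined 0] by simp
  qed (use assms in simp)
  from this[of "Poly_Mapping.keys p"] show ?thesis by (simp add: sum_monomials)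
qed

lemma single_0_mult:
  "Poly_Mapping.single 0 (c * d) = (Poly_Mapping.single 0 c * Poly_Mapping.single 0 d :: ('v, 'k::field) mpoly)"
  by (simp add: mult_single)

text \<open>Substitution of polynomials for variables serves three purposes: renaming variables, setting
  variables to zero, and evaluating an algebraic relation.\<close>

definition eval_mon :: "('w \<Rightarrow> ('v, 'k::field) mpoly) \<Rightarrow> 'w exponent \<Rightarrow> ('v, 'k) mpoly" where
  "eval_mon \<sigma> m = (\<Prod>v\<in>Poly_Mapping.keys m. \<sigma> v ^ Poly_Mapping.lookup m v)"

definition subst :: "('w \<Rightarrow> ('v, 'k::field) mpoly) \<Rightarrow> ('w, 'k) mpoly \<Rightarrow> ('v, 'k) mpoly" where
  "subst \<sigma> p = (\<Sum>m\<in>Poly_Mapping.keys p. Poly_Mapping.single 0 (Poly_Mapping.lookup p m) * eval_mon \<sigma> m)"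

lemma eval_mon_superset:
  "finite A \<Longrightarrow> Poly_Mapping.keys m \<subseteq> A \<Longrightarrow> eval_mon \<sigma> m = (\<Prod>v\<in>A. \<sigma> v ^ Poly_Mapping.lookup m v)"
  unfolding eval_mon_def by (rule prod.mono_neutral_left) (auto simp: in_keys_iff)

lemma eval_mon_0 [simp]: "eval_mon \<sigma> 0 = 1"
  by (simp add: eval_mon_def)

lemma eval_mon_add: "eval_mon \<sigma> (m + n) = eval_mon \<sigma> m * eval_mon \<sigma> n"
proof -
  let ?A = "Poly_Mapping.keys m \<union> Poly_Mapping.keys n"
  have "eval_mon \<sigma> (m + n) = (\<Prod>v\<in>?A. \<sigma> v ^ Poly_Mapping.lookup (m + n) v)"
    by (rule eval_mon_superset) (simp_all add: Poly_Mapping.keys_add)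
  also have "\<dots> = (\<Prod>v\<in>?A. \<sigma> v ^ Poly_Mapping.lookup m v) * (\<Prod>v\<in>?A. \<sigma> v ^ Poly_Mapping.lookup n v)"
    by (simp add: lookup_add power_add prod.distrib)
  also have "\<dots> = eval_mon \<sigma> m * eval_mon \<sigma> n"
    by (simp add: eval_mon_superset[of ?A])
  finally show ?thesis .
qed

lemma eval_mon_single: "eval_mon \<sigma> (Poly_Mapping.single v k) = \<sigma> v ^ k"
  by (cases "k = 0") (auto simp: eval_mon_def)

lemma subst_superset:
  "finite A \<Longrightarrow> Poly_Mapping.keys p \<subseteq> A \<Longrightarrow>
     subst \<sigma> p = (\<Sum>m\<in>A. Poly_Mapping.single 0 (Poly_Mapping.lookup p m) * eval_mon \<sigma> m)"
  unfolding subst_def by (rule sum.mono_neutral_left) (auto simp: in_keys_iff)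

lemma subst_single: "subst \<sigma> (Poly_Mapping.single m c) = Poly_Mapping.single 0 c * eval_mon \<sigma> m"
  by (cases "c = 0") (auto simp: subst_def)

lemma subst_0 [simp]: "subst \<sigma> 0 = 0"
  by (simp add: subst_def)

lemma subst_const [simp]: "subst \<sigma> (Poly_Mapping.single 0 c) = Poly_Mapping.single 0 c"
  by (simp add: subst_single)

lemma subst_1 [simp]: "subst \<sigma> 1 = 1"
  using subst_const[of \<sigma> 1] by simp

lemma subst_var [simp]: "subst \<sigma> (poly_var v) = \<sigma> v"
  by (simp add: poly_var_def subst_single eval_mon_single)

lemma subst_add: "subst \<sigma> (p + q) = subst \<sigma> p + subst \<sigma> q"
proof -
  let ?A = "Poly_Mapping.keys p \<union> Poly_Mapping.keys q"
  have "subst \<sigma> (p + q) = (\<Sum>m\<in>?A. Poly_Mapping.single 0 (Poly_Mapping.lookup (p + q) m) * eval_mon \<sigma> m)"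
    by (rule subst_superset) (simp_all add: Poly_Mapping.keys_add)
  also have "\<dots> = subst \<sigma> p + subst \<sigma> q"
    by (simp add: lookup_add single_add distrib_right sum.distrib subst_superset[of ?A])
  finally show ?thesis .
qed

lemma subst_sum: "subst \<sigma> (sum f A) = (\<Sum>i\<in>A. subst \<sigma> (f i))"
  by (induction A rule: infinite_finite_induct) (auto simp: subst_add)

lemma subst_mult: "subst \<sigma> (p * q) = subst \<sigma> p * subst \<sigma> q"
proof (induction p rule: poly_induct)
  case (single m c)
  show ?case
  proof (induction q rule: poly_induct)
    case (single n d)
    show ?case by (simp add: mult_single[of m c n d] subst_single eval_mon_add single_0_mult mult_ac)
  qed (simp add: distrib_left subst_add)
qed (simp add: distrib_right subst_add)

lemma subst_diff: "subst \<sigma> (p - q) = subst \<sigma> p - subst \<sigma> q"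
  using subst_add[of \<sigma> "p - q" q] by (simp add: algebra_simps)

lemma subst_power: "subst \<sigma> (p ^ n) = subst \<sigma> p ^ n"
  by (induction n) (simp_all add: subst_mult)

lemma subst_prod: "subst \<sigma> (prod f A) = (\<Prod>i\<in>A. subst \<sigma> (f i))"
  by (induction A rule: infinite_finite_induct) (auto simp: subst_mult)

lemma eval_mon_var: "eval_mon poly_var m = Poly_Mapping.single m 1"
proof -
  have "eval_mon poly_var m = (Poly_Mapping.single m 1 :: ('a, 'b::field) mpoly)"
  proof (induction m rule: poly_induct)
    case (single v k)
    have "poly_var v ^ k = (Poly_Mapping.single (Poly_Mapping.single v k) 1 :: ('a, 'b) mpoly)"
      by (induction k) (auto simp: poly_var_def mult_single single_add[symmetric])
    then show ?case by (simp add: eval_mon_single)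
  qed (simp add: eval_mon_add mult_single)
  then show ?thesis .
qed

lemma subst_id: "subst poly_var p = p"
  by (simp add: subst_def eval_mon_var mult_single sum_monomials)

lemma subst_subst: "subst \<sigma> (subst \<tau> p) = subst (\<lambda>v. subst \<sigma> (\<tau> v)) p"
  by (simp add: subst_def[of \<tau>] subst_sum subst_mult eval_mon_def subst_prod subst_power)
     (simp add: subst_def eval_mon_def)

lemma subst_cong:
  assumes "p \<in> polys A" "\<And>v. v \<in> A \<Longrightarrow> \<sigma> v = \<tau> v"
  shows "subst \<sigma> p = subst \<tau> p"
  unfolding subst_def eval_mon_def using assms
  by (intro sum.cong refl arg_cong2[of _ _ _ _ "(*)"] prod.cong) (auto simp: polys_def subset_iff)

lemma subst_polys:
  assumes "p \<in> polys A" "\<And>v. v \<in> A \<Longrightarrow> \<sigma> v \<in> polys V"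
  shows "subst \<sigma> p \<in> polys V"
  unfolding subst_def eval_mon_def
proof (intro polys_sum P.mult_C polys_prod polys_power assms(2))
  show "v \<in> A" if "m \<in> Poly_Mapping.keys p" "v \<in> Poly_Mapping.keys m" for m v
    using that assms(1) by (auto simp: polys_def)
qed simp

lemma polys_finite_support:
  obtains A where "finite A" "p \<in> polys A"
proof
  show "finite (\<Union>m\<in>Poly_Mapping.keys p. Poly_Mapping.keys m)" by simp
  show "p \<in> polys (\<Union>m\<in>Poly_Mapping.keys p. Poly_Mapping.keys m)" by (auto simp: polys_def)
qed

text \<open>Finitely many variables can be renamed to natural numbers, and monomials in variables
  indexed by a linear order are linearly ordered.\<close>

lemma mpoly_no_zero_divisors:
  fixes p q :: "('v, 'k::field) mpoly"
  assumes "p * q = 0"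
  shows "p = 0 \<or> q = 0"
proof -
  obtain A B where AB: "finite A" "finite B" "p \<in> polys A" "q \<in> polys B"
    by (meson polys_finite_support)
  define D where "D = A \<union> B"
  have D: "finite D" "p \<in> polys D" "q \<in> polys D"
    using AB polys_mono[of A D] polys_mono[of B D] by (auto simp: D_def)
  obtain f :: "'v \<Rightarrow> nat" where f: "inj_on f D" using finite_imp_inj_to_nat_seg[OF D(1)] by auto
  define ren where "ren = (subst (\<lambda>v. poly_var (f v)) :: ('v, 'k) mpoly \<Rightarrow> (nat, 'k) mpoly)"
  have ren_0: "r = 0" if r: "r \<in> polys D" "ren r = 0" for r
  proof -
    have "subst (\<lambda>n. poly_var (inv_into D f n)) (ren r) = subst poly_var r"
      unfolding ren_def subst_subst by (rule subst_cong[OF r(1)]) (simp add: f)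
    then show ?thesis using r by (simp add: subst_id)
  qed
  have "ren p * ren q = 0" unfolding ren_def subst_mult[symmetric] by (simp add: assms)
  then show ?thesis using ren_0 D by (auto simp: mult_eq_0_iff)
qed


section \<open>Algebraic dependence\<close>

definition box :: "'v set \<Rightarrow> nat \<Rightarrow> 'v exponent set" where
  "box A N = {m. Poly_Mapping.keys m \<subseteq> A \<and> (\<forall>v. Poly_Mapping.lookup m v \<le> N)}"

lemma box_bij:
  assumes "finite A"
  shows "bij_betw (\<lambda>m. restrict (Poly_Mapping.lookup m) A) (box A N) (A \<rightarrow>\<^sub>E {..N})"
proof (rule bij_betw_imageI)
  show "inj_on (\<lambda>m. restrict (Poly_Mapping.lookup m) A) (box A N)"
  proof (rule inj_onI)
    fix m n assume mn: "m \<in> box A N" "n \<in> box A N"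
      "restrict (Poly_Mapping.lookup m) A = restrict (Poly_Mapping.lookup n) A"
    show "m = n"
    proof (rule poly_mapping_eqI)
      fix v
      show "Poly_Mapping.lookup m v = Poly_Mapping.lookup n v"
      proof (cases "v \<in> A")
        case True
        then show ?thesis using fun_cong[OF mn(3), of v] by simp
      next
        case False
        then have "v \<notin> Poly_Mapping.keys m" "v \<notin> Poly_Mapping.keys n"
          using mn by (auto simp: box_def)
        then show ?thesis by (simp add: in_keys_iff)
      qed
    qed
  qed
  show "(\<lambda>m. restrict (Poly_Mapping.lookup m) A) ` box A N = (A \<rightarrow>\<^sub>E {..N})"
  proof (intro equalityI subsetI)
    fix g assume g: "g \<in> (A \<rightarrow>\<^sub>E {..N})"
    define m where "m = Abs_poly_mapping (\<lambda>v. if v \<in> A then g v else 0)"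
    have lk: "Poly_Mapping.lookup m = (\<lambda>v. if v \<in> A then g v else 0)"
      unfolding m_def by (rule lookup_Abs_poly_mapping) (use assms in \<open>auto intro: finite_subset[of _ A]\<close>)
    have "m \<in> box A N" using g by (auto simp: box_def lk in_keys_iff split: if_splits)
    moreover have "g = restrict (Poly_Mapping.lookup m) A"
      using g by (auto simp: lk restrict_def PiE_def extensional_def)
    ultimately show "g \<in> (\<lambda>m. restrict (Poly_Mapping.lookup m) A) ` box A N" by blast
  qed (auto simp: box_def)
qed

lemma finite_box: "finite A \<Longrightarrow> finite (box A N)"
  using bij_betw_finite[OF box_bij, of A N] finite_PiE[of A "\<lambda>_. {..N}"] by simp

lemma card_box: "finite A \<Longrightarrow> card (box A N) = Suc N ^ card A"
  using bij_betw_same_card[OF box_bij, of A N] by (simp add: card_PiE)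

lemma box_mono: "N \<le> N' \<Longrightarrow> box A N \<subseteq> box A N'"
  by (auto simp: box_def intro: order_trans)

definition scale :: "'k::field \<Rightarrow> ('v, 'k) mpoly \<Rightarrow> ('v, 'k) mpoly" where
  "scale c p = Poly_Mapping.single 0 c * p"

interpretation mp: vector_space "scale :: 'k::field \<Rightarrow> ('v, 'k) mpoly \<Rightarrow> ('v, 'k) mpoly"
proof
  fix a b :: 'k and p :: "('v, 'k) mpoly"
  show "scale a (scale b p) = scale (a * b) p"
    by (simp add: scale_def single_0_mult mult.assoc)
qed (simp_all add: scale_def distrib_left distrib_right single_add)

lemma mem_span_monomials:
  assumes "Poly_Mapping.keys p \<subseteq> S"
  shows "p \<in> mp.span ((\<lambda>m. Poly_Mapping.single m 1) ` S)"
proof -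
  have "Poly_Mapping.single m (Poly_Mapping.lookup p m) \<in> mp.span ((\<lambda>m. Poly_Mapping.single m 1) ` S)"
    if "m \<in> Poly_Mapping.keys p" for m
  proof -
    have "scale (Poly_Mapping.lookup p m) (Poly_Mapping.single m 1) \<in> mp.span ((\<lambda>m. Poly_Mapping.single m 1) ` S)"
      using that assms by (intro mp.span_scale mp.span_base) auto
    then show ?thesis by (simp add: scale_def mult_single)
  qed
  then have "(\<Sum>m\<in>Poly_Mapping.keys p. Poly_Mapping.single m (Poly_Mapping.lookup p m)) \<in>
      mp.span ((\<lambda>m. Poly_Mapping.single m 1) ` S)"
    by (rule mp.span_sum)
  then show ?thesis by (simp add: sum_monomials)
qed

lemma keys_mult_box:
  assumes "Poly_Mapping.keys p \<subseteq> box A K" "Poly_Mapping.keys q \<subseteq> box A L"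
  shows "Poly_Mapping.keys (p * q) \<subseteq> box A (K + L)"
proof
  fix m assume "m \<in> Poly_Mapping.keys (p * q)"
  then obtain a b where ab: "m = a + b" "a \<in> Poly_Mapping.keys p" "b \<in> Poly_Mapping.keys q"
    using Poly_Mapping.keys_mult[of p q] by blast
  then have "a \<in> box A K" "b \<in> box A L" using assms by auto
  then show "m \<in> box A (K + L)"
    using Poly_Mapping.keys_add[of a b] ab(1) by (auto simp: box_def lookup_add intro!: add_mono)
qed

lemma keys_1_box: "Poly_Mapping.keys (1 :: ('v, 'k::field) mpoly) \<subseteq> box A K"
  by (auto simp: box_def)

lemma keys_power_box:
  assumes "Poly_Mapping.keys p \<subseteq> box A K"
  shows "Poly_Mapping.keys (p ^ n) \<subseteq> box A (n * K)"
  by (induction n) (use keys_1_box keys_mult_box[OF assms] in auto)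

lemma keys_prod_box:
  assumes "\<And>i. i \<in> I \<Longrightarrow> Poly_Mapping.keys (f i) \<subseteq> box A (K i)"
  shows "Poly_Mapping.keys (prod f I :: ('v, 'k::field) mpoly) \<subseteq> box A (sum K I)"
  using assms
proof (induction I rule: infinite_finite_induct)
  case (insert i I)
  then show ?case using keys_mult_box[of "f i" A "K i" "prod f I"] by simp
qed (use keys_1_box in auto)

lemma keys_in_box:
  assumes "p \<in> polys A"
  obtains K where "Poly_Mapping.keys p \<subseteq> box A K"
proof
  show "Poly_Mapping.keys p \<subseteq> box A (\<Sum>m\<in>Poly_Mapping.keys p. \<Sum>v\<in>Poly_Mapping.keys m. Poly_Mapping.lookup m v)"
  proof
    fix m assume m: "m \<in> Poly_Mapping.keys p"
    have "Poly_Mapping.lookup m v \<le> (\<Sum>m\<in>Poly_Mapping.keys p. \<Sum>v\<in>Poly_Mapping.keys m. Poly_Mapping.lookup m v)" for v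
    proof (cases "v \<in> Poly_Mapping.keys m")
      case True
      have "Poly_Mapping.lookup m v \<le> (\<Sum>v\<in>Poly_Mapping.keys m. Poly_Mapping.lookup m v)"
        by (rule member_le_sum) (use True in auto)
      also have "\<dots> \<le> (\<Sum>m\<in>Poly_Mapping.keys p. \<Sum>v\<in>Poly_Mapping.keys m. Poly_Mapping.lookup m v)"
        by (rule member_le_sum) (use m in auto)
      finally show ?thesis .
    qed (simp add: in_keys_iff)
    then show "m \<in> box A (\<Sum>m\<in>Poly_Mapping.keys p. \<Sum>v\<in>Poly_Mapping.keys m. Poly_Mapping.lookup m v)"
      using assms m by (auto simp: box_def polys_def)
  qed
qed

text \<open>A linear relation between values of distinct monomials is a polynomial relation.\<close>

lemma eval_mon_nonzero_independent:
  fixes x :: "'w \<Rightarrow> ('v, 'k::field) mpoly"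
  assumes fin: "finite S"
    and nz: "\<And>q. q \<noteq> 0 \<Longrightarrow> Poly_Mapping.keys q \<subseteq> S \<Longrightarrow> subst x q \<noteq> 0"
  shows "inj_on (eval_mon x) S" "\<not> mp.dependent (eval_mon x ` S)"
proof -
  have ev: "eval_mon x m = subst x (Poly_Mapping.single m 1)" for m
    by (simp add: subst_single)
  show inj: "inj_on (eval_mon x) S"
  proof (rule inj_onI, rule ccontr)
    fix m n assume mn: "m \<in> S" "n \<in> S" "eval_mon x m = eval_mon x n" "m \<noteq> n"
    define q where "q = (Poly_Mapping.single m 1 - Poly_Mapping.single n 1 :: ('w, 'k) mpoly)"
    have "Poly_Mapping.lookup q m = 1" using mn by (simp add: q_def lookup_minus lookup_single)
    then have "q \<noteq> 0" by auto
    moreover have "Poly_Mapping.keys q \<subseteq> S"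
    proof
      fix k assume "k \<in> Poly_Mapping.keys q"
      then have "k = m \<or> k = n" by (auto simp: q_def in_keys_iff lookup_minus lookup_single when_def split: if_splits)
      then show "k \<in> S" using mn by auto
    qed
    moreover have "subst x q = 0" using mn by (simp add: q_def subst_diff ev[symmetric])
    ultimately show False using nz by blast
  qed
  show "\<not> mp.dependent (eval_mon x ` S)"
  proof
    assume "mp.dependent (eval_mon x ` S)"
    then obtain u where u: "\<exists>v\<in>eval_mon x ` S. u v \<noteq> 0" "(\<Sum>v\<in>eval_mon x ` S. scale (u v) v) = 0"
      using mp.dependent_finite[of "eval_mon x ` S"] fin by auto
    define q where "q = (\<Sum>m\<in>S. Poly_Mapping.single m (u (eval_mon x m)))"
    have lk: "Poly_Mapping.lookup q n = (if n \<in> S then u (eval_mon x n) else 0)" for n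
      unfolding q_def lookup_sum using fin by (simp add: lookup_single when_def)
    obtain m where "m \<in> S" "u (eval_mon x m) \<noteq> 0" using u(1) by auto
    then have "q \<noteq> 0" using lk[of m] by auto
    moreover have "Poly_Mapping.keys q \<subseteq> S" using lk by (auto simp: in_keys_iff split: if_splits)
    moreover have "subst x q = 0"
    proof -
      have "subst x q = (\<Sum>m\<in>S. scale (u (eval_mon x m)) (eval_mon x m))"
        by (simp add: q_def subst_sum subst_single scale_def)
      also have "\<dots> = (\<Sum>v\<in>eval_mon x ` S. scale (u v) v)"
        by (simp add: sum.reindex[OF inj])
      finally show ?thesis using u by simp
    qed
    ultimately show False using nz by blast
  qed
qed

text \<open>The \<open>(N + 1)\<^sup>d\<^sup>+\<^sup>1\<close> monomials in \<open>d + 1\<close> given polynomials with exponents at most \<open>N\<close> lie in the span of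
  the monomials in \<open>d\<close> variables with exponents at most \<open>N D\<close>, where \<open>D\<close> depends on the polynomials
  only. For large \<open>N\<close> the dimension of this span, \<open>(N D + 1)\<^sup>d\<close>, is too small for them to be independent.\<close>

lemma algebraically_dependent:
  fixes x :: "nat \<Rightarrow> ('v, 'k::field) mpoly"
  assumes F: "finite F" and x: "\<And>i. i \<le> card F \<Longrightarrow> x i \<in> polys F"
  obtains q where "q \<noteq> 0" "q \<in> polys {..card F}" "subst x q = 0"
proof -
  define d where "d = card F"
  have "\<exists>K. \<forall>i\<le>d. Poly_Mapping.keys (x i) \<subseteq> box F (K i)"
  proof -
    have "\<forall>i. \<exists>K. i \<le> d \<longrightarrow> Poly_Mapping.keys (x i) \<subseteq> box F K"
      using keys_in_box[OF x] unfolding d_def by metis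
    then show ?thesis by metis
  qed
  then obtain K where K: "\<And>i. i \<le> d \<Longrightarrow> Poly_Mapping.keys (x i) \<subseteq> box F (K i)" by blast
  define D where "D = (\<Sum>i\<le>d. K i)"
  \<comment> \<open>Then (N D + 1)^d < (N + 1)^(d + 1), since N D + 1 is at most (N + 1) (D + 1).\<close>
  define N where "N = Suc D ^ d"
  have "\<exists>q. q \<noteq> 0 \<and> Poly_Mapping.keys q \<subseteq> box {..d} N \<and> subst x q = 0"
  proof (rule ccontr)
    assume "\<not> ?thesis"
    then have nz: "\<And>q. q \<noteq> 0 \<Longrightarrow> Poly_Mapping.keys q \<subseteq> box {..d} N \<Longrightarrow> subst x q \<noteq> 0" by blast
    note ind = eval_mon_nonzero_independent[OF finite_box[OF finite_atMost] nz]
    have "eval_mon x ` box {..d} N \<subseteq> mp.span ((\<lambda>m. Poly_Mapping.single m 1) ` box F (N * D))"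
    proof (intro subsetI, elim imageE)
      fix p m assume m: "m \<in> box {..d} N" and p: "p = eval_mon x m"
      have "p = (\<Prod>i\<le>d. x i ^ Poly_Mapping.lookup m i)"
        using m eval_mon_superset[of "{..d}" m x] by (auto simp: p box_def)
      then have "Poly_Mapping.keys p \<subseteq> box F (\<Sum>i\<le>d. Poly_Mapping.lookup m i * K i)"
        using keys_prod_box[of "{..d}" "\<lambda>i. x i ^ Poly_Mapping.lookup m i" F "\<lambda>i. Poly_Mapping.lookup m i * K i"]
          keys_power_box[OF K] by simp
      also have "\<dots> \<subseteq> box F (N * D)"
        by (rule box_mono) (use m in \<open>auto simp: D_def sum_distrib_left box_def intro!: sum_mono mult_mono\<close>)
      finally show "p \<in> mp.span ((\<lambda>m. Poly_Mapping.single m 1) ` box F (N * D))"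
        by (rule mem_span_monomials)
    qed
    then have "card (eval_mon x ` box {..d} N) \<le> card ((\<lambda>m. Poly_Mapping.single m (1::'k)) ` box F (N * D))"
      using mp.independent_span_bound[OF _ ind(2)] finite_box[OF F] by blast
    also have "\<dots> \<le> card (box F (N * D))" by (rule card_image_le[OF finite_box[OF F]])
    also have "\<dots> = Suc (N * D) ^ d" by (simp add: card_box[OF F] d_def)
    finally have "Suc N ^ Suc d \<le> Suc (N * D) ^ d"
      by (simp add: card_image[OF ind(1)] card_box)
    also have "\<dots> \<le> (Suc N * Suc D) ^ d" by (rule power_mono) auto
    also have "\<dots> = Suc N ^ d * N" unfolding power_mult_distrib N_def ..
    also have "\<dots> < Suc N ^ Suc d" by simp
    finally show False by simp
  qed
  then obtain q where "q \<noteq> 0" "Poly_Mapping.keys q \<subseteq> box {..d} N" "subst x q = 0" by blast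
  then show thesis using that[of q] by (auto simp: polys_def box_def d_def)
qed

lemma split_off_variable:
  fixes q :: "('w, 'k::field) mpoly"
  assumes "q \<in> polys A" "\<forall>m\<in>Poly_Mapping.keys q. Poly_Mapping.lookup m i \<le> D"
  shows "\<exists>q0 r. q = q0 + poly_var i * r \<and> q0 \<in> polys (A - {i}) \<and> r \<in> polys A \<and>
     (\<forall>m\<in>Poly_Mapping.keys r. Poly_Mapping.lookup m i < D)"
proof -
  have "\<exists>q0 r. (\<Sum>m\<in>B. Poly_Mapping.single m (Poly_Mapping.lookup q m)) = q0 + poly_var i * r \<and>
     q0 \<in> polys (A - {i}) \<and> r \<in> polys A \<and> (\<forall>m\<in>Poly_Mapping.keys r. Poly_Mapping.lookup m i < D)"
    if "finite B" "B \<subseteq> Poly_Mapping.keys q" for B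
    using that
  proof induction
    case empty
    show ?case by (intro exI[of _ "0 :: ('w, 'k) mpoly"]) auto
  next
    case (insert m B)
    then obtain q0 r where qr: "(\<Sum>m\<in>B. Poly_Mapping.single m (Poly_Mapping.lookup q m)) = q0 + poly_var i * r"
      "q0 \<in> polys (A - {i})" "r \<in> polys A" "\<forall>m\<in>Poly_Mapping.keys r. Poly_Mapping.lookup m i < D"
      by auto
    define c where "c = Poly_Mapping.lookup q m"
    have sum: "(\<Sum>m\<in>insert m B. Poly_Mapping.single m (Poly_Mapping.lookup q m)) =
      Poly_Mapping.single m c + (q0 + poly_var i * r)"
      using insert qr(1) by (simp add: c_def)
    have mA: "Poly_Mapping.keys m \<subseteq> A" using insert assms(1) by (auto simp: polys_def)
    show ?case
    proof (cases "Poly_Mapping.lookup m i = 0")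
      case True
      then have "Poly_Mapping.single m c \<in> polys (A - {i})" using mA by (auto simp: in_keys_iff)
      then have "Poly_Mapping.single m c + q0 \<in> polys (A - {i})" using qr(2) by (rule P.add_C)
      then show ?thesis using qr unfolding sum
        by (intro exI[of _ "Poly_Mapping.single m c + q0"] exI[of _ r]) (auto simp: add.assoc)
    next
      case False
      define n where "n = m - Poly_Mapping.single i 1"
      have n: "m = Poly_Mapping.single i 1 + n"
        by (rule poly_mapping_eqI) (use False in \<open>auto simp: n_def lookup_add lookup_minus lookup_single when_def\<close>)
      have "Poly_Mapping.keys n \<subseteq> A" using mA n by (auto simp: in_keys_iff lookup_add)
      then have "r + Poly_Mapping.single n c \<in> polys A" using qr(3) by (intro P.add_C) auto
      moreover have "Poly_Mapping.lookup n i < D"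
      proof -
        have "Poly_Mapping.lookup m i \<le> D" using insert assms(2) by auto
        then show ?thesis using n by (simp add: lookup_add)
      qed
      then have "\<forall>k\<in>Poly_Mapping.keys (r + Poly_Mapping.single n c). Poly_Mapping.lookup k i < D"
        using Poly_Mapping.keys_add[of r "Poly_Mapping.single n c"] qr(4) by (auto split: if_splits)
      moreover have "Poly_Mapping.single m c = poly_var i * Poly_Mapping.single n c"
        using n by (simp add: poly_var_def mult_single)
      then have "Poly_Mapping.single m c + (q0 + poly_var i * r) = q0 + poly_var i * (r + Poly_Mapping.single n c)"
        by (simp add: algebra_simps)
      ultimately show ?thesis using qr(2) unfolding sum by blast
    qed
  qed
  from this[OF _ order_refl] show ?thesis by (simp add: sum_monomials)
qed

text \<open>The relation has the form \<open>x\<^sub>i\<^sup>m (q\<^sub>0 + x\<^sub>i r)\<close> where \<open>q\<^sub>0 \<noteq> 0\<close> does not involve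
  \<open>x\<^sub>i\<close>. The factor \<open>x\<^sub>i\<^sup>m\<close> can be cancelled modulo \<open>J\<^sub>i\<close>, and \<open>x\<^sub>i r\<close> vanishes modulo
  \<open>J\<^sub>i\<^sub>+\<^sub>1\<close>, so that \<open>q\<^sub>0\<close> has the same property for \<open>i + 1\<close>; after the last step it is a unit. The
  ideals \<open>J\<^sub>i\<close> will be the members of a chain of primes in one application, and in another the
  annihilators of the quotients of a module by the initial segments of a regular sequence.\<close>

lemma relation_collapse:
  fixes J :: "nat \<Rightarrow> ('v, 'k::field) mpoly set"
  assumes J: "\<And>i. i \<le> n \<Longrightarrow> ideal_in (polys V) (J i)" "\<And>i. i < n \<Longrightarrow> J i \<subseteq> J (Suc i)"
    and x: "\<And>i. i < n \<Longrightarrow> x i \<in> J (Suc i)" "\<And>i. i < n \<Longrightarrow> x i \<in> polys V"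
      "\<And>i. i < n \<Longrightarrow> reg_mod (polys V) (J i) (x i)"
    and q: "i \<le> n" "q \<noteq> 0" "q \<in> polys {i..<n}" "subst x q \<in> J i"
  shows "1 \<in> J n"
  using q
proof (induction "n - i" arbitrary: i q)
  case 0
  then have "i = n" by simp
  note Jn = P.ideal_inD[OF J(1)[OF order_refl]]
  define c where "c = Poly_Mapping.lookup q 0"
  have "Poly_Mapping.keys q \<subseteq> {0}" using 0 \<open>i = n\<close> by (auto simp: polys_def)
  then have "Poly_Mapping.single 0 c = q" using sum_monomials[of "{0}" q] by (simp add: c_def)
  then have "c \<noteq> 0" "Poly_Mapping.single 0 c \<in> J n" using 0 \<open>i = n\<close> by (auto simp: subst_single)
  then have "Poly_Mapping.single 0 (inverse c) * Poly_Mapping.single 0 c \<in> J n"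
    by (intro Jn(4)) auto
  then show ?case using \<open>c \<noteq> 0\<close> by (simp add: mult_single)
next
  case (Suc k)
  have i: "i < n" using Suc.hyps by simp
  note Ji = P.ideal_inD[OF J(1)[OF Suc.prems(1)]]
  have "Suc i \<le> n" using i by simp
  note JS = P.ideal_inD[OF J(1)[OF this]]
  have sub: "subst x r \<in> polys V" if "r \<in> polys {i..<n}" for r
    by (rule subst_polys[OF that]) (use x(2) in auto)
  have "1 \<in> J n" if "q \<noteq> 0" "q \<in> polys {i..<n}" "subst x q \<in> J i"
    "\<forall>m\<in>Poly_Mapping.keys q. Poly_Mapping.lookup m i \<le> D" for q D
    using that
  proof (induction D arbitrary: q rule: less_induct)
    case (less D)
    obtain q0 r where qr: "q = q0 + poly_var i * r" "q0 \<in> polys ({i..<n} - {i})" "r \<in> polys {i..<n}"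
      "\<forall>m\<in>Poly_Mapping.keys r. Poly_Mapping.lookup m i < D"
      using split_off_variable[OF less.prems(2,4)] by auto
    have sq: "subst x q = subst x q0 + x i * subst x r" by (simp add: qr(1) subst_add subst_mult)
    show ?case
    proof (cases "q0 = 0")
      case True
      then have "r \<noteq> 0" using less.prems qr by auto
      then obtain m where "m \<in> Poly_Mapping.keys r" by fastforce
      then have "D > 0" using qr(4) by fastforce
      have "subst x r \<in> J i"
        using x(3)[OF i] sub[OF qr(3)] less.prems(3) sq True by (auto simp: reg_mod_def)
      moreover have "\<forall>m\<in>Poly_Mapping.keys r. Poly_Mapping.lookup m i \<le> D - 1"
        using qr(4) by fastforce
      ultimately show ?thesis
        using less.IH[of "D - 1" r] \<open>D > 0\<close> \<open>r \<noteq> 0\<close> qr(3) by auto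
    next
      case False
      have "subst x r * x i \<in> J (Suc i)" using JS(4)[OF sub[OF qr(3)] x(1)[OF i]] .
      moreover have "subst x q \<in> J (Suc i)" using less.prems(3) J(2)[OF i] by auto
      ultimately have "subst x q - subst x r * x i \<in> J (Suc i)" by (intro JS(6))
      then have "subst x q0 \<in> J (Suc i)" by (simp add: sq mult.commute)
      moreover have "{i..<n} - {i} = {Suc i..<n}" by auto
      ultimately show ?thesis using Suc.hyps(1)[of "Suc i" q0] Suc.hyps(2) i False qr(2) by auto
    qed
  qed
  from this[OF Suc.prems(2-4), of "Max (insert 0 ((\<lambda>m. Poly_Mapping.lookup m i) ` Poly_Mapping.keys q))"]
  show ?case by simp
qed


section \<open>Stanley-Reisner ideals\<close>

text \<open>The intersection of the primes \<open>(x\<^sub>v | v \<notin> F)\<close>, described by its monomials. The single prime of \<open>F\<close>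
  is \<open>sr_ideal V {F}\<close>, and \<open>sr_ideal V {{}}\<close> is the ideal of polynomials without constant term.\<close>

definition sr_ideal :: "'v set \<Rightarrow> 'v set set \<Rightarrow> ('v, 'k::field) mpoly set" where
  "sr_ideal V \<F> = {p \<in> polys V. \<forall>m\<in>Poly_Mapping.keys p. \<forall>F\<in>\<F>. \<not> Poly_Mapping.keys m \<subseteq> F}"

lemma keys_exponent_add: "Poly_Mapping.keys (m + n) = Poly_Mapping.keys m \<union> Poly_Mapping.keys (n :: 'v exponent)"
  by (auto simp: in_keys_iff lookup_add)

lemma sr_ideal_ideal: "ideal_in (polys V) (sr_ideal V \<F> :: ('v, 'k::field) mpoly set)"
  unfolding ideal_in_def
proof (intro conjI ballI)
  fix p q :: "('v, 'k) mpoly" assume "p \<in> sr_ideal V \<F>" "q \<in> sr_ideal V \<F>"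
  then show "p + q \<in> sr_ideal V \<F>"
    using Poly_Mapping.keys_add[of p q] by (fastforce simp: sr_ideal_def intro: P.add_C)
next
  fix p q :: "('v, 'k) mpoly" assume pq: "p \<in> polys V" "q \<in> sr_ideal V \<F>"
  have "\<not> Poly_Mapping.keys m \<subseteq> F" if m: "m \<in> Poly_Mapping.keys (p * q)" and F: "F \<in> \<F>" for m F
  proof -
    obtain a b where "m = a + b" "b \<in> Poly_Mapping.keys q"
      using m Poly_Mapping.keys_mult[of p q] by blast
    then show ?thesis using pq F by (auto simp: sr_ideal_def keys_exponent_add)
  qed
  then show "p * q \<in> sr_ideal V \<F>" using pq by (auto simp: sr_ideal_def intro: P.mult_C)
qed (auto simp: sr_ideal_def)

lemma sr_ideal_subset: "sr_ideal V \<F> \<subseteq> polys V"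
  by (auto simp: sr_ideal_def)

lemma sr_ideal_antimono: "\<F> \<subseteq> \<G> \<Longrightarrow> sr_ideal V \<G> \<subseteq> sr_ideal V \<F>"
  by (auto simp: sr_ideal_def)

lemma sr_ideal_insertI:
  "p \<in> sr_ideal V {F} \<Longrightarrow> p \<in> sr_ideal V \<F> \<Longrightarrow> p \<in> sr_ideal V (insert F \<F>)"
  by (auto simp: sr_ideal_def)

lemma sr_ideal_empty [simp]: "sr_ideal V {} = polys V"
  by (simp add: sr_ideal_def)

text \<open>Setting the variables outside \<open>F\<close> to zero has kernel \<open>sr_ideal V {F}\<close>.\<close>

lemma lookup_subst_restrict:
  fixes p :: "('v, 'k::field) mpoly"
  shows "Poly_Mapping.lookup (subst (\<lambda>v. if v \<in> F then poly_var v else 0) p) m =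
     (if Poly_Mapping.keys m \<subseteq> F then Poly_Mapping.lookup p m else 0)"
proof (induction p rule: poly_induct)
  case (single n c)
  have "eval_mon (\<lambda>v. if v \<in> F then poly_var v else 0) n =
      (if Poly_Mapping.keys n \<subseteq> F then Poly_Mapping.single n 1 else (0 :: ('v, 'k) mpoly))" for n :: "'v exponent"
  proof (cases "Poly_Mapping.keys n \<subseteq> F")
    case True
    then have "eval_mon (\<lambda>v. if v \<in> F then poly_var v else 0) n = (eval_mon poly_var n :: ('v, 'k) mpoly)"
      unfolding eval_mon_def by (intro prod.cong) auto
    then show ?thesis using True by (simp add: eval_mon_var)
  next
    case False
    then obtain v where "v \<in> Poly_Mapping.keys n" "v \<notin> F" by auto
    then have "\<exists>v\<in>Poly_Mapping.keys n. (if v \<in> F then poly_var v else 0) ^ Poly_Mapping.lookup n v = (0 :: ('v, 'k) mpoly)"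
      by (intro bexI[of _ v]) (auto simp: in_keys_iff zero_power)
    then have "eval_mon (\<lambda>v. if v \<in> F then poly_var v else 0) n = (0 :: ('v, 'k) mpoly)"
      unfolding eval_mon_def by (intro prod_zero) auto
    then show ?thesis using False by simp
  qed
  then show ?case by (auto simp: subst_single mult_single lookup_single when_def)
qed (simp add: subst_add lookup_add)

lemma sr_ideal_single_iff:
  "p \<in> sr_ideal V {F} \<longleftrightarrow> p \<in> polys V \<and> subst (\<lambda>v. if v \<in> F then poly_var v else 0) p = 0"
proof -
  have "subst (\<lambda>v. if v \<in> F then poly_var v else 0) p = 0 \<longleftrightarrow>
      (\<forall>m. Poly_Mapping.keys m \<subseteq> F \<longrightarrow> Poly_Mapping.lookup p m = 0)"
    by (auto simp: poly_mapping_eq_iff fun_eq_iff lookup_subst_restrict)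
  then show ?thesis by (auto simp: sr_ideal_def in_keys_iff)
qed

lemma sr_ideal_prime: "prime_in (polys V) (sr_ideal V {F} :: ('v, 'k::field) mpoly set)"
  unfolding prime_in_def
proof (intro conjI ballI impI)
  show "1 \<notin> (sr_ideal V {F} :: ('v, 'k) mpoly set)" by (simp add: sr_ideal_def)
  fix p q :: "('v, 'k) mpoly" assume "p \<in> polys V" "q \<in> polys V" "p * q \<in> sr_ideal V {F}"
  then show "p \<in> sr_ideal V {F} \<or> q \<in> sr_ideal V {F}"
    using mpoly_no_zero_divisors by (auto simp: sr_ideal_single_iff subst_mult)
qed (rule sr_ideal_ideal)

lemma poly_var_mem_sr_ideal_iff:
  "v \<in> V \<Longrightarrow> (poly_var v :: ('v, 'k::field) mpoly) \<in> sr_ideal V {F} \<longleftrightarrow> v \<notin> F"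
  by (auto simp: sr_ideal_def poly_var_def)

lemma poly_var_polys: "v \<in> V \<Longrightarrow> poly_var v \<in> polys V"
  by (simp add: poly_var_def)

text \<open>Modulo the prime of \<open>W\<close>, the element \<open>t\<close> is the variable \<open>w\<close>.\<close>

lemma add_multiples_sr_ideal:
  fixes t :: "('v, 'k::field) mpoly"
  assumes w: "w \<in> W" "W \<subseteq> V" and t: "t - poly_var w \<in> sr_ideal V {W}"
  shows "add_multiples (sr_ideal V {W}) t (polys V) = sr_ideal V {W - {w}}"
proof (intro equalityI subsetI)
  let ?I = "sr_ideal V {W} :: ('v, 'k) mpoly set" and ?J = "sr_ideal V {W - {w}} :: ('v, 'k) mpoly set"
  note I = P.ideal_inD[OF sr_ideal_ideal[of V "{W}"]] and J = P.ideal_inD[OF sr_ideal_ideal[of V "{W - {w}}"]]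
  have IJ: "?I \<subseteq> ?J" by (auto simp: sr_ideal_def)
  have wJ: "poly_var w \<in> ?J" using w by (auto simp: poly_var_mem_sr_ideal_iff)
  {
    fix p assume "p \<in> add_multiples ?I t (polys V)"
    then obtain u n where un: "p = u + t * n" "u \<in> ?I" "n \<in> polys V" by (rule add_multiplesE)
    have "t - poly_var w + poly_var w \<in> ?J" by (rule J(3)) (use t IJ wJ in auto)
    then have "n * t \<in> ?J" using un(3) by (intro J(4)) simp_all
    then show "p \<in> ?J" using J(3)[of u "n * t"] un IJ by (auto simp: mult.commute)
  next
    fix p assume p: "p \<in> ?J"
    then have "p \<in> polys V" by (simp add: sr_ideal_def)
    then obtain p0 r where pr: "p = p0 + poly_var w * r" "p0 \<in> polys (V - {w})" "r \<in> polys V"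
      using split_off_variable[of p V w "Max (insert 0 ((\<lambda>m. Poly_Mapping.lookup m w) ` Poly_Mapping.keys p))"]
      by auto
    have "p - r * poly_var w \<in> ?J" by (rule J(6)[OF p J(4)[OF pr(3) wJ]])
    then have "p0 \<in> ?J" by (simp add: pr(1) mult.commute)
    moreover have "X \<subseteq> V - {w} \<Longrightarrow> X \<subseteq> W \<Longrightarrow> X \<subseteq> W - {w}" for X by auto
    ultimately have "p0 \<in> ?I" using pr(2) unfolding sr_ideal_def polys_def by blast
    then have "p0 - r * (t - poly_var w) \<in> ?I" by (rule I(6)) (rule I(4)[OF pr(3) t])
    then show "p \<in> add_multiples ?I t (polys V)"
      by (rule add_multiplesI[OF _ pr(3)]) (simp add: pr(1) algebra_simps)
  }
qed


section \<open>Shellings\<close>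

text \<open>The faces that \<open>F\<close> shares with members of \<open>\<F>\<close> are covered by faces of codimension one with the same
  property.\<close>

definition shells :: "'v set set \<Rightarrow> 'v set \<Rightarrow> bool" where
  "shells \<F> F \<longleftrightarrow> (\<forall>F'\<in>\<F>. \<exists>v\<in>F - F'. \<exists>F''\<in>\<F>. F - F'' = {v})"

fun shelling :: "'v set set \<Rightarrow> 'v set list \<Rightarrow> bool" where
  "shelling \<F> [] \<longleftrightarrow> True"
| "shelling \<F> (F # Fs) \<longleftrightarrow> shells \<F> F \<and> shelling (insert F \<F>) Fs"

lemma shellingI:
  assumes "\<And>i. i < length Fs \<Longrightarrow> shells (\<F> \<union> set (take i Fs)) (Fs ! i)"
  shows "shelling \<F> Fs"
  using assms
proof (induction Fs arbitrary: \<F>)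
  case (Cons F Fs)
  have "shells \<F> F" using Cons.prems[of 0] by simp
  moreover have "shelling (insert F \<F>) Fs"
    by (rule Cons.IH) (use Cons.prems[of "Suc i" for i] in auto)
  ultimately show ?case by simp
qed simp

lemma lookup_mult_monomial:
  fixes p :: "('v, 'k::field) mpoly"
  shows "Poly_Mapping.lookup (p * Poly_Mapping.single e 1) (m + e) = Poly_Mapping.lookup p m"
  by (induction p rule: poly_induct) (auto simp: distrib_right lookup_add mult_single lookup_single when_def)

text \<open>Let \<open>B\<close> be the set of all \<open>v\<close> with \<open>F - F'' = {v}\<close> for some \<open>F'' \<in> \<F>\<close>. A subset of \<open>F\<close> lies in no
  member of \<open>\<F>\<close> if and only if it contains \<open>B\<close>. Hence the monomials of \<open>sr_ideal V \<F>\<close> that are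
  nonzero modulo the prime of \<open>F\<close> are the multiples with support in \<open>F\<close> of \<open>m = \<Prod>\<^sub>v\<^sub>\<in>\<^sub>B x\<^sub>v\<close>, and
  the factor of the filtration that belongs to \<open>F\<close> is \<open>R/P\<^sub>F\<close>, generated by \<open>m\<close>.\<close>

lemma shelling_step:
  assumes F: "F \<subseteq> V" "finite F" and sh: "shells \<F> F"
  obtains m :: "('v, 'k::field) mpoly" where "m \<in> sr_ideal V \<F>"
    "\<And>r. r \<in> polys V \<Longrightarrow> r * m \<in> sr_ideal V (insert F \<F>) \<longleftrightarrow> r \<in> sr_ideal V {F}"
    "\<And>p. p \<in> sr_ideal V \<F> \<Longrightarrow> \<exists>r\<in>polys V. p - r * m \<in> sr_ideal V (insert F \<F>)"
proof -
  define B where "B = {v. \<exists>F''\<in>\<F>. F - F'' = {v}}"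
  have BF: "B \<subseteq> F" by (auto simp: B_def)
  then have finB: "finite B" using F(2) finite_subset by blast
  have Bnot: "\<not> B \<subseteq> F'" if "F' \<in> \<F>" for F'
    using sh that unfolding shells_def B_def by blast
  have Bsub: "B \<subseteq> X" if X: "X \<subseteq> F" "\<And>F'. F' \<in> \<F> \<Longrightarrow> \<not> X \<subseteq> F'" for X
  proof
    fix v assume "v \<in> B"
    then obtain F'' where F'': "F'' \<in> \<F>" "F - F'' = {v}" by (auto simp: B_def)
    then obtain w where w: "w \<in> X" "w \<notin> F''" using X(2) by blast
    then have "w \<in> F - F''" using X(1) by blast
    then show "v \<in> X" using w F''(2) by simp
  qed
  define e where "e = (\<Sum>v\<in>B. Poly_Mapping.single v (1::nat))"
  have e: "Poly_Mapping.lookup e v = (if v \<in> B then 1 else 0)" for v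
    using finB by (simp add: e_def lookup_sum lookup_single when_def)
  have keys_e: "Poly_Mapping.keys e = B" by (auto simp: in_keys_iff e split: if_splits)
  define m where "m = (Poly_Mapping.single e 1 :: ('v, 'k) mpoly)"
  have mpoly: "m \<in> polys V" using BF F by (auto simp: m_def keys_e)
  have msr: "m \<in> sr_ideal V \<F>"
    using mpoly Bnot by (auto simp: sr_ideal_def m_def keys_e)
  show thesis
  proof (rule that[OF msr])
    fix r :: "('v, 'k) mpoly" assume r: "r \<in> polys V"
    show "r * m \<in> sr_ideal V (insert F \<F>) \<longleftrightarrow> r \<in> sr_ideal V {F}"
    proof
      assume *: "r * m \<in> sr_ideal V (insert F \<F>)"
      have "\<not> Poly_Mapping.keys k \<subseteq> F" if "k \<in> Poly_Mapping.keys r" for k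
      proof -
        have "k + e \<in> Poly_Mapping.keys (r * m)"
          using that lookup_mult_monomial[of r e k] by (simp add: in_keys_iff m_def)
        then have "\<not> Poly_Mapping.keys (k + e) \<subseteq> F" using * unfolding sr_ideal_def by blast
        then show ?thesis using BF by (simp add: keys_exponent_add keys_e)
      qed
      then show "r \<in> sr_ideal V {F}" using r by (simp add: sr_ideal_def)
    next
      assume "r \<in> sr_ideal V {F}"
      then have "m * r \<in> sr_ideal V {F}" by (rule P.ideal_inD(4)[OF sr_ideal_ideal mpoly])
      moreover have "r * m \<in> sr_ideal V \<F>" by (rule P.ideal_inD(4)[OF sr_ideal_ideal r msr])
      ultimately show "r * m \<in> sr_ideal V (insert F \<F>)"
        unfolding mult.commute[of m r] by (rule sr_ideal_insertI)
    qed
  next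
    fix p :: "('v, 'k) mpoly" assume p: "p \<in> sr_ideal V \<F>"
    define K where "K = {k \<in> Poly_Mapping.keys p. Poly_Mapping.keys k \<subseteq> F}"
    define r where "r = (\<Sum>k\<in>K. Poly_Mapping.single (k - e) (Poly_Mapping.lookup p k))"
    have ke: "k = (k - e) + e" if k: "k \<in> K" for k
    proof (rule poly_mapping_eqI)
      fix v
      have "B \<subseteq> Poly_Mapping.keys k" using k p by (intro Bsub) (auto simp: K_def sr_ideal_def)
      then show "Poly_Mapping.lookup k v = Poly_Mapping.lookup ((k - e) + e) v"
        by (auto simp: lookup_add lookup_minus e in_keys_iff)
    qed
    have "r \<in> polys V"
    proof (unfold r_def, rule polys_sum)
      fix k assume k: "k \<in> K"
      have "Poly_Mapping.keys (k - e) \<subseteq> Poly_Mapping.keys k" by (auto simp: in_keys_iff lookup_minus)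
      then show "Poly_Mapping.single (k - e) (Poly_Mapping.lookup p k) \<in> polys V"
        using k F by (auto simp: K_def)
    qed
    have "r * m = (\<Sum>k\<in>K. Poly_Mapping.single k (Poly_Mapping.lookup p k))"
      unfolding r_def m_def sum_distrib_right
    proof (rule sum.cong[OF refl])
      fix k assume "k \<in> K"
      from ke[OF this] show "Poly_Mapping.single (k - e) (Poly_Mapping.lookup p k) * Poly_Mapping.single e 1 =
          Poly_Mapping.single k (Poly_Mapping.lookup p k)"
        by (simp add: mult_single)
    qed
    moreover have "p = (\<Sum>k\<in>Poly_Mapping.keys p. Poly_Mapping.single k (Poly_Mapping.lookup p k))"
      by (simp add: sum_monomials)
    ultimately have "p - r * m = (\<Sum>k\<in>Poly_Mapping.keys p - K. Poly_Mapping.single k (Poly_Mapping.lookup p k))"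
      using sum_diff[of "Poly_Mapping.keys p" K "\<lambda>k. Poly_Mapping.single k (Poly_Mapping.lookup p k)"]
      by (simp add: K_def)
    also have "\<dots> \<in> sr_ideal V (insert F \<F>)"
    proof -
      have *: "sum f A \<in> sr_ideal V (insert F \<F>)" if "\<And>k. k \<in> A \<Longrightarrow> f k \<in> sr_ideal V (insert F \<F>)"
        for f :: "'v exponent \<Rightarrow> ('v, 'k) mpoly" and A
        using that by (induction A rule: infinite_finite_induct)
          (auto intro: P.ideal_inD(2,3)[OF sr_ideal_ideal])
      show ?thesis by (rule *) (use p in \<open>auto simp: sr_ideal_def K_def polys_def\<close>)
    qed
    finally show "\<exists>r\<in>polys V. p - r * m \<in> sr_ideal V (insert F \<F>)" using \<open>r \<in> polys V\<close> by blast
  qed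
qed

lemma weakly_regular_refl: "ideal_in C N \<Longrightarrow> csubring C \<Longrightarrow> set as \<subseteq> C \<Longrightarrow> weakly_regular N N as"
  unfolding weakly_regular_def reg_mod_def
proof (intro allI impI ballI)
  fix i x assume *: "ideal_in C N" "csubring C" "set as \<subseteq> C" "i < length as" "x \<in> N"
  interpret csubring C by fact
  show "x \<in> seq_sum N N (take i as)"
    using seq_sum_ideal(2)[OF *(1,1) order_refl, of "take i as"] * set_take_subset[of i as] by blast
qed

text \<open>Each facet of the shelling contributes a factor \<open>R/P\<^sub>F\<close>, and regularity passes through extensions.\<close>

lemma shelling_weakly_regular:
  fixes \<theta> :: "('v, 'k::field) mpoly list"
  assumes "shelling \<F> Fs" "\<And>F. F \<in> set Fs \<Longrightarrow> F \<subseteq> V \<and> finite F" "set \<theta> \<subseteq> polys V"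
    and "\<And>F. F \<in> set Fs \<Longrightarrow> weakly_regular (polys V) (sr_ideal V {F}) \<theta>"
  shows "weakly_regular (sr_ideal V \<F>) (sr_ideal V (\<F> \<union> set Fs)) \<theta>"
  using assms
proof (induction Fs arbitrary: \<F>)
  case Nil
  then show ?case by (simp add: weakly_regular_refl[OF sr_ideal_ideal csubring_polys])
next
  case (Cons F Fs)
  define N' where "N' = (sr_ideal V (insert F \<F>) :: ('v, 'k) mpoly set)"
  define U where "U = (sr_ideal V (\<F> \<union> set (F # Fs)) :: ('v, 'k) mpoly set)"
  have N'N: "N' \<subseteq> sr_ideal V \<F>" and UN': "U \<subseteq> N'"
    unfolding U_def N'_def by (auto intro!: sr_ideal_antimono)
  have IN': "ideal_in (polys V) N'" and IU: "ideal_in (polys V) U"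
    unfolding N'_def U_def by (rule sr_ideal_ideal)+
  have "weakly_regular N' U \<theta>"
    unfolding N'_def U_def using Cons.IH[of "insert F \<F>"] Cons.prems by simp
  moreover have "N' \<inter> U = U" using UN' by auto
  moreover have "weakly_regular (sr_ideal V \<F>) N' \<theta>"
  proof -
    obtain m where m: "m \<in> sr_ideal V \<F>"
      "\<And>r. r \<in> polys V \<Longrightarrow> r * m \<in> N' \<longleftrightarrow> r \<in> sr_ideal V {F}"
      "\<And>p. p \<in> sr_ideal V \<F> \<Longrightarrow> \<exists>r\<in>polys V. p - r * m \<in> N'"
      using shelling_step[of F V \<F>, where ?'k = 'k] Cons.prems unfolding N'_def by auto
    show ?thesis
      using P.weakly_regular_cyclic[OF sr_ideal_ideal IN' sr_ideal_ideal N'N Cons.prems(3) m(1) m(3,2)]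
        Cons.prems(4)[of F] by simp
  qed
  moreover have "{n + u | n u. n \<in> N' \<and> u \<in> U} = N'"
  proof (intro equalityI subsetI)
    fix x assume "x \<in> N'"
    then have "x = x + 0 \<and> x \<in> N' \<and> 0 \<in> U" using P.ideal_inD(2)[OF IU] by simp
    then show "x \<in> {n + u | n u. n \<in> N' \<and> u \<in> U}" by blast
  qed (use UN' P.ideal_inD(3)[OF IN'] in auto)
  ultimately show ?case
    using P.weakly_regular_extension[OF sr_ideal_ideal IN' IU N'N _ Cons.prems(3)] UN' N'N
    unfolding U_def by auto
qed

lemma seq_sum_mono: "U \<subseteq> U' \<Longrightarrow> seq_sum N U as \<subseteq> seq_sum N U' as"
proof (induction as arbitrary: U U')
  case (Cons a as)
  have "add_multiples U a N \<subseteq> add_multiples U' a N"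
    using Cons.prems unfolding add_multiples_def by blast
  then show ?case using Cons.IH by simp
qed simp

lemma (in csubring) seq_sum_subset:
  assumes J: "ideal_in C J" and "U \<subseteq> J" "set as \<subseteq> J"
  shows "seq_sum C U as \<subseteq> J"
  using assms(2,3)
proof (induction as arbitrary: U)
  case (Cons a as)
  have "add_multiples U a C \<subseteq> J"
  proof
    fix x assume "x \<in> add_multiples U a C"
    then obtain u n where "x = u + a * n" "u \<in> U" "n \<in> C" by (rule add_multiplesE)
    then show "x \<in> J" using ideal_inD(3)[OF J, of u "n * a"] ideal_inD(4)[OF J, of n a] Cons.prems
      by (auto simp: mult.commute)
  qed
  then show ?case using Cons by simp
qed simp

text \<open>The factor of the first facet is the quotient \<open>R/P\<^sub>F\<close> of the whole module. Polynomials without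
  constant term do not generate the unit ideal modulo \<open>P\<^sub>F\<close>.\<close>

lemma shelling_seq_sum_proper:
  fixes \<theta> :: "('v, 'k::field) mpoly list"
  assumes "shelling \<F> (F # Fs)" "F \<subseteq> V" "finite F" "set \<theta> \<subseteq> sr_ideal V {{}}"
  shows "seq_sum (sr_ideal V \<F>) (sr_ideal V (\<F> \<union> set (F # Fs))) \<theta> \<noteq> sr_ideal V \<F>"
proof
  assume eq: "seq_sum (sr_ideal V \<F>) (sr_ideal V (\<F> \<union> set (F # Fs))) \<theta> = sr_ideal V \<F>"
  define N' where "N' = (sr_ideal V (insert F \<F>) :: ('v, 'k) mpoly set)"
  have N'N: "N' \<subseteq> sr_ideal V \<F>" and UN': "sr_ideal V (\<F> \<union> set (F # Fs)) \<subseteq> N'"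
    unfolding N'_def by (auto intro!: sr_ideal_antimono)
  have IN': "ideal_in (polys V) N'" unfolding N'_def by (rule sr_ideal_ideal)
  have \<theta>: "set \<theta> \<subseteq> polys V" using assms(4) sr_ideal_subset by blast
  obtain m where m: "m \<in> sr_ideal V \<F>"
    "\<And>r. r \<in> polys V \<Longrightarrow> r * m \<in> N' \<longleftrightarrow> r \<in> sr_ideal V {F}"
    "\<And>p. p \<in> sr_ideal V \<F> \<Longrightarrow> \<exists>r\<in>polys V. p - r * m \<in> N'"
    using shelling_step[of F V \<F>, where ?'k = 'k] assms unfolding N'_def by auto
  have "m \<in> seq_sum (sr_ideal V \<F>) N' \<theta>" using m(1) eq seq_sum_mono[OF UN'] by blast
  moreover have "\<forall>r\<in>polys V. r * m \<in> seq_sum (sr_ideal V \<F>) N' \<theta> \<longleftrightarrow> r \<in> seq_sum (polys V) (sr_ideal V {F}) \<theta>"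
    using P.weakly_regular_cyclic[OF sr_ideal_ideal IN' sr_ideal_ideal N'N \<theta> m(1) m(3,2)] by simp
  ultimately have "1 \<in> seq_sum (polys V) (sr_ideal V {F}) \<theta>" by (metis P.one_C mult_1)
  also have "\<dots> \<subseteq> sr_ideal V {{}}"
    by (rule P.seq_sum_subset[OF sr_ideal_ideal]) (use assms(4) in \<open>auto simp: sr_ideal_def\<close>)
  finally show False by (simp add: sr_ideal_def)
qed

text \<open>After setting the variables outside \<open>F\<close> to zero, \<open>d + 1\<close> polynomials satisfy an algebraic relation.
  The product of the relations for all \<open>F\<close> annihilates one factor of the filtration after the other.\<close>

lemma shelling_relation:
  fixes x :: "nat \<Rightarrow> ('v, 'k::field) mpoly"
  assumes "\<And>F. F \<in> set Fs \<Longrightarrow> finite F \<and> card F = d" "\<And>i. i \<le> d \<Longrightarrow> x i \<in> polys V"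
  obtains q where "q \<noteq> 0" "q \<in> polys {..d}"
    "\<And>n. n \<in> sr_ideal V \<F> \<Longrightarrow> subst x q * n \<in> sr_ideal V (\<F> \<union> set Fs)"
proof -
  have "\<exists>q. q \<noteq> 0 \<and> q \<in> polys {..d} \<and> (\<forall>n\<in>sr_ideal V \<F>. subst x q * n \<in> sr_ideal V (\<F> \<union> set Fs))"
    using assms(1)
  proof (induction Fs arbitrary: \<F>)
    case Nil
    show ?case by (intro exI[of _ "1 :: (nat, 'k) mpoly"]) (auto simp: polys_def)
  next
    case (Cons F Fs)
    then obtain q where q: "q \<noteq> 0" "q \<in> polys {..d}"
      "\<forall>n\<in>sr_ideal V (insert F \<F>). subst x q * n \<in> sr_ideal V (insert F \<F> \<union> set Fs)"
      by (metis list.set_intros(2))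
    define \<sigma> where "\<sigma> = (\<lambda>v. if v \<in> F then poly_var v else 0 :: ('v, 'k) mpoly)"
    have F: "finite F" "card F = d" using Cons.prems by auto
    have "subst \<sigma> (x i) \<in> polys F" if "i \<le> d" for i
      by (rule subst_polys[OF assms(2)[OF that]]) (auto simp: \<sigma>_def poly_var_polys)
    then obtain p where p: "p \<noteq> 0" "p \<in> polys {..d}" "subst (\<lambda>i. subst \<sigma> (x i)) p = 0"
      using algebraically_dependent[OF F(1), of "\<lambda>i. subst \<sigma> (x i)"] F(2) by metis
    have pV: "subst x p \<in> polys V" by (rule subst_polys[OF p(2)]) (use assms(2) in auto)
    have "subst \<sigma> (subst x p) = 0" using p(3) by (simp add: subst_subst)
    then have pF: "subst x p \<in> sr_ideal V {F}" using pV by (simp add: sr_ideal_single_iff \<sigma>_def)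
    have "subst x (p * q) * n \<in> sr_ideal V (\<F> \<union> set (F # Fs))" if n: "n \<in> sr_ideal V \<F>" for n
    proof -
      have "n * subst x p \<in> sr_ideal V {F}"
        using n pF sr_ideal_subset by (intro P.ideal_inD(4)[OF sr_ideal_ideal]) auto
      moreover have "subst x p * n \<in> sr_ideal V \<F>" by (rule P.ideal_inD(4)[OF sr_ideal_ideal pV n])
      ultimately have "subst x p * n \<in> sr_ideal V (insert F \<F>)"
        unfolding mult.commute[of n "subst x p"] by (rule sr_ideal_insertI)
      then have "subst x q * (subst x p * n) \<in> sr_ideal V (insert F \<F> \<union> set Fs)" using q(3) by blast
      then show ?thesis by (simp add: subst_mult mult_ac)
    qed
    moreover have "p * q \<noteq> 0" using mpoly_no_zero_divisors p(1) q(1) by blast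
    moreover have "p * q \<in> polys {..d}" using p(2) q(2) by (rule P.mult_C)
    ultimately show ?case by blast
  qed
  then show thesis using that by blast
qed

lemma irrelevant_ideal_subset: "irrelevant_ideal V \<subseteq> (sr_ideal V {{}} :: ('v, 'k::field) mpoly set)"
proof -
  interpret cring "set_ring (polys V :: ('v, 'k) mpoly set)" by (rule P.cring_set_ring)
  show ?thesis unfolding irrelevant_ideal_def poly_ring_eq
    by (rule genideal_minimal)
      (use P.ideal_iff sr_ideal_ideal in \<open>auto simp: poly_var_mem_sr_ideal_iff\<close>)
qed

lemma poly_var_irrelevant: "v \<in> V \<Longrightarrow> (poly_var v :: ('v, 'k::field) mpoly) \<in> irrelevant_ideal V"
proof -
  assume v: "v \<in> V"
  interpret cring "set_ring (polys V :: ('v, 'k) mpoly set)" by (rule P.cring_set_ring)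
  have "poly_var ` V \<subseteq> Idl\<^bsub>set_ring (polys V :: ('v, 'k) mpoly set)\<^esub> (poly_var ` V)"
    by (rule genideal_self) (auto simp: poly_var_polys)
  then show ?thesis using v by (auto simp: irrelevant_ideal_def poly_ring_eq)
qed

lemma irrelevant_ideal_add:
  "p \<in> irrelevant_ideal V \<Longrightarrow> q \<in> irrelevant_ideal V \<Longrightarrow> p + q \<in> (irrelevant_ideal V :: ('v, 'k::field) mpoly set)"
proof -
  interpret cring "set_ring (polys V :: ('v, 'k) mpoly set)" by (rule P.cring_set_ring)
  have "ideal (irrelevant_ideal V) (set_ring (polys V :: ('v, 'k) mpoly set))"
    unfolding irrelevant_ideal_def poly_ring_eq by (rule genideal_ideal) (auto simp: poly_var_polys)
  then show "p \<in> irrelevant_ideal V \<Longrightarrow> q \<in> irrelevant_ideal V \<Longrightarrow> p + q \<in> (irrelevant_ideal V :: ('v, 'k) mpoly set)"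
    using P.ideal_iff P.ideal_inD(3) by blast
qed


section \<open>Depth and dimension of one layer\<close>

text \<open>For the upper bound, let \<open>J\<^sub>i\<close> consist of the multipliers of \<open>N\<close> into \<open>U + (a\<^sub>1, \<dots>, a\<^sub>i) N\<close>. A regular
  sequence on \<open>N/U\<close> is regular modulo these ideals as well, and \<open>1 \<in> J\<^sub>d\<^sub>+\<^sub>1\<close> means that the quotient of
  \<open>N/U\<close> by \<open>d + 1\<close> of its elements vanishes.\<close>

lemma depth_layer:
  fixes \<theta> :: "('v, 'k::field) mpoly list" and M :: "(('v, 'k) mpoly, 'b, 'n) module_scheme"
  assumes P: "presents (polys V) (sr_ideal V \<F>) (sr_ideal V (\<F> \<union> set Fs)) M h"
    and sh: "shelling \<F> Fs" "Fs \<noteq> []" and Fs: "\<And>F. F \<in> set Fs \<Longrightarrow> F \<subseteq> V \<and> finite F \<and> card F = d"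
    and \<theta>: "length \<theta> = d" "set \<theta> \<subseteq> irrelevant_ideal V"
      "\<And>F. F \<in> set Fs \<Longrightarrow> weakly_regular (polys V) (sr_ideal V {F}) \<theta>"
  shows "depth (poly_ring V) (irrelevant_ideal V) M = ereal (real d)"
proof -
  let ?N = "sr_ideal V \<F> :: ('v, 'k) mpoly set" and ?U = "sr_ideal V (\<F> \<union> set Fs) :: ('v, 'k) mpoly set"
  have UN: "?U \<subseteq> ?N" by (rule sr_ideal_antimono) auto
  have irr: "irrelevant_ideal V \<subseteq> (polys V :: ('v, 'k) mpoly set)"
    using irrelevant_ideal_subset sr_ideal_subset by blast
  note reg = P.presents_regular_sequence[OF P]
  define L where "L = {as :: ('v, 'k) mpoly list. set as \<subseteq> irrelevant_ideal V \<and> regular_sequence (poly_ring V) M as}"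
  obtain F Gs where FG: "Fs = F # Gs" using sh(2) by (cases Fs) auto
  have "\<theta> \<in> L"
  proof -
    have "weakly_regular ?N ?U \<theta>"
      by (rule shelling_weakly_regular[OF sh(1)]) (use Fs \<theta> irr in auto)
    moreover have "seq_sum ?N ?U \<theta> \<noteq> ?N"
      unfolding FG by (rule shelling_seq_sum_proper)
        (use sh Fs FG \<theta>(2) irrelevant_ideal_subset[of V, where ?'k = 'k] in auto)
    ultimately show ?thesis using reg[of \<theta>] \<theta>(2) irr by (auto simp: L_def poly_ring_eq)
  qed
  moreover have "length as \<le> d" if "as \<in> L" for as
  proof (rule ccontr)
    assume "\<not> length as \<le> d"
    then have len: "Suc d \<le> length as" by simp
    have asC: "set as \<subseteq> polys V" using that irr by (auto simp: L_def)
    have wr: "weakly_regular ?N ?U as" and ne: "seq_sum ?N ?U as \<noteq> ?N"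
      using that reg[OF asC] by (auto simp: L_def poly_ring_eq)
    have asV: "as ! i \<in> polys V" if "i \<le> d" for i
      using that len asC nth_mem[of i as] by auto
    obtain q where q: "q \<noteq> 0" "q \<in> polys {..d}" "\<And>n. n \<in> ?N \<Longrightarrow> subst ((!) as) q * n \<in> ?U"
      using shelling_relation[of Fs d "(!) as" V \<F>] Fs asV by auto
    define J where "J i = {c \<in> polys V. \<forall>n\<in>?N. c * n \<in> seq_sum ?N ?U (take i as)}" for i
    have S: "set (take i as) \<subseteq> polys V" for i using asC set_take_subset[of i as] by blast
    note sI = P.seq_sum_ideal[OF sr_ideal_ideal sr_ideal_ideal UN]
    have step: "take (Suc i) as = take i as @ [as ! i]" if "i < Suc d" for i
      using that len by (simp add: take_Suc_conv_app_nth)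
    have "1 \<in> J (Suc d)"
    proof (rule relation_collapse[where i = 0 and q = q and x = "(!) as" and V = V])
      show "ideal_in (polys V) (J i)" for i
        unfolding J_def by (rule P.ideal_in_annihilator) (rule sI(1)[OF S])
      show "J i \<subseteq> J (Suc i)" if "i < Suc d" for i
      proof -
        have "seq_sum ?N ?U (take i as) \<subseteq> seq_sum ?N ?U (take (Suc i) as)"
          unfolding step[OF that] seq_sum_append
          by (rule P.seq_sum_ideal(2)[OF sr_ideal_ideal sI(1)[OF S] sI(3)[OF S]]) (use asC len that in auto)
        then show ?thesis by (auto simp: J_def)
      qed
      fix i assume i: "i < Suc d"
      then have mem: "as ! i \<in> set as" using len by auto
      show "as ! i \<in> polys V" using mem asC by auto
      show "as ! i \<in> J (Suc i)"
        using sI(4)[OF S[of "Suc i"], of "as ! i"] step[OF i] mem asC by (auto simp: J_def)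
      show "reg_mod (polys V) (J i) (as ! i)"
        unfolding reg_mod_def
      proof (intro ballI impI)
        fix y assume y: "y \<in> polys V" "as ! i * y \<in> J i"
        have "y * n \<in> seq_sum ?N ?U (take i as)" if n: "n \<in> ?N" for n
        proof -
          have "y * n \<in> ?N" by (rule P.ideal_inD(4)[OF sr_ideal_ideal y(1) n])
          moreover have "as ! i * (y * n) \<in> seq_sum ?N ?U (take i as)"
            using y(2) n by (auto simp: J_def mult.assoc)
          ultimately show ?thesis using wr i len by (auto simp: weakly_regular_def reg_mod_def)
        qed
        then show "y \<in> J i" using y(1) by (simp add: J_def)
      qed
    next
      show "subst ((!) as) q \<in> J 0"
        using q(3) subst_polys[OF q(2), of "(!) as" V] asV by (auto simp: J_def)
      show "q \<in> polys {0..<Suc d}" using q(2) by (simp add: atLeast0LessThan lessThan_Suc_atMost)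
    qed (use q in auto)
    then have "?N \<subseteq> seq_sum ?N ?U (take (Suc d) as)" by (auto simp: J_def)
    also have "\<dots> \<subseteq> seq_sum ?N ?U (take (Suc d) as @ drop (Suc d) as)"
      unfolding seq_sum_append
      by (rule P.seq_sum_ideal(2)[OF sr_ideal_ideal sI(1)[OF S] sI(3)[OF S]])
        (use asC set_drop_subset[of "Suc d" as] in blast)
    finally show False using ne sI(3)[OF asC] by simp
  qed
  ultimately have "(SUP as\<in>L. ereal (real (length as))) = ereal (real d)"
    using \<theta>(1) by (intro antisym SUP_least SUP_upper2[of \<theta>]) auto
  then show ?thesis by (simp add: depth_def L_def)
qed

text \<open>The annihilator is contained in the prime of the first facet, from which a chain of length \<open>d\<close>
  ascends by adding variables. It contains a relation between any \<open>d + 1\<close> elements, and a longer chain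
  of primes would consist of ideals that are separated by such elements.\<close>

lemma dim_layer:
  fixes M :: "(('v, 'k::field) mpoly, 'b, 'n) module_scheme"
  assumes P: "presents (polys V) (sr_ideal V \<F>) (sr_ideal V (\<F> \<union> set Fs)) M h"
    and sh: "shelling \<F> Fs" "Fs \<noteq> []" and Fs: "\<And>F. F \<in> set Fs \<Longrightarrow> F \<subseteq> V \<and> finite F \<and> card F = d"
  shows "module_dim (poly_ring V) M = ereal (real d)"
proof -
  let ?N = "sr_ideal V \<F> :: ('v, 'k) mpoly set" and ?U = "sr_ideal V (\<F> \<union> set Fs) :: ('v, 'k) mpoly set"
  define A where "A = {c \<in> polys V. \<forall>n\<in>?N. c * n \<in> ?U}"
  have ann: "annihilator (poly_ring V) M = A"
    unfolding poly_ring_eq A_def by (rule P.presents_annihilator[OF P])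
  obtain F Gs where FG: "Fs = F # Gs" using sh(2) by (cases Fs) auto
  have F: "F \<subseteq> V" "finite F" "card F = d" using Fs FG by auto
  obtain vs where vs: "set vs = F" "distinct vs" using finite_distinct_list[OF F(2)] by auto
  have len: "length vs = d" using vs F distinct_card by metis
  define Q where "Q i = (sr_ideal V {set (drop i vs)} :: ('v, 'k) mpoly set)" for i
  have "krull_dim (set_ring (polys V) Quot A) = ereal (real d)"
  proof (rule P.krull_dim_quotI[where P = Q])
    show "ideal_in (polys V) A" unfolding A_def by (rule P.ideal_in_annihilator) (rule sr_ideal_ideal)
    show "prime_in (polys V) (Q i)" for i unfolding Q_def by (rule sr_ideal_prime)
    show "Q i \<subset> Q (Suc i)" if i: "i < d" for i
    proof
      have dr: "drop i vs = vs ! i # drop (Suc i) vs" using i len by (simp add: Cons_nth_drop_Suc)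
      show "Q i \<subseteq> Q (Suc i)" unfolding Q_def dr by (auto simp: sr_ideal_def)
      have "vs ! i \<in> V" using vs F i len by auto
      moreover have "vs ! i \<notin> set (drop (Suc i) vs)"
        using distinct_drop[OF vs(2), of i] unfolding dr by simp
      ultimately have "poly_var (vs ! i) \<in> Q (Suc i)" "poly_var (vs ! i) \<notin> Q i"
        unfolding Q_def dr by (simp_all add: poly_var_mem_sr_ideal_iff)
      then show "Q i \<noteq> Q (Suc i)" by auto
    qed
    show "A \<subseteq> Q 0"
    proof
      fix r assume r: "r \<in> A"
      obtain m where m: "m \<in> ?N"
        "\<And>r. r \<in> polys V \<Longrightarrow> r * m \<in> sr_ideal V (insert F \<F>) \<longleftrightarrow> r \<in> sr_ideal V {F}"
        "\<And>p. p \<in> ?N \<Longrightarrow> \<exists>r\<in>polys V. p - r * m \<in> sr_ideal V (insert F \<F>)"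
        using shelling_step[of F V \<F>, where ?'k = 'k] F sh(1) FG by auto
      have "?U \<subseteq> sr_ideal V (insert F \<F>)" using FG by (intro sr_ideal_antimono) auto
      then show "r \<in> Q 0" using r m vs by (auto simp: A_def Q_def)
    qed
    fix n and Q' :: "nat \<Rightarrow> ('v, 'k) mpoly set"
    assume Q': "\<And>i. i \<le> n \<Longrightarrow> prime_in (polys V) (Q' i)" "\<And>i. i < n \<Longrightarrow> Q' i \<subset> Q' (Suc i)" "A \<subseteq> Q' 0"
    show "n \<le> d"
    proof (rule ccontr)
      assume "\<not> n \<le> d"
      then have n: "Suc d \<le> n" by simp
      have "\<exists>x. x \<in> Q' (Suc i) \<and> x \<notin> Q' i" if "i < n" for i using Q'(2)[OF that] by auto
      then obtain x where x: "\<And>i. i < n \<Longrightarrow> x i \<in> Q' (Suc i) \<and> x i \<notin> Q' i" by metis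
      have id: "ideal_in (polys V) (Q' i)" if "i \<le> n" for i using Q'(1)[OF that] by (simp add: prime_in_def)
      have xV: "x i \<in> polys V" if "i < n" for i
        using P.ideal_inD(7)[OF id[of "Suc i"]] x[OF that] that by auto
      obtain q where q: "q \<noteq> 0" "q \<in> polys {..d}" "\<And>n. n \<in> ?N \<Longrightarrow> subst x q * n \<in> ?U"
        using shelling_relation[of Fs d x V \<F>] Fs xV n by auto
      have "1 \<in> Q' (Suc d)"
      proof (rule relation_collapse[where i = 0 and q = q and x = x and V = V])
        show "subst x q \<in> Q' 0"
          using q(3) subst_polys[OF q(2), of x V] xV n Q'(3) by (auto simp: A_def)
        show "q \<in> polys {0..<Suc d}" using q(2) by (simp add: atLeast0LessThan lessThan_Suc_atMost)
        show "Q' i \<subseteq> Q' (Suc i)" if "i < Suc d" for i using Q'(2)[of i] that n by auto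
      qed (use q x xV n id P.reg_mod_prime[OF Q'(1)] in auto)
      then show False using Q'(1)[OF n] by (simp add: prime_in_def)
    qed
  qed
  then show ?thesis by (simp add: module_dim_def ann) (simp add: poly_ring_eq)
qed


section \<open>Gradings\<close>

definition hom_part :: "int \<Rightarrow> ('v, 'k::field) mpoly \<Rightarrow> ('v, 'k) mpoly" where
  "hom_part d p =
     (\<Sum>m\<in>{m \<in> Poly_Mapping.keys p. int (mon_degree m) = d}. Poly_Mapping.single m (Poly_Mapping.lookup p m))"

lemma lookup_hom_part:
  "Poly_Mapping.lookup (hom_part d p) m = (if int (mon_degree m) = d then Poly_Mapping.lookup p m else 0)"
proof -
  let ?K = "{m \<in> Poly_Mapping.keys p. int (mon_degree m) = d}"
  have "Poly_Mapping.lookup (hom_part d p) m = (\<Sum>n\<in>?K. if n = m then Poly_Mapping.lookup p n else 0)"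
    unfolding hom_part_def lookup_sum by (rule sum.cong) (auto simp: lookup_single)
  also have "\<dots> = (if m \<in> ?K then Poly_Mapping.lookup p m else 0)"
    by (subst sum.delta) auto
  finally show ?thesis by (auto simp: in_keys_iff)
qed

lemma keys_hom_part: "Poly_Mapping.keys (hom_part d p) \<subseteq> Poly_Mapping.keys p"
  by (auto simp: in_keys_iff lookup_hom_part split: if_splits)

lemma hom_part_diff: "hom_part d (p - q) = hom_part d p - hom_part d q"
  by (rule poly_mapping_eqI) (simp add: lookup_hom_part lookup_minus)

lemma hom_part_sum: "hom_part d (sum f A) = (\<Sum>i\<in>A. hom_part d (f i))"
  by (rule poly_mapping_eqI) (simp add: lookup_hom_part lookup_sum)

lemma poly_component_eq: "poly_component V d = {p \<in> polys V. \<forall>m\<in>Poly_Mapping.keys p. int (mon_degree m) = d}"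
  by (simp add: poly_component_def poly_ring_eq)

lemma hom_part_component:
  assumes "p \<in> poly_component V d"
  shows "hom_part e p = (if e = d then p else 0)"
proof (rule poly_mapping_eqI)
  fix m
  show "Poly_Mapping.lookup (hom_part e p) m = Poly_Mapping.lookup (if e = d then p else 0) m"
    using assms by (auto simp: lookup_hom_part poly_component_eq in_keys_iff)
qed

lemma sum_hom_parts:
  assumes "finite D" "(\<lambda>m. int (mon_degree m)) ` Poly_Mapping.keys p \<subseteq> D"
  shows "(\<Sum>d\<in>D. hom_part d p) = p"
proof (rule poly_mapping_eqI)
  fix m
  have "Poly_Mapping.lookup p m = 0" if "int (mon_degree m) \<notin> D"
    using assms(2) that by (metis image_subset_iff in_keys_iff)
  then show "Poly_Mapping.lookup (\<Sum>d\<in>D. hom_part d p) m = Poly_Mapping.lookup p m"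
    using assms(1) by (auto simp: lookup_sum lookup_hom_part)
qed

lemma mon_degree_add: "mon_degree (m + n) = mon_degree m + mon_degree n"
proof -
  let ?A = "Poly_Mapping.keys m \<union> Poly_Mapping.keys n"
  have *: "mon_degree k = (\<Sum>v\<in>?A. Poly_Mapping.lookup k v)" if "Poly_Mapping.keys k \<subseteq> ?A" for k
    unfolding mon_degree_def by (rule sum.mono_neutral_left) (use that in \<open>auto simp: in_keys_iff\<close>)
  have "mon_degree (m + n) = (\<Sum>v\<in>?A. Poly_Mapping.lookup (m + n) v)"
    by (rule *) (simp add: keys_exponent_add)
  then show ?thesis using *[of m] *[of n] by (simp add: lookup_add sum.distrib)
qed

lemma poly_component_mult:
  assumes "p \<in> poly_component V d" "q \<in> poly_component V e"
  shows "p * q \<in> poly_component V (d + e)"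
proof -
  have "int (mon_degree m) = d + e" if m: "m \<in> Poly_Mapping.keys (p * q)" for m
  proof -
    obtain a b where "m = a + b" "a \<in> Poly_Mapping.keys p" "b \<in> Poly_Mapping.keys q"
      using m Poly_Mapping.keys_mult[of p q] by blast
    then show ?thesis using assms by (simp add: mon_degree_add poly_component_eq)
  qed
  then show ?thesis using assms by (auto simp: poly_component_eq)
qed

lemma poly_component_closed:
  fixes p q :: "('v, 'k::field) mpoly"
  shows "(0 :: ('v, 'k) mpoly) \<in> poly_component V d"
  "p \<in> poly_component V d \<Longrightarrow> q \<in> poly_component V d \<Longrightarrow> p + q \<in> poly_component V d"
  "p \<in> poly_component V d \<Longrightarrow> - p \<in> poly_component V d"
proof -
  show "(0 :: ('v, 'k) mpoly) \<in> poly_component V d" by (simp add: poly_component_eq)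
  show "p + q \<in> poly_component V d" if "p \<in> poly_component V d" "q \<in> poly_component V d"
    using that Poly_Mapping.keys_add[of p q] unfolding poly_component_eq by blast
  show "- p \<in> poly_component V d" if "p \<in> poly_component V d"
    using that by (auto simp: poly_component_eq in_keys_iff)
qed

definition homogeneous :: "('v, 'k::field) mpoly set \<Rightarrow> bool" where
  "homogeneous J \<longleftrightarrow> (\<forall>p\<in>J. \<forall>d. hom_part d p \<in> J)"

lemma homogeneous_sr_ideal: "homogeneous (sr_ideal V \<F>)"
  unfolding homogeneous_def sr_ideal_def polys_def using keys_hom_part by blast

lemma hom_part_in_component: "p \<in> polys V \<Longrightarrow> hom_part d p \<in> poly_component V d"
  using keys_hom_part[of d p] by (auto simp: poly_component_eq polys_def in_keys_iff lookup_hom_part split: if_splits)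

lemma (in csubring) presents_finsum:
  assumes P: "presents C N U M h" and "finite A" "\<And>i. i \<in> A \<Longrightarrow> g i \<in> N"
  shows "finsum M (\<lambda>i. h (g i)) A = h (\<Sum>i\<in>A. g i)"
  using assms(2,3)
proof (induction A)
  case empty
  interpret Module.module R M by (rule presents_module[OF P])
  show ?case using presentsD(5)[OF P] by simp
next
  case (insert a A)
  interpret Module.module R M by (rule presents_module[OF P])
  note N = ideal_inD[OF presentsD(1)[OF P]] and h = presentsD(4-7)[OF P]
  have "sum g A \<in> N" if "\<And>i. i \<in> A \<Longrightarrow> g i \<in> N" for A
    using that by (induction A rule: infinite_finite_induct) (auto intro: N(2,3))
  then have "sum g A \<in> N" using insert by auto
  then show ?case using insert h by (simp add: M.finsum_insert Pi_def)
qed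

text \<open>Existence and uniqueness of the decomposition are read off from representatives: since \<open>N\<close> and \<open>U\<close> are
  homogeneous, congruence modulo \<open>U\<close> can be tested on homogeneous parts.\<close>

lemma graded_module_presents:
  fixes M :: "(('v, 'k::field) mpoly, 'b, 'n) module_scheme"
  assumes P: "presents (polys V) N U M h" and hom: "homogeneous N" "homogeneous U"
    and gr: "\<And>d. gr d = h ` (poly_component V d \<inter> N)"
  shows "graded_module V M gr"
  unfolding graded_module_def
proof (intro conjI allI ballI)
  note N = P.ideal_inD[OF P.presentsD(1)[OF P]] and h = P.presentsD(4-7)[OF P]
    and U = P.ideal_inD[OF P.presentsD(2)[OF P]] and UN = P.presentsD(3)[OF P]
  note K = poly_component_closed
  show mod: "Module.module (poly_ring V) M" unfolding poly_ring_eq by (rule P.presents_module[OF P])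
  then interpret Module.module "poly_ring V" M .
  fix d
  show "subgroup (gr d) (add_monoid M)"
  proof (rule M.add.subgroupI)
    show "gr d \<subseteq> carrier M" using gr h by auto
    have "0 \<in> poly_component V d \<inter> N" using K(1) N(2) by blast
    then show "gr d \<noteq> {}" using gr by blast
    show "\<ominus>\<^bsub>M\<^esub> a \<in> gr d" if a: "a \<in> gr d" for a
    proof -
      obtain p where p: "p \<in> poly_component V d" "p \<in> N" "a = h p" using a gr by blast
      have "\<ominus>\<^bsub>M\<^esub> a = h (- p)" by (rule M.minus_equality) (use p h N(5) in auto)
      moreover have "- p \<in> poly_component V d \<inter> N" using p K(3) N(5) by blast
      ultimately show ?thesis unfolding gr by simp
    qed
    show "a \<oplus>\<^bsub>M\<^esub> b \<in> gr d" if ab: "a \<in> gr d" "b \<in> gr d" for a b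
    proof -
      obtain p q where "p \<in> poly_component V d \<inter> N" "a = h p" "q \<in> poly_component V d \<inter> N" "b = h q"
        using ab gr by blast
      then have "a \<oplus>\<^bsub>M\<^esub> b = h (p + q)" "p + q \<in> poly_component V d \<inter> N" using h(3) K(2) N(3) by auto
      then show ?thesis unfolding gr by simp
    qed
  qed
  show "a \<odot>\<^bsub>M\<^esub> x \<in> gr (d + e)" if a: "a \<in> poly_component V d" and x: "x \<in> gr e" for e a x
  proof -
    obtain p where p: "p \<in> poly_component V e" "p \<in> N" "x = h p" using x gr by blast
    have "a \<in> polys V" using a by (simp add: poly_component_eq)
    then have "a \<odot>\<^bsub>M\<^esub> x = h (a * p)" "a * p \<in> N" using h(4) p N(4) by auto
    then show ?thesis using poly_component_mult[OF a p(1)] unfolding gr by simp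
  qed
next
  note N = P.ideal_inD[OF P.presentsD(1)[OF P]] and h = P.presentsD(4-7)[OF P]
    and U = P.ideal_inD[OF P.presentsD(2)[OF P]] and UN = P.presentsD(3)[OF P]
  interpret Module.module "set_ring (polys V)" M by (rule P.presents_module[OF P])
  fix x assume "x \<in> carrier M"
  then obtain p where p: "p \<in> N" "x = h p" using h by auto
  define f where "f d = h (hom_part d p)" for d
  define D where "D = (\<lambda>m. int (mon_degree m)) ` Poly_Mapping.keys p"
  define E where "E = {d. f d \<noteq> \<zero>\<^bsub>M\<^esub>}"
  have part: "hom_part d p \<in> N" for d using hom(1) p by (auto simp: homogeneous_def)
  have part0: "hom_part d p \<in> U" if "d \<notin> E" for d
    using that P.presentsD(8)[OF P part] h(2) by (auto simp: E_def f_def)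
  have ED: "E \<subseteq> D"
  proof
    fix d assume d: "d \<in> E"
    show "d \<in> D"
    proof (rule ccontr)
      assume "d \<notin> D"
      then have "hom_part d p = 0" by (auto simp: hom_part_def D_def intro!: sum.neutral)
      then show False using d h(2) by (simp add: E_def f_def)
    qed
  qed
  have finD: "finite D" by (simp add: D_def)
  then have finE: "finite E" using ED finite_subset by blast
  have sumN: "sum g A \<in> N" if "\<And>i. i \<in> A \<Longrightarrow> g i \<in> N" for g and A :: "int set"
    using that by (induction A rule: infinite_finite_induct) (auto intro: N(2,3))
  have sumU: "sum g A \<in> U" if "\<And>i. i \<in> A \<Longrightarrow> g i \<in> U" for g and A :: "int set"
    using that by (induction A rule: infinite_finite_induct) (auto intro: U(2,3))
  have sE: "(\<Sum>d\<in>E. hom_part d p) \<in> N" by (rule sumN) (rule part)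
  have "p = (\<Sum>d\<in>D. hom_part d p)" by (rule sum_hom_parts[symmetric]) (auto simp: D_def)
  also have "\<dots> = (\<Sum>d\<in>D - E. hom_part d p) + (\<Sum>d\<in>E. hom_part d p)"
    by (rule sum.subset_diff[OF ED finD])
  finally have "p - (\<Sum>d\<in>E. hom_part d p) = (\<Sum>d\<in>D - E. hom_part d p)" by (simp add: algebra_simps)
  also have "\<dots> \<in> U" by (rule sumU) (simp add: part0)
  finally have "h p = h (\<Sum>d\<in>E. hom_part d p)"
    using P.presents_eq_iff[OF P p(1) sE] by (rule iffD2[rotated])
  also have "\<dots> = finsum M f E"
    using P.presents_finsum[OF P finE part] unfolding f_def[abs_def] by (rule sym)
  finally have ex: "x = finsum M f E" using p by simp
  show "\<exists>!f. (\<forall>d. f d \<in> gr d) \<and> finite {d. f d \<noteq> \<zero>\<^bsub>M\<^esub>} \<and> x = finsum M f {d. f d \<noteq> \<zero>\<^bsub>M\<^esub>}"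
  proof (rule ex1I[of _ f])
    have "f d \<in> gr d" for d
      using part hom_part_in_component[of p V d] N(7)[OF p(1)] gr by (auto simp: f_def)
    then show "(\<forall>d. f d \<in> gr d) \<and> finite {d. f d \<noteq> \<zero>\<^bsub>M\<^esub>} \<and> x = finsum M f {d. f d \<noteq> \<zero>\<^bsub>M\<^esub>}"
      using finE ex by (simp add: E_def)
  next
    fix f' assume f': "(\<forall>d. f' d \<in> gr d) \<and> finite {d. f' d \<noteq> \<zero>\<^bsub>M\<^esub>} \<and> x = finsum M f' {d. f' d \<noteq> \<zero>\<^bsub>M\<^esub>}"
    define E' where "E' = {d. f' d \<noteq> \<zero>\<^bsub>M\<^esub>}"
    have "\<forall>d. \<exists>q. q \<in> poly_component V d \<inter> N \<and> f' d = h q" using f' gr by blast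
    then obtain g where g: "\<And>d. g d \<in> poly_component V d" "\<And>d. g d \<in> N" "\<And>d. f' d = h (g d)" by (metis IntE)
    have finE': "finite E'" using f' by (simp add: E'_def)
    have sE': "(\<Sum>d\<in>E'. g d) \<in> N" by (rule sumN) (rule g(2))
    have "h p = finsum M (\<lambda>d. h (g d)) E'" using f' p g(3)[symmetric] by (simp add: E'_def)
    also have "\<dots> = h (\<Sum>d\<in>E'. g d)" by (rule P.presents_finsum[OF P finE' g(2)])
    finally have diff: "p - (\<Sum>d\<in>E'. g d) \<in> U"
      using P.presents_eq_iff[OF P p(1) sE'] by (rule iffD1[rotated])
    show "f' = f"
    proof
      fix e
      define q where "q = (if e \<in> E' then g e else 0)"
      have "hom_part e (p - (\<Sum>d\<in>E'. g d)) = hom_part e p - q"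
      proof -
        have "hom_part e (\<Sum>d\<in>E'. g d) = (\<Sum>d\<in>E'. if e = d then g d else 0)"
          unfolding hom_part_sum by (rule sum.cong[OF refl]) (rule hom_part_component[OF g(1)])
        also have "\<dots> = q" using finE' by (simp add: q_def)
        finally show ?thesis by (simp add: hom_part_diff)
      qed
      moreover have "hom_part e (p - (\<Sum>d\<in>E'. g d)) \<in> U" using hom(2) diff by (simp add: homogeneous_def)
      moreover have qN: "q \<in> N" using g(2) N(2) by (simp add: q_def)
      ultimately have "f e = h q" using P.presents_eq_iff[OF P part[of e] qN] by (simp add: f_def)
      also have "h q = f' e" using g(3)[of e] h(2) by (auto simp: q_def E'_def)
      finally show "f' e = f e" ..
    qed
  qed
qed


section \<open>Shellable complexes are sequentially Cohen-Macaulay\<close>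

lemma mem_take_sorted:
  assumes "sorted_wrt (<) (ds :: nat list)" "i < length ds" "x \<in> set ds"
  shows "x \<in> set (take (Suc i) ds) \<longleftrightarrow> x \<le> ds ! i"
proof -
  obtain j where j: "j < length ds" "x = ds ! j" using assms(3) by (auto simp: in_set_conv_nth)
  have mono: "a < b \<Longrightarrow> b < length ds \<Longrightarrow> ds ! a < ds ! b" for a b
    using assms(1) by (auto simp: sorted_wrt_iff_nth_less)
  have "x \<le> ds ! i \<longleftrightarrow> j \<le> i"
    using mono[of i j] mono[of j i] j assms(2) by (metis leD le_less_linear less_imp_le_nat order.refl nat_neq_iff)
  moreover have "j \<le> i \<longleftrightarrow> x \<in> set (take (Suc i) ds)"
  proof
    assume "j \<le> i"
    then show "x \<in> set (take (Suc i) ds)" using j assms(2) by (auto simp: in_set_conv_nth intro!: exI[of _ j])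
  next
    assume "x \<in> set (take (Suc i) ds)"
    then obtain k where "k \<le> i" "k < length ds" "x = ds ! k" by (auto simp: in_set_conv_nth less_Suc_eq_le)
    then show "j \<le> i" using j mono[of k j] mono[of j k] by (metis less_irrefl nat_neq_iff)
  qed
  ultimately show ?thesis by simp
qed

text \<open>The filtration is the dimension filtration: its member \<open>i\<close> consists of the polynomials that lie in the
  primes of all facets whose size is not among the \<open>i\<close> smallest sizes that occur. Restricting to sizes
  that occur makes all inclusions strict.\<close>

theorem shellable_sequentially_cohen_macaulay:
  fixes V :: "'v set" and \<F> :: "'v set set"
  defines "R \<equiv> poly_ring V :: ('v, 'k::field) mpoly ring" and "I \<equiv> sr_ideal V \<F> :: ('v, 'k) mpoly set"
  assumes \<F>: "finite \<F>" "\<And>F. F \<in> \<F> \<Longrightarrow> F \<subseteq> V \<and> finite F"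
    and sh: "\<And>d. \<exists>Fs. set Fs = {F \<in> \<F>. card F = d} \<and> shelling {F \<in> \<F>. d < card F} Fs"
    and reg: "\<And>d. d \<in> card ` \<F> \<Longrightarrow> \<exists>\<theta> :: ('v, 'k) mpoly list. length \<theta> = d \<and> set \<theta> \<subseteq> irrelevant_ideal V \<and>
      (\<forall>F\<in>\<F>. card F = d \<longrightarrow> weakly_regular (polys V) (sr_ideal V {F}) \<theta>)"
  shows "sequentially_cohen_macaulay V (quot_module (self_module R) I)
    (\<lambda>d. (\<lambda>p. I +>\<^bsub>R\<^esub> p) ` poly_component V d)"
proof -
  let ?C = "polys V :: ('v, 'k) mpoly set"
  define M where "M = quot_module (self_module R) I"
  define h where "h p = I +>\<^bsub>R\<^esub> p" for p
  define gr where "gr d = h ` poly_component V d" for d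
  have R: "R = set_ring ?C" by (simp add: R_def poly_ring_eq)
  have idI: "ideal_in ?C I" unfolding I_def by (rule sr_ideal_ideal)
  have P: "presents ?C ?C I M h"
  proof -
    have "presents ?C ?C I (quot_module (self_module R) (id ` I)) (\<lambda>x. id ` I +>\<^bsub>self_module R\<^esub> id x)"
      unfolding R using P.presents_quotient[OF P.presents_self idI _ P.ideal_inD(1)[OF idI]] P.ideal_inD(2)[OF idI]
      by simp
    moreover have "(\<lambda>x. id ` I +>\<^bsub>self_module R\<^esub> id x) = h"
      by (simp add: h_def[abs_def] a_r_coset_def' self_module_def)
    ultimately show ?thesis by (simp add: M_def)
  qed
  note hD = P.presentsD(4-7)[OF P]
  define ds where "ds = sorted_list_of_set (card ` \<F>)"
  have ds: "set ds = card ` \<F>" "sorted_wrt (<) ds" using \<F>(1) by (simp_all add: ds_def)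
  define r where "r = length ds"
  define \<G> where "\<G> i = {F \<in> \<F>. card F \<notin> set (take i ds)}" for i
  define N where "N i = (sr_ideal V (\<G> i) :: ('v, 'k) mpoly set)" for i
  have idN: "ideal_in ?C (N i)" "N i \<subseteq> ?C" for i unfolding N_def using sr_ideal_ideal sr_ideal_subset by blast+
  have IN: "I \<subseteq> N i" for i unfolding N_def I_def by (rule sr_ideal_antimono) (auto simp: \<G>_def)
  have N0: "N 0 = I" by (simp add: N_def I_def \<G>_def)
  have Nr: "N r = ?C"
  proof -
    have "\<G> r = {}" using ds(1) by (auto simp: \<G>_def r_def)
    then show ?thesis by (simp add: N_def)
  qed
  have PN: "presents ?C (N i) I (M\<lparr>carrier := h ` N i\<rparr>) h" for i
    by (rule P.presents_restrict[OF P idN(1) IN idN(2)])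
  define Q where "Q i = quot_module (M\<lparr>carrier := h ` N (Suc i)\<rparr>) (h ` N i)" for i
  have layer: "module_dim R (Q i) = ereal (real (ds ! i)) \<and> cohen_macaulay V (Q i) \<and> h ` N i \<subset> h ` N (Suc i)"
    if i: "i < r" for i
  proof -
    define d where "d = ds ! i"
    have \<G>S: "\<G> (Suc i) = {F \<in> \<F>. d < card F}"
      using mem_take_sorted[OF ds(2), of i] i ds(1) unfolding \<G>_def r_def d_def by fastforce
    have dmem: "d \<in> card ` \<F>" using i ds(1) nth_mem[of i ds] by (simp add: d_def r_def)
    obtain Fs where Fs: "set Fs = {F \<in> \<F>. card F = d}" "shelling (\<G> (Suc i)) Fs" using sh \<G>S by metis
    have take_Suc: "set (take (Suc i) ds) = insert d (set (take i ds))"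
      using i by (simp add: take_Suc_conv_app_nth r_def d_def)
    have "d \<notin> set (take i ds)"
    proof
      assume "d \<in> set (take i ds)"
      then obtain j where "j < i" "ds ! j = d" using i by (auto simp: in_set_conv_nth r_def)
      then show False using ds(2) i unfolding sorted_wrt_iff_nth_less d_def r_def by (metis less_irrefl)
    qed
    then have \<G>i: "\<G> i = \<G> (Suc i) \<union> set Fs"
      unfolding Fs(1) \<G>_def take_Suc by auto
    have FsD: "F \<subseteq> V \<and> finite F \<and> card F = d" if "F \<in> set Fs" for F using that Fs(1) \<F>(2) by auto
    have ne: "Fs \<noteq> []" using dmem Fs(1) by force
    have NN: "N i \<subseteq> N (Suc i)" unfolding N_def \<G>i by (rule sr_ideal_antimono) auto
    have "presents ?C (N (Suc i)) (N i) (Q i) (\<lambda>x. h ` N i +>\<^bsub>M\<lparr>carrier := h ` N (Suc i)\<rparr>\<^esub> h x)"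
      unfolding Q_def by (rule P.presents_quotient[OF PN idN(1) IN NN])
    then have PQ: "presents ?C (sr_ideal V (\<G> (Suc i))) (sr_ideal V (\<G> (Suc i) \<union> set Fs)) (Q i)
        (\<lambda>x. h ` N i +>\<^bsub>M\<lparr>carrier := h ` N (Suc i)\<rparr>\<^esub> h x)"
      by (simp add: N_def \<G>i)
    obtain \<theta> :: "('v, 'k) mpoly list" where \<theta>: "length \<theta> = d" "set \<theta> \<subseteq> irrelevant_ideal V"
      "\<forall>F\<in>\<F>. card F = d \<longrightarrow> weakly_regular (polys V) (sr_ideal V {F}) \<theta>"
      using reg[OF dmem] by blast
    have dep: "depth (poly_ring V) (irrelevant_ideal V) (Q i) = ereal (real d)"
      by (rule depth_layer[OF PQ Fs(2) ne FsD \<theta>(1,2)]) (use \<theta>(3) Fs(1) in auto)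
    have dim: "module_dim (poly_ring V) (Q i) = ereal (real d)"
      by (rule dim_layer[OF PQ Fs(2) ne FsD])
    obtain F Gs where FG: "Fs = F # Gs" using ne by (cases Fs) auto
    obtain m where m: "m \<in> N (Suc i)"
      "\<And>q. q \<in> ?C \<Longrightarrow> q * m \<in> sr_ideal V (insert F (\<G> (Suc i))) \<longleftrightarrow> q \<in> sr_ideal V {F}"
      "\<And>p. p \<in> N (Suc i) \<Longrightarrow> \<exists>q\<in>?C. p - q * m \<in> sr_ideal V (insert F (\<G> (Suc i)))"
      using shelling_step[of F V "\<G> (Suc i)", where ?'k = 'k] FsD[of F] Fs(2) FG unfolding N_def by auto
    have "N i \<subseteq> sr_ideal V (insert F (\<G> (Suc i)))"
      unfolding N_def \<G>i FG by (rule sr_ideal_antimono) auto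
    moreover have "m \<notin> sr_ideal V (insert F (\<G> (Suc i)))"
      using m(2)[of 1] sr_ideal_prime[of V F, where ?'k = 'k] by (auto simp: prime_in_def)
    ultimately have "m \<notin> N i" by auto
    then have "h m \<notin> h ` N i"
      using P.presents_image_mem_iff[OF P idN(1) IN idN(2), of m i] m(1) idN(2) by auto
    then have "h ` N i \<subset> h ` N (Suc i)" using NN m(1) by blast
    then show ?thesis using dep dim by (simp add: cohen_macaulay_def R_def d_def)
  qed
  have gr_int: "gr d \<inter> h ` N i = h ` (poly_component V d \<inter> N i)" for d i
  proof -
    have "poly_component V d \<subseteq> ?C" by (auto simp: poly_component_eq)
    then show ?thesis
      using P.presents_image_mem_iff[OF P idN(1) IN idN(2)] unfolding gr_def by blast
  qed
  have graded: "graded_module V M gr"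
    by (rule graded_module_presents[OF P])
      (use homogeneous_sr_ideal[of V "{}", where ?'b = 'k] homogeneous_sr_ideal[of V \<F>, where ?'b = 'k] in
        \<open>auto simp: I_def gr_def poly_component_eq intro!: image_cong\<close>)
  have sub: "graded_submodule V M gr (h ` N i)" for i
    unfolding graded_submodule_def
  proof
    show "submodule (h ` N i) (poly_ring V) M"
      unfolding poly_ring_eq by (rule P.presents_submodule[OF P idN])
    show "graded_module V (M\<lparr>carrier := h ` N i\<rparr>) (\<lambda>d. gr d \<inter> h ` N i)"
    proof (rule graded_module_presents[OF PN])
      show "homogeneous (N i)" "homogeneous I" unfolding N_def I_def by (rule homogeneous_sr_ideal)+
    qed (rule gr_int)
  qed
  have fg: "finitely_generated R M"
    unfolding finitely_generated_def
  proof (intro exI conjI)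
    show "{h 1} \<subseteq> carrier M" using hD by auto
    have "carrier M \<subseteq> K" if K: "submodule K R M" "{h 1} \<subseteq> K" for K
    proof -
      interpret K: submodule K R M by (rule K)
      have "h c \<in> K" if "c \<in> ?C" for c
        using K.smult_closed[of c "h 1"] hD(4)[of c 1] that K(2) by (simp add: R)
      then show ?thesis using hD by auto
    qed
    moreover have "submodule (carrier M) R M"
      using P.presents_submodule[OF P P.ideal_in_C] hD(1) by (simp add: R)
    ultimately show "module_span R M {h 1} = carrier M"
      using hD(1) unfolding module_span_def by auto
  qed simp
  have zero: "h ` N 0 = {\<zero>\<^bsub>M\<^esub>}"
  proof -
    have "h x = \<zero>\<^bsub>M\<^esub>" if "x \<in> I" for x
      using P.presentsD(8)[OF P, of x] that P.ideal_inD(1)[OF idI] hD(2) by auto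
    moreover have "0 \<in> I" by (rule P.ideal_inD(2)[OF idI])
    ultimately show ?thesis unfolding N0 by (auto intro!: image_eqI[of _ _ 0])
  qed
  have top: "h ` N r = carrier M" using Nr hD(1) by simp
  have mono: "module_dim R (Q i) < module_dim R (Q (Suc i))" if "Suc i < r" for i
    using layer[of i] layer[of "Suc i"] that ds(2) by (simp add: sorted_wrt_iff_nth_less r_def)
  have "sequentially_cohen_macaulay V M gr"
    unfolding sequentially_cohen_macaulay_def Let_def
  proof (intro conjI exI[of _ r] exI[of _ "\<lambda>i. h ` N i"] allI impI)
    show "graded_module V M gr" "finitely_generated (poly_ring V) M"
      using graded fg by (simp_all add: R_def)
    show "h ` N 0 = {\<zero>\<^bsub>M\<^esub>}" "h ` N r = carrier M" by (rule zero, rule top)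
    show "graded_submodule V M gr (h ` N i)" for i by (rule sub)
    show "h ` N i \<subset> h ` N (Suc i)"
      "cohen_macaulay V (quot_module (M\<lparr>carrier := h ` N (Suc i)\<rparr>) (h ` N i))" if "i < r" for i
      using layer[OF that] by (simp_all add: Q_def)
    show "module_dim (poly_ring V) (quot_module (M\<lparr>carrier := h ` N (Suc i)\<rparr>) (h ` N i))
      < module_dim (poly_ring V) (quot_module (M\<lparr>carrier := h ` N (Suc (Suc i))\<rparr>) (h ` N (Suc i)))"
      if "Suc i < r" for i
      using mono[OF that] by (simp add: Q_def R_def)
  qed
  then show ?thesis by (simp add: M_def gr_def[abs_def] h_def[abs_def])
qed


section \<open>Edge ideals and maximal independent sets\<close>

definition independent_set :: "'v ugraph \<Rightarrow> 'v set \<Rightarrow> bool" where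
  "independent_set G X \<longleftrightarrow> X \<subseteq> vertices G \<and> (\<forall>e\<in>edges G. \<not> e \<subseteq> X)"

definition facets :: "'v ugraph \<Rightarrow> 'v set set" where
  "facets G = {F. independent_set G F \<and> (\<forall>X. independent_set G X \<longrightarrow> F \<subseteq> X \<longrightarrow> X = F)}"

lemma facetsD:
  assumes "F \<in> facets G"
  shows "independent_set G F" "F \<subseteq> vertices G" "independent_set G X \<Longrightarrow> F \<subseteq> X \<Longrightarrow> X = F"
  using assms by (auto simp: facets_def independent_set_def)

lemma extend_to_facet:
  assumes "finite (vertices G)" "independent_set G X"
  obtains F where "F \<in> facets G" "X \<subseteq> F"
proof -
  have fin: "finite {Y. independent_set G Y}"
    by (rule finite_subset[of _ "Pow (vertices G)"]) (use assms(1) in \<open>auto simp: independent_set_def\<close>)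
  obtain F where F: "independent_set G F" "X \<subseteq> F" "\<forall>Y. independent_set G Y \<longrightarrow> F \<subseteq> Y \<longrightarrow> F = Y"
    using finite_has_maximal2[OF fin, of X] assms(2) by auto
  then show thesis using that[of F] by (auto simp: facets_def)
qed

lemma finite_facets: "finite (vertices G) \<Longrightarrow> finite (facets G)"
  by (rule finite_subset[of _ "Pow (vertices G)"]) (auto dest: facetsD)

text \<open>A monomial lies outside the edge ideal if and only if its support is independent, that is, contained in
  a facet.\<close>

lemma edge_ideal_eq:
  assumes G: "simple_graph G"
  shows "edge_ideal G = (sr_ideal (vertices G) (facets G) :: ('v, 'k::field) mpoly set)"
proof
  define V where "V = vertices G"
  have fin: "finite V" and edge: "\<And>e. e \<in> edges G \<Longrightarrow> e \<subseteq> V \<and> card e = 2"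
    using G by (auto simp: simple_graph_def V_def)
  define X where "X = {poly_var u * poly_var v :: ('v, 'k) mpoly | u v. {u, v} \<in> edges G}"
  interpret R: cring "set_ring (polys V :: ('v, 'k) mpoly set)" by (rule P.cring_set_ring)
  have X: "X \<subseteq> polys V"
    using edge by (fastforce simp: X_def intro!: P.mult_C poly_var_polys)
  have EI: "edge_ideal G = Idl\<^bsub>set_ring (polys V)\<^esub> X"
    by (simp add: edge_ideal_def X_def poly_ring_eq V_def)
  have prod: "poly_var u * poly_var v = (Poly_Mapping.single (Poly_Mapping.single u 1 + Poly_Mapping.single v 1) 1 :: ('v, 'k) mpoly)"
    for u v :: 'v by (simp add: poly_var_def mult_single)
  show "edge_ideal G \<subseteq> (sr_ideal (vertices G) (facets G) :: ('v, 'k) mpoly set)"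
    unfolding EI V_def[symmetric]
  proof (rule R.genideal_minimal)
    show "ideal (sr_ideal V (facets G)) (set_ring (polys V :: ('v, 'k) mpoly set))"
      unfolding P.ideal_iff by (rule sr_ideal_ideal)
    show "X \<subseteq> sr_ideal V (facets G)"
    proof
      fix p assume p: "p \<in> X"
      then obtain u v where uv: "p = poly_var u * poly_var v" "{u, v} \<in> edges G" by (auto simp: X_def)
      have "\<not> {u, v} \<subseteq> F" if "F \<in> facets G" for F
        using facetsD(1)[OF that] uv(2) unfolding independent_set_def by blast
      then show "p \<in> sr_ideal V (facets G)"
        using X p unfolding sr_ideal_def uv(1) prod by (auto simp: keys_exponent_add)
    qed
  qed
  have I: "ideal_in (polys V) (edge_ideal G :: ('v, 'k) mpoly set)"
    unfolding EI P.ideal_iff[symmetric] by (rule R.genideal_ideal) (use X in simp)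
  show "sr_ideal (vertices G) (facets G) \<subseteq> (edge_ideal G :: ('v, 'k) mpoly set)"
  proof
    fix p :: "('v, 'k) mpoly" assume p: "p \<in> sr_ideal (vertices G) (facets G)"
    have "Poly_Mapping.single m (Poly_Mapping.lookup p m) \<in> edge_ideal G" if m: "m \<in> Poly_Mapping.keys p" for m
    proof -
      have mV: "Poly_Mapping.keys m \<subseteq> V" using p m by (auto simp: sr_ideal_def polys_def V_def)
      have "\<not> independent_set G (Poly_Mapping.keys m)"
      proof
        assume "independent_set G (Poly_Mapping.keys m)"
        then obtain F where "F \<in> facets G" "Poly_Mapping.keys m \<subseteq> F"
          using extend_to_facet fin unfolding V_def by blast
        then show False using p m by (auto simp: sr_ideal_def)
      qed
      then obtain e where e: "e \<in> edges G" "e \<subseteq> Poly_Mapping.keys m"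
        using mV by (auto simp: independent_set_def V_def)
      obtain u v where uv: "e = {u, v}" "u \<noteq> v" using edge[OF e(1)] by (auto simp: card_2_iff)
      define n where "n = m - (Poly_Mapping.single u 1 + Poly_Mapping.single v 1)"
      have mn: "m = n + (Poly_Mapping.single u 1 + Poly_Mapping.single v 1)"
        by (rule poly_mapping_eqI)
          (use e uv in \<open>auto simp: n_def lookup_add lookup_minus lookup_single when_def in_keys_iff\<close>)
      have "Poly_Mapping.keys n \<subseteq> V" using mV by (auto simp: n_def in_keys_iff lookup_minus)
      then have "Poly_Mapping.single n (Poly_Mapping.lookup p m) \<in> polys V" by simp
      moreover have "poly_var u * poly_var v \<in> (edge_ideal G :: ('v, 'k) mpoly set)"
        using R.genideal_self[of X] X e(1) uv(1) unfolding EI by (auto simp: X_def)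
      ultimately have "Poly_Mapping.single n (Poly_Mapping.lookup p m) * (poly_var u * poly_var v) \<in> edge_ideal G"
        by (rule P.ideal_inD(4)[OF I])
      moreover have "Poly_Mapping.single n (Poly_Mapping.lookup p m) * (poly_var u * poly_var v) =
          Poly_Mapping.single m (Poly_Mapping.lookup p m)"
        unfolding prod using mn by (simp add: mult_single)
      ultimately show ?thesis by simp
    qed
    then have "(\<Sum>m\<in>A. Poly_Mapping.single m (Poly_Mapping.lookup p m)) \<in> edge_ideal G"
      if "A \<subseteq> Poly_Mapping.keys p" for A
      using that by (induction A rule: infinite_finite_induct) (auto intro: P.ideal_inD(2,3)[OF I])
    from this[OF order_refl] show "p \<in> edge_ideal G" by (simp add: sum_monomials)
  qed
qed


section \<open>Linear regular sequences modulo a face\<close>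

text \<open>Modulo the prime of \<open>W\<close>, the element \<open>t\<close> is a variable, and adding it produces the prime of \<open>W - {w}\<close>.\<close>

lemma weakly_regular_variable_step:
  fixes t :: "('v, 'k::field) mpoly"
  assumes w: "w \<in> W" "W \<subseteq> V" and t: "t - poly_var w \<in> sr_ideal V {W}"
    and as: "weakly_regular (polys V) (sr_ideal V {W - {w}}) as"
  shows "weakly_regular (polys V) (sr_ideal V {W}) (t # as)"
proof -
  have wV: "w \<in> V" using w by auto
  note I = P.ideal_inD[OF sr_ideal_ideal[of V "{W}"]]
  have "t - poly_var w + poly_var w \<in> polys V"
    using t sr_ideal_subset poly_var_polys[OF wV] by (blast intro: P.add_C)
  then have tV: "t \<in> polys V" by simp
  have "t \<notin> sr_ideal V {W}"
  proof
    assume "t \<in> sr_ideal V {W}"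
    then have "t - (t - poly_var w) \<in> sr_ideal V {W}" using t by (rule I(6))
    then show False using w wV poly_var_mem_sr_ideal_iff[of w V W, where ?'k = 'k] by simp
  qed
  then have "reg_mod (polys V) (sr_ideal V {W}) t" by (rule P.reg_mod_prime[OF sr_ideal_prime tV])
  then show ?thesis using as add_multiples_sr_ideal[OF w t] by simp
qed

lemma weakly_regular_variables:
  "distinct vs \<Longrightarrow> set vs \<subseteq> V \<Longrightarrow>
    weakly_regular (polys V) (sr_ideal V {set vs}) (map poly_var vs :: ('v, 'k::field) mpoly list)"
proof (induction vs)
  case (Cons v vs)
  have "weakly_regular (polys V) (sr_ideal V {set (v # vs)}) (poly_var v # map poly_var vs :: ('v, 'k) mpoly list)"
    by (rule weakly_regular_variable_step[of v])
      (use Cons P.ideal_inD(2)[OF sr_ideal_ideal] in auto)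
  then show ?case by simp
qed simp

lemma poly_var_mem_sr_ideal: "v \<in> V \<Longrightarrow> v \<notin> W \<Longrightarrow> (poly_var v :: ('v, 'k::field) mpoly) \<in> sr_ideal V {W}"
  by (simp add: poly_var_mem_sr_ideal_iff)

text \<open>Any two of the vectors \<open>(1, 0)\<close>, \<open>(0, 1)\<close>, \<open>(1, 1)\<close> are linearly independent over every field. Therefore the two
  forms span the linear forms in the variables of \<open>W\<close>, whichever of \<open>a\<close>, \<open>b\<close>, \<open>c\<close> is set to zero.\<close>

lemma weakly_regular_pair:
  fixes a b c :: 'v and V :: "'v set"
  defines "x \<equiv> poly_var :: 'v \<Rightarrow> ('v, 'k::field) mpoly"
  assumes abc: "a \<noteq> b" "a \<noteq> c" "b \<noteq> c" "{a, b, c} \<subseteq> V" and W: "W \<subseteq> {a, b, c}" "card W = 2"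
  shows "weakly_regular (polys V) (sr_ideal V {W}) [x a + x c, x b + x c]"
proof -
  have "card ({a, b, c} - W) = 1"
    using card_Diff_subset[of W "{a, b, c}"] W abc finite_subset[OF W(1)] by simp
  then obtain z where "{a, b, c} - W = {z}" by (auto simp: card_1_singleton_iff)
  then have "z \<in> {a, b, c}" "W = {a, b, c} - {z}" using W(1) by auto
  then have "W = {a, b} \<or> W = {b, c} \<or> W = {a, c}" using abc by auto
  note var_mem = poly_var_mem_sr_ideal[of _ V, where ?'k = 'k, folded x_def]
  have two: "weakly_regular (polys V) (sr_ideal V {{u, v}}) [s, t]"
    if "s - x u \<in> sr_ideal V {{u, v}}" "t - x v \<in> sr_ideal V {{v}}" "u \<noteq> v" "u \<in> V" "v \<in> V" for u v s t
  proof -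
    have "weakly_regular (polys V) (sr_ideal V {{v}}) [t]"
      by (rule weakly_regular_variable_step[of v]) (use that in \<open>simp_all add: x_def\<close>)
    moreover have "{u, v} - {u} = {v}" using that by auto
    ultimately have "weakly_regular (polys V) (sr_ideal V {{u, v} - {u}}) [t]" by simp
    then show ?thesis
      using that by (intro weakly_regular_variable_step[of u "{u, v}" V s "[t]"]) (auto simp: x_def)
  qed
  show ?thesis
    using \<open>W = {a, b} \<or> W = {b, c} \<or> W = {a, c}\<close>
  proof (elim disjE)
    assume W: "W = {a, b}"
    show ?thesis unfolding W by (rule two) (use abc var_mem[of c] in simp_all)
  next
    assume W: "W = {b, c}"
    have "weakly_regular (polys V) (sr_ideal V {{c, b}}) [x a + x c, x b + x c]"
      by (rule two) (use abc var_mem[of c] var_mem[of a] in simp_all)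
    then show ?thesis by (simp only: W insert_commute)
  next
    assume W: "W = {a, c}"
    \<comment> \<open>Modulo b the sequence is a + c, c. Its first member is not congruent to a variable, but in the
      reversed order c, a + c every member is.\<close>
    let ?I = "sr_ideal V {W} :: ('v, 'k) mpoly set"
    have xV: "x a \<in> polys V" "x b \<in> polys V" "x c \<in> polys V" using abc by (auto simp: x_def poly_var_polys)
    have notin: "s + x v \<notin> sr_ideal V {Z}" if "s \<in> sr_ideal V {Z}" "v \<in> Z" "v \<in> V" for s v Z
    proof
      assume "s + x v \<in> sr_ideal V {Z}"
      then have "s + x v - s \<in> sr_ideal V {Z}" using that(1) by (rule P.ideal_inD(6)[OF sr_ideal_ideal])
      then show False using that by (simp add: x_def poly_var_mem_sr_ideal_iff)
    qed
    have xb: "x b \<in> ?I" using abc W by (intro var_mem) auto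
    have xc: "x c \<in> sr_ideal V {{a}}" using abc by (intro var_mem) auto
    have ca: "add_multiples ?I (x b + x c) (polys V) = sr_ideal V {{a}}"
    proof -
      have "W - {c} = {a}" using W abc by auto
      then show ?thesis using add_multiples_sr_ideal[of c W V "x b + x c"] xb abc W by (simp add: x_def)
    qed
    have "\<not> x a + x c \<in> ?I"
    proof
      assume "x a + x c \<in> ?I"
      moreover have "?I \<subseteq> sr_ideal V {{a}}" unfolding W by (auto simp: sr_ideal_def)
      ultimately show False using notin[OF xc, of a] abc by (auto simp: add.commute)
    qed
    then have "reg_mod (polys V) ?I (x a + x c)"
      using xV by (intro P.reg_mod_prime sr_ideal_prime P.add_C)
    moreover have "reg_mod (polys V) (add_multiples ?I (x a + x c) (polys V)) (x b + x c)"
    proof (rule P.reg_mod_swap)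
      show "reg_mod (polys V) ?I (x b + x c)"
        using xV notin[OF xb, of c] W abc by (intro P.reg_mod_prime sr_ideal_prime P.add_C) auto
      show "reg_mod (polys V) (add_multiples ?I (x b + x c) (polys V)) (x a + x c)"
        unfolding ca using xV notin[OF xc, of a] abc
        by (intro P.reg_mod_prime sr_ideal_prime P.add_C) (auto simp: add.commute)
    qed (use xV sr_ideal_ideal in \<open>auto intro: P.add_C\<close>)
    ultimately show ?thesis by simp
  qed
qed

text \<open>Extreme cases are the sum of all variables for \<open>n = 1\<close> and the variables themselves for \<open>n = |T|\<close>. The
  bound on \<open>T\<close> leaves only \<open>n = 2\<close> with \<open>|T| = 3\<close>.\<close>

lemma weakly_regular_small:
  assumes T: "finite T" "card T \<le> 3" "T \<subseteq> V" and n: "n \<le> card T"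
  obtains \<tau> :: "('v, 'k::field) mpoly list" where "length \<tau> = n" "set \<tau> \<subseteq> irrelevant_ideal V"
    "\<And>W. W \<subseteq> T \<Longrightarrow> card W = n \<Longrightarrow> weakly_regular (polys V) (sr_ideal V {W}) \<tau>"
proof -
  consider "n = 0" | "n = 1" | "n = card T" | "n = 2" "card T = 3" using T n by linarith
  then show thesis
  proof cases
    case 1
    then show thesis using that[of "[]"] by simp
  next
    case 2
    define t where "t = (\<Sum>v\<in>T. poly_var v :: ('v, 'k) mpoly)"
    have "T \<noteq> {}" using 2 n by auto
    have "(\<Sum>v\<in>A. poly_var v :: ('v, 'k) mpoly) \<in> irrelevant_ideal V"
      if "finite A" "A \<noteq> {}" "A \<subseteq> V" for A
      using that by (induction A rule: finite_ne_induct) (auto intro: irrelevant_ideal_add poly_var_irrelevant)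
    then have tI: "t \<in> irrelevant_ideal V"
      unfolding t_def using T(1,3) \<open>T \<noteq> {}\<close> by blast
    have "weakly_regular (polys V) (sr_ideal V {W}) [t]" if W: "W \<subseteq> T" "card W = n" for W
    proof -
      obtain w where w: "W = {w}" using W 2 by (auto simp: card_1_singleton_iff)
      have "t - poly_var w = (\<Sum>v\<in>T - {w}. poly_var v)"
        using T(1) w W unfolding t_def by (simp add: sum_diff1)
      also have "\<dots> \<in> sr_ideal V {W}"
      proof -
        have "(\<Sum>v\<in>A. poly_var v) \<in> (sr_ideal V {W} :: ('v, 'k) mpoly set)" if "A \<subseteq> T - {w}" for A
          using that by (induction A rule: infinite_finite_induct)
            (use w T(3) in \<open>auto intro!: P.ideal_inD(2,3)[OF sr_ideal_ideal] poly_var_mem_sr_ideal\<close>)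
        then show ?thesis by blast
      qed
      finally show ?thesis
        by (intro weakly_regular_variable_step[of w]) (use w W T in auto)
    qed
    then show thesis using that[of "[t]"] tI 2 by simp
  next
    case 3
    obtain vs where vs: "set vs = T" "distinct vs" using finite_distinct_list[OF T(1)] by auto
    show thesis
    proof (rule that[of "map poly_var vs"])
      show "length (map poly_var vs) = n" using 3 vs distinct_card[of vs] by simp
      show "set (map poly_var vs) \<subseteq> (irrelevant_ideal V :: ('v, 'k) mpoly set)"
        using vs T(3) by (auto intro: poly_var_irrelevant)
      fix W assume "W \<subseteq> T" "card W = n"
      then have "W = T" using card_subset_eq[OF T(1)] 3 by simp
      then show "weakly_regular (polys V) (sr_ideal V {W}) (map poly_var vs :: ('v, 'k) mpoly list)"
        using weakly_regular_variables[OF vs(2)] vs(1) T(3) by simp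
    qed
  next
    case 4
    obtain a b c where abc: "T = {a, b, c}" "a \<noteq> b" "a \<noteq> c" "b \<noteq> c" using 4(2) by (auto simp: card_3_iff)
    show thesis
    proof (rule that[of "[poly_var a + poly_var c, poly_var b + poly_var c]"])
      show "set [poly_var a + poly_var c, poly_var b + poly_var c] \<subseteq> (irrelevant_ideal V :: ('v, 'k) mpoly set)"
        using abc T(3) by (auto intro!: irrelevant_ideal_add poly_var_irrelevant)
      fix W assume "W \<subseteq> T" "card W = n"
      then show "weakly_regular (polys V) (sr_ideal V {W}) [poly_var a + poly_var c, poly_var b + poly_var c :: ('v, 'k) mpoly]"
        using weakly_regular_pair[of a b c V W] abc T(3) 4(1) by simp
    qed (use 4 in simp)
  qed
qed


section \<open>Facets of a whiskered graph\<close>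

lemma independent_set_whisker_iff:
  "independent_set (whisker G S) X \<longleftrightarrow> X \<subseteq> Inl ` vertices G \<union> Inr ` S \<and>
     (\<forall>e\<in>edges G. \<not> Inl ` e \<subseteq> X) \<and> (\<forall>y\<in>S. \<not> (Inl y \<in> X \<and> Inr y \<in> X))"
proof -
  have "(\<forall>e\<in>{{Inl y, Inr y} | y. y \<in> S}. \<not> e \<subseteq> X) \<longleftrightarrow> (\<forall>y\<in>S. \<not> (Inl y \<in> X \<and> Inr y \<in> X))"
    unfolding Setcompr_eq_image by simp
  then show ?thesis by (simp add: independent_set_def whisker_def ball_Un)
qed

locale whiskered =
  fixes G :: "'v ugraph" and S :: "'v set"
  assumes G: "simple_graph G" and SV: "S \<subseteq> vertices G" and card_rest: "card (vertices G - S) \<le> 3"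
begin

abbreviation H :: "('v + 'v) ugraph" where "H \<equiv> whisker G S"
abbreviation T :: "'v set" where "T \<equiv> vertices G - S"

text \<open>The two traces of a facet: \<open>rest\<close> on the vertices without whisker and \<open>core\<close> on \<open>S\<close>.\<close>

definition rest :: "('v + 'v) set \<Rightarrow> 'v set" where "rest F = {v \<in> T. Inl v \<in> F}"
definition core :: "('v + 'v) set \<Rightarrow> 'v set" where "core F = {y \<in> S. Inl y \<in> F}"

lemma finG: "finite (vertices G)" and finS: "finite S" and finT: "finite T" and finH: "finite (vertices H)"
  using G SV finite_subset by (auto simp: simple_graph_def whisker_def)

lemma simple_H: "simple_graph H"
  by (rule simple_graph_whisker[OF G SV])

lemma facet_whisker:
  assumes F: "F \<in> facets H" and y: "y \<in> S"
  shows "Inr y \<in> F \<longleftrightarrow> Inl y \<notin> F"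
proof -
  have ind: "independent_set H F" using facetsD(1)[OF F] .
  have "Inr y \<in> F" if "Inl y \<notin> F"
  proof -
    have "independent_set H (insert (Inr y) F)"
      using ind that y unfolding independent_set_whisker_iff by blast
    then show ?thesis using facetsD(3)[OF F, of "insert (Inr y) F"] by auto
  qed
  then show ?thesis using ind y unfolding independent_set_whisker_iff by blast
qed

lemma facet_eq:
  assumes F: "F \<in> facets H"
  shows "F = Inl ` rest F \<union> Inl ` core F \<union> Inr ` (S - core F)"
proof -
  have sub: "F \<subseteq> Inl ` vertices G \<union> Inr ` S"
    using facetsD(1)[OF F] unfolding independent_set_whisker_iff by blast
  show ?thesis
  proof (intro equalityI subsetI)
    fix z assume z: "z \<in> F"
    then consider v where "z = Inl v" "v \<in> vertices G" | y where "z = Inr y" "y \<in> S" using sub by blast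
    then show "z \<in> Inl ` rest F \<union> Inl ` core F \<union> Inr ` (S - core F)"
      using z facet_whisker[OF F] by cases (auto simp: rest_def core_def)
  next
    fix z assume "z \<in> Inl ` rest F \<union> Inl ` core F \<union> Inr ` (S - core F)"
    then show "z \<in> F" using facet_whisker[OF F] by (auto simp: rest_def core_def)
  qed
qed

lemma facet_mem_iff:
  assumes "F \<in> facets H"
  shows "Inl v \<in> F \<longleftrightarrow> v \<in> rest F \<or> v \<in> core F" "Inr y \<in> F \<longleftrightarrow> y \<in> S \<and> y \<notin> core F"
proof -
  have *: "z \<in> F \<longleftrightarrow> z \<in> Inl ` rest F \<union> Inl ` core F \<union> Inr ` (S - core F)" for z
    by (rule arg_cong[OF facet_eq[OF assms]])
  show "Inl v \<in> F \<longleftrightarrow> v \<in> rest F \<or> v \<in> core F" "Inr y \<in> F \<longleftrightarrow> y \<in> S \<and> y \<notin> core F"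
    unfolding *[of "Inl v"] *[of "Inr y"] by auto
qed

lemma rest_core_finite: "finite (rest F)" "finite (core F)" "core F \<subseteq> S" "rest F \<subseteq> T"
  using finT finS by (auto simp: rest_def core_def)

lemma card_facet:
  assumes F: "F \<in> facets H"
  shows "card F = card (rest F) + card S"
proof -
  have disj: "rest F \<inter> core F = {}" by (auto simp: rest_def core_def)
  have "F = Inl ` (rest F \<union> core F) \<union> Inr ` (S - core F)" using facet_eq[OF F] by (simp add: image_Un)
  then have "card F = card (Inl ` (rest F \<union> core F) \<union> Inr ` (S - core F) :: ('v + 'v) set)" by simp
  also have "\<dots> = card (rest F \<union> core F) + card (S - core F)"
    using rest_core_finite finS by (subst card_Un_disjoint) (auto simp: card_image)
  also have "\<dots> = card (rest F) + (card (core F) + card (S - core F))"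
    using rest_core_finite disj by (simp add: card_Un_disjoint)
  also have "card (core F) + card (S - core F) = card S"
    using rest_core_finite[of F] card_Diff_subset[of "core F" S] card_mono[OF finS, of "core F"] by simp
  finally show ?thesis .
qed

text \<open>The hypothesis \<open>before\<close> says that \<open>F'\<close> comes before \<open>F\<close> in the order by decreasing \<open>card\<close> and
  increasing \<open>card (core _)\<close>, with ties in any order. If some \<open>y \<in> core F\<close> is missing from \<open>F'\<close>, it is
  replaced by the end of its whisker; the resulting independent set extends to a facet that is larger
  than \<open>F\<close> or has a smaller core. Otherwise \<open>rest F' \<union> core F\<close>, being independent as a subset of
  \<open>rest F' \<union> core F'\<close>, extends to a facet \<open>F''\<close> with the same core as \<open>F\<close>. By maximality
  \<open>rest F\<close> is not contained in \<open>rest F''\<close>, which is at least as large; as both are subsets of a set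
  with at most three elements, \<open>rest F - rest F''\<close> is a singleton.\<close>

lemma facet_exchange:
  assumes F: "F \<in> facets H" and F': "F' \<in> facets H" and ne: "F' \<noteq> F"
    and before: "card F < card F' \<or> card F' = card F \<and> card (core F') \<le> card (core F)"
  shows "\<exists>v\<in>F - F'. \<exists>F''\<in>facets H. F - F'' = {v} \<and>
     (card F < card F'' \<or> card F'' = card F \<and> (card (core F'') < card (core F) \<or> F'' = F'))"
proof (cases "core F \<subseteq> core F'")
  case False
  then obtain y where y: "y \<in> S" "Inl y \<in> F" "Inl y \<notin> F'" by (auto simp: core_def)
  define D where "D = insert (Inr y) (F - {Inl y})"
  have finF: "finite F" using facetsD(2)[OF F] finH finite_subset by blast
  have nr: "Inr y \<notin> F" using facet_whisker[OF F y(1)] y(2) by simp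
  have "independent_set H D"
    using facetsD(1)[OF F] y(1) unfolding independent_set_whisker_iff D_def by blast
  then obtain F'' where F'': "F'' \<in> facets H" "D \<subseteq> F''" using extend_to_facet[OF finH] by blast
  have nl: "Inl y \<notin> F''" using facet_whisker[OF F''(1) y(1)] F''(2) by (auto simp: D_def)
  then have diff: "F - F'' = {Inl y}" using F''(2) y(2) by (auto simp: D_def)
  have finF'': "finite F''" using facetsD(2)[OF F''(1)] finH finite_subset by blast
  have cardD: "card D = card F"
    unfolding D_def using finF nr card_Suc_Diff1[OF finF y(2)] by simp
  then have le: "card F \<le> card F''" using card_mono[OF finF'' F''(2)] by simp
  have "card (core F'') < card (core F)" if eq: "card F'' = card F"
  proof -
    have "D = F''" using card_subset_eq[OF finF'' F''(2)] eq cardD by simp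
    then have "core F'' = core F - {y}" by (auto simp: core_def D_def)
    moreover have "y \<in> core F" using y by (simp add: core_def)
    ultimately show ?thesis using card_Diff1_less[OF rest_core_finite(2)[of F], of y] by simp
  qed
  then have "card F < card F'' \<or> card F'' = card F \<and> (card (core F'') < card (core F) \<or> F'' = F')"
    using le by linarith
  moreover have "Inl y \<in> F - F'" using y by simp
  ultimately show ?thesis using diff F''(1) by blast
next
  case True
  define D where "D = Inl ` rest F' \<union> Inl ` core F \<union> Inr ` (S - core F)"
  have lD: "Inl v \<in> F'" if "Inl v \<in> D" for v
    using that True by (auto simp: D_def rest_def core_def)
  have "independent_set H D"
    unfolding independent_set_whisker_iff
  proof (intro conjI ballI)
    show "D \<subseteq> Inl ` vertices G \<union> Inr ` S"
      using rest_core_finite(4)[of F'] rest_core_finite(3)[of F] SV by (auto simp: D_def)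
    show "\<not> Inl ` e \<subseteq> D" if "e \<in> edges G" for e
    proof
      assume "Inl ` e \<subseteq> D"
      then have "Inl ` e \<subseteq> F'" using lD by blast
      then show False using facetsD(1)[OF F'] that unfolding independent_set_whisker_iff by blast
    qed
    show "\<not> (Inl y \<in> D \<and> Inr y \<in> D)" if "y \<in> S" for y
      using that by (auto simp: D_def rest_def)
  qed
  then obtain F'' where F'': "F'' \<in> facets H" "D \<subseteq> F''" using extend_to_facet[OF finH] by blast
  have core'': "core F'' = core F"
  proof
    show "core F \<subseteq> core F''" using F''(2) by (auto simp: core_def D_def)
    show "core F'' \<subseteq> core F"
    proof
      fix y assume y: "y \<in> core F''"
      then have "y \<in> S" "Inr y \<notin> F''" using facet_whisker[OF F''(1)] by (auto simp: core_def)
      then show "y \<in> core F" using F''(2) by (auto simp: D_def)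
    qed
  qed
  have rest'': "rest F' \<subseteq> rest F''" using F''(2) by (auto simp: rest_def D_def)
  have cle: "card (rest F') \<le> card (rest F'')" by (rule card_mono[OF rest_core_finite(1) rest''])
  have better: "card F < card F'' \<or> card F'' = card F \<and> F'' = F'"
    using before
  proof
    assume "card F < card F'"
    then show ?thesis using cle card_facet[OF F] card_facet[OF F'] card_facet[OF F''(1)] by simp
  next
    assume *: "card F' = card F \<and> card (core F') \<le> card (core F)"
    then have "core F = core F'" using True card_seteq[OF rest_core_finite(2)] by blast
    then have "D = F'" using facet_eq[OF F'] by (simp add: D_def)
    then have "F'' = F'" using facetsD(3)[OF F' facetsD(1)[OF F''(1)]] F''(2) by simp
    then show ?thesis using * by simp
  qed
  then have ne'': "F'' \<noteq> F" using ne by auto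
  have ge: "card (rest F) \<le> card (rest F'')"
    using better card_facet[OF F] card_facet[OF F''(1)] by auto
  have "\<not> rest F \<subseteq> rest F''"
  proof
    assume "rest F \<subseteq> rest F''"
    then have "z \<in> F''" if "z \<in> F" for z
      using that by (cases z) (auto simp: facet_mem_iff[OF F] facet_mem_iff[OF F''(1)] core'')
    then have "F \<subseteq> F''" by blast
    then show False using facetsD(3)[OF F facetsD(1)[OF F''(1)]] ne'' by simp
  qed
  moreover have "card (rest F - rest F'') \<le> 1"
  proof -
    have "card (rest F - rest F'') \<le> card (rest F'' - rest F)"
      using ge card_le_sym_Diff[OF rest_core_finite(1) rest_core_finite(1)] by blast
    moreover have "card (rest F - rest F'') + card (rest F'' - rest F) \<le> card T"
    proof -
      have "card (rest F - rest F'') + card (rest F'' - rest F) = card ((rest F - rest F'') \<union> (rest F'' - rest F))"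
        by (rule card_Un_disjoint[symmetric]) (use rest_core_finite in auto)
      also have "\<dots> \<le> card T" by (rule card_mono[OF finT]) (use rest_core_finite(4)[of F] rest_core_finite(4)[of F''] in auto)
      finally show ?thesis .
    qed
    ultimately show ?thesis using card_rest by linarith
  qed
  ultimately obtain v where v: "rest F - rest F'' = {v}"
    using rest_core_finite(1)[of F] by (metis Diff_eq_empty_iff card_0_eq card_1_singletonE finite_Diff le_neq_implies_less less_one)
  have diff: "F - F'' = {Inl v}"
  proof -
    have "z \<in> F - F'' \<longleftrightarrow> z \<in> Inl ` (rest F - rest F'')" for z
      using rest_core_finite(3,4)[of F] rest_core_finite(3,4)[of F'']
      by (cases z) (auto simp: facet_mem_iff[OF F] facet_mem_iff[OF F''(1)] core'')
    then have "F - F'' = Inl ` (rest F - rest F'')" by blast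
    then show ?thesis using v by simp
  qed
  have "v \<in> rest F" "v \<notin> rest F'" using v rest'' by auto
  then have "Inl v \<in> F - F'" by (auto simp: rest_def)
  then show ?thesis using diff F''(1) better by blast
qed

lemma facets_shelling: "\<exists>Fs. set Fs = {F \<in> facets H. card F = d} \<and> shelling {F \<in> facets H. d < card F} Fs"
proof -
  obtain xs where xs: "set xs = {F \<in> facets H. card F = d}" "distinct xs"
    using finite_distinct_list[of "{F \<in> facets H. card F = d}"] finite_facets[OF finH] by auto
  define Fs where "Fs = sort_key (\<lambda>F. card (core F)) xs"
  have Fs: "set Fs = {F \<in> facets H. card F = d}" "distinct Fs" using xs by (simp_all add: Fs_def)
  have sorted: "sorted (map (\<lambda>F. card (core F)) Fs)" by (simp add: Fs_def)
  have "shells ({F \<in> facets H. d < card F} \<union> set (take i Fs)) (Fs ! i)" if i: "i < length Fs" for i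
    unfolding shells_def
  proof
    define F where "F = Fs ! i"
    have F: "F \<in> facets H" "card F = d" using Fs(1) nth_mem[OF i] by (auto simp: F_def)
    fix F' assume F': "F' \<in> {F \<in> facets H. d < card F} \<union> set (take i Fs)"
    have taken: "F'' \<noteq> F \<and> card (core F'') \<le> card (core F) \<and> F'' \<in> facets H \<and> card F'' = d"
      if "F'' \<in> set (take i Fs)" for F''
    proof -
      obtain j where j: "j < i" "F'' = Fs ! j" using \<open>F'' \<in> set (take i Fs)\<close> i by (auto simp: in_set_conv_nth)
      then have "F'' \<noteq> F" using Fs(2) i by (simp add: F_def nth_eq_iff_index_eq)
      moreover have "card (core F'') \<le> card (core F)"
        using sorted_nth_mono[OF sorted, of j i] i j by (simp add: F_def)
      moreover have "F'' \<in> set Fs" using j i by simp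
      ultimately show ?thesis using Fs(1) by auto
    qed
    have less_taken: "F'' \<in> set (take i Fs)"
      if F'': "F'' \<in> facets H" "card F'' = d" "card (core F'') < card (core F)" for F''
    proof -
      have "F'' \<in> set Fs" using F'' Fs(1) by simp
      then obtain j where j: "j < length Fs" "F'' = Fs ! j" by (auto simp: in_set_conv_nth)
      have "j < i"
      proof (rule ccontr)
        assume "\<not> j < i"
        then have "card (core F) \<le> card (core F'')"
          using sorted_nth_mono[OF sorted, of i j] j by (simp add: F_def)
        then show False using F'' by simp
      qed
      then show ?thesis using j i by (auto simp: in_set_conv_nth intro!: exI[of _ j])
    qed
    have fac: "F' \<in> facets H" "F' \<noteq> F" "card F < card F' \<or> card F' = card F \<and> card (core F') \<le> card (core F)"
      using F' taken[of F'] F by auto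
    from facet_exchange[OF F(1) fac] obtain v F'' where vF:
      "v \<in> F - F'" "F'' \<in> facets H" "F - F'' = {v}"
      "card F < card F'' \<or> card F'' = card F \<and> (card (core F'') < card (core F) \<or> F'' = F')" by blast
    have "F'' \<in> {F \<in> facets H. d < card F} \<union> set (take i Fs)"
      using vF(2,4) less_taken[of F''] F' F(2) by auto
    then show "\<exists>v\<in>Fs ! i - F'. \<exists>F''\<in>{F \<in> facets H. d < card F} \<union> set (take i Fs). Fs ! i - F'' = {v}"
      using vF unfolding F_def by blast
  qed
  then have "shelling {F \<in> facets H. d < card F} Fs" by (rule shellingI)
  then show ?thesis using Fs(1) by blast
qed

text \<open>The set \<open>W\<close> contains exactly one end of each whisker. The variable of the other end vanishes modulo the
  prime of \<open>W\<close>, so that the sum of the two is a variable there.\<close>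

lemma weakly_regular_whiskers:
  fixes as :: "('v + 'v, 'k::field) mpoly list"
  assumes "distinct ys" "set ys \<subseteq> S" "W \<subseteq> vertices H" "\<And>y. y \<in> set ys \<Longrightarrow> Inr y \<in> W \<longleftrightarrow> Inl y \<notin> W"
    and "weakly_regular (polys (vertices H)) (sr_ideal (vertices H) {W - (Inl ` set ys \<union> Inr ` set ys)}) as"
  shows "weakly_regular (polys (vertices H)) (sr_ideal (vertices H) {W})
    (map (\<lambda>y. poly_var (Inl y) + poly_var (Inr y)) ys @ as)"
  using assms
proof (induction ys arbitrary: W)
  case (Cons y ys)
  define w where "w = (if Inl y \<in> W then Inl y else Inr y)"
  define w' where "w' = (if Inl y \<in> W then Inr y else Inl y)"
  have yS: "y \<in> S" using Cons.prems by simp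
  have w: "w \<in> W" "w' \<notin> W" using Cons.prems(4)[of y] by (auto simp: w_def w'_def)
  have w': "w' \<in> vertices H" using yS SV by (auto simp: w'_def whisker_def)
  have t: "poly_var (Inl y) + poly_var (Inr y) - poly_var w = (poly_var w' :: ('v + 'v, 'k) mpoly)"
    by (simp add: w_def w'_def)
  have eq: "W - {w} - (Inl ` set ys \<union> Inr ` set ys) = W - (Inl ` set (y # ys) \<union> Inr ` set (y # ys))"
    using w by (auto simp: w_def w'_def split: if_splits)
  have "weakly_regular (polys (vertices H)) (sr_ideal (vertices H) {W - {w}})
    (map (\<lambda>y. poly_var (Inl y) + poly_var (Inr y)) ys @ as)"
  proof (rule Cons.IH)
    fix z assume z: "z \<in> set ys"
    then have "w \<noteq> Inl z" "w \<noteq> Inr z" using Cons.prems(1) by (auto simp: w_def)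
    then show "Inr z \<in> W - {w} \<longleftrightarrow> Inl z \<notin> W - {w}" using Cons.prems(4)[of z] z by auto
  qed (use Cons.prems eq in auto)
  moreover have "poly_var (Inl y) + poly_var (Inr y) - poly_var w \<in> (sr_ideal (vertices H) {W} :: ('v + 'v, 'k) mpoly set)"
    unfolding t by (rule poly_var_mem_sr_ideal[OF w' w(2)])
  ultimately show ?case
    unfolding list.map append_Cons by (rule weakly_regular_variable_step[OF w(1) Cons.prems(3), rotated])
qed simp

lemma facets_regular:
  assumes "d \<in> card ` facets H"
  shows "\<exists>\<theta> :: ('v + 'v, 'k::field) mpoly list. length \<theta> = d \<and> set \<theta> \<subseteq> irrelevant_ideal (vertices H) \<and>
    (\<forall>F\<in>facets H. card F = d \<longrightarrow> weakly_regular (polys (vertices H)) (sr_ideal (vertices H) {F}) \<theta>)"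
proof -
  obtain F0 where F0: "F0 \<in> facets H" "d = card F0" using assms by auto
  define n where "n = card (rest F0)"
  have d: "d = n + card S" using card_facet[OF F0(1)] F0(2) by (simp add: n_def)
  have T: "finite (Inl ` T)" "card (Inl ` T :: ('v + 'v) set) \<le> 3" "Inl ` T \<subseteq> vertices H"
    "n \<le> card (Inl ` T :: ('v + 'v) set)"
    using finT card_rest card_mono[OF finT rest_core_finite(4)[of F0]] by (auto simp: card_image whisker_def n_def)
  obtain \<tau> :: "('v + 'v, 'k) mpoly list" where \<tau>: "length \<tau> = n" "set \<tau> \<subseteq> irrelevant_ideal (vertices H)"
    "\<And>W. W \<subseteq> Inl ` T \<Longrightarrow> card W = n \<Longrightarrow> weakly_regular (polys (vertices H)) (sr_ideal (vertices H) {W}) \<tau>"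
    using weakly_regular_small[OF T] by blast
  obtain ys where ys: "set ys = S" "distinct ys" using finite_distinct_list[OF finS] by auto
  define \<theta> where "\<theta> = map (\<lambda>y. poly_var (Inl y) + poly_var (Inr y) :: ('v + 'v, 'k) mpoly) ys @ \<tau>"
  have "length \<theta> = d" using d \<tau>(1) distinct_card[OF ys(2)] ys(1) by (simp add: \<theta>_def)
  moreover have "set \<theta> \<subseteq> irrelevant_ideal (vertices H)"
    using \<tau>(2) ys(1) SV by (auto simp: \<theta>_def whisker_def intro!: irrelevant_ideal_add poly_var_irrelevant)
  moreover have "weakly_regular (polys (vertices H)) (sr_ideal (vertices H) {F}) \<theta>"
    if F: "F \<in> facets H" "card F = d" for F
    unfolding \<theta>_def
  proof (rule weakly_regular_whiskers)
    have "z \<in> F - (Inl ` set ys \<union> Inr ` set ys) \<longleftrightarrow> z \<in> Inl ` rest F" for z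
      using rest_core_finite(3,4)[of F] ys(1) by (cases z) (auto simp: facet_mem_iff[OF F(1)])
    then have "F - (Inl ` set ys \<union> Inr ` set ys) = Inl ` rest F" by blast
    moreover have "card (Inl ` rest F :: ('v + 'v) set) = n"
      using card_facet[OF F(1)] F(2) d by (simp add: card_image)
    ultimately show "weakly_regular (polys (vertices H)) (sr_ideal (vertices H) {F - (Inl ` set ys \<union> Inr ` set ys)}) \<tau>"
      using \<tau>(3)[of "Inl ` rest F"] rest_core_finite(4)[of F] by auto
  qed (use ys facetsD(2)[OF F(1)] facet_whisker[OF F(1)] in auto)
  ultimately show ?thesis by blast
qed

lemma sequentially_cm_whisker: "sequentially_cm_graph TYPE('k::field) H"
proof -
  have fin: "F \<subseteq> vertices H \<and> finite F" if "F \<in> facets H" for F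
    using facetsD(2)[OF that] finH finite_subset by blast
  show ?thesis
    unfolding sequentially_cm_graph_def Let_def edge_ideal_eq[OF simple_H]
    by (rule shellable_sequentially_cohen_macaulay[OF finite_facets[OF finH] fin facets_shelling facets_regular])
qed

end

theorem corollary3p5:
  fixes G :: "'v ugraph" and S :: "'v set"
  assumes "simple_graph G"
    and "S \<subseteq> vertices G"
    and "int (card S) \<ge> int (card (vertices G)) - 3"
  shows "sequentially_cm_graph TYPE('k::field) (whisker G S)"
proof -
  have "finite S" using assms(1,2) finite_subset by (auto simp: simple_graph_def)
  then have "card (vertices G - S) \<le> 3" using assms(2,3) by (simp add: card_Diff_subset)
  then interpret whiskered G S using assms(1,2) by unfold_locales
  show ?thesis by (rule sequentially_cm_whisker)
qed

end
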